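(* Let $N = N_{\underline\mu,P} = \Gamma_{\underline\mu,P}\backslash(\mathbb{C}^{2n}\ltimes_\rho\mathbb{C}^{2m})$ be as constructed in the context. Then the (complex-valued) de Rham cohomology of $N$ satisfies $H^*_d(N)\simeq A^*_{\Gamma_{\underline\mu,P}}$ (isomorphism of graded vector spaces), where $A^*_{\Gamma_{\underline\mu,P}}$ is the graded space of differential forms on $N$ defined in the context.
   Context: Construction. Let $n,m\ge1$ and let $M\in\mathrm{SL}(2m,\mathbb{Z})$ be a matrix for which there exist $P\in \mathrm{GL}(2m,\mathbb{R})$ and a real number $\lambda\neq 0$ with $PMP^{-1} = \mathrm{diag}(e^{\lambda},e^{-\lambda},\dots,e^{\lambda},e^{-\lambda})$. Denote coordinates of $\mathbb{C}^{2n}$ by $w=(w_1,\dots,w_{2n})$ and of $\mathbb{C}^{2m}$ by $z=(z_1,\dots,z_{2m})$. Put $a(w) = w_1+\bar w_2+\cdots+w_{2n-1}+\bar w_{2n}$, and define $\rho:\mathbb{C}^{2n}\to \mathrm{GL}(2m,\mathbb{C})$ by $\rho(w) = \mathrm{diag}(e^{\lambda a(w)}, e^{-\lambda\overline{a(w)}},\dots,e^{\lambda a(w)},e^{-\lambda\overline{a(w)}})$. $\mathbb{C}^{2n}\ltimes_\rho\mathbb{C}^{2m}$ has product $(w',z')*(w,z) = (w'+w,\rho(w')z+z')$. Let $\underline\mu = \mathrm{diag}(\mu_1,\dots,\mu_{2n})$ with $\mu_i = \frac{2k_i\pi}{\lambda}$, $k_i\in\mathbb{Z}\setminus\{0\}$,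 and put $\Gamma'_{\underline\mu} = \mathbb{Z}^{2n}\oplus\sqrt{-1}\,\underline\mu\mathbb{Z}^{2n}$, $\Gamma''_P = P\mathbb{Z}^{2m}\oplus\sqrt{-1}\,P\mathbb{Z}^{2m}$. Then $\Gamma_{\underline\mu,P} = \Gamma'_{\underline\mu}\ltimes_\rho\Gamma''_P$ is a lattice in $\mathbb{C}^{2n}\ltimes_\rho\mathbb{C}^{2m}$. The forms $\varphi^i = dw_i$ ($i=1,\dots,2n$), $\psi^{2j+1} = e^{-\lambda a(w)}dz_{2j+1}$, $\psi^{2j+2} = e^{\lambda\overline{a(w)}}dz_{2j+2}$ ($j=0,\dots,m-1$) descend to $N$. Characters. To each form of the coframe associate a function (character) of $(w,z)\in \mathbb{C}^{2n}\ltimes_\rho\mathbb{C}^{2m}$: to every $\varphi^i$ and $\bar\varphi^i$ the constant $1$; to $\psi^{2j+1}$ the function $e^{\lambda a(w)}$; to $\bar\psi^{2j+1}$ the function $e^{\lambda\overline{a(w)}}$; to $\psi^{2j+2}$ the function $e^{-\lambda\overline{a(w)}}$; to $\bar\psi^{2j+2}$ the function $e^{-\lambda a(w)}$. For multiindices $I,J\subset\{1,\dots,2n\}$ and $K,H\subset\{1,\dots,2m\}$ let $\alpha_{IJKH}$ be the product of the characters associated with all the factors of $\varphi^I\wedge\bar\varphi^J\wedge\psi^K\wedge\bar\psi^H$. Define $$A^p_{\Gamma_{\underline\mu,P}} = \mathbb{C}\left\langle \alpha_{IJKH}\,\varphi^I\wedge\bar\varphi^J\wedge\psi^K\wedge\bar\psi^H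 \ :\ \alpha_{IJKH}|_{\Gamma_{\underline\mu,P}} = 1,\ |I|+|J|+|K|+|H| = p\right\rangle$$ (the complex linear span inside the complex-valued $p$-forms on $N$) and $A^*_{\Gamma_{\underline\mu,P}} = \bigoplus_pA^p_{\Gamma_{\underline\mu,P}}$. *)

theory Defs
  imports
    "HOL-Analysis.Analysis"
    "HOL-Combinatorics.Permutations"
    "HOL-Library.Function_Algebras"
    "HOL-Library.Set_Algebras"
begin

section \<open>Smooth differential forms on open sets of a normed space\<close>

text \<open>A complex-valued form assigns to a point and a list of tangent vectors a complex number;
  a p-form vanishes on lists whose length is not p.\<close>

type_synonym 'e form = "'e \<Rightarrow> 'e list \<Rightarrow> complex"

primrec ck_on :: "nat \<Rightarrow> 'e::real_normed_vector set \<Rightarrow> ('e \<Rightarrow> 'f::real_normed_vector) \<Rightarrow> bool" where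
  "ck_on 0 U f \<longleftrightarrow> continuous_on U f"
| "ck_on (Suc k) U f \<longleftrightarrow>
     (\<forall>x\<in>U. f differentiable (at x)) \<and> (\<forall>v. ck_on k U (\<lambda>x. frechet_derivative f (at x) v))"

definition smooth_on :: "'e::real_normed_vector set \<Rightarrow> ('e \<Rightarrow> 'f::real_normed_vector) \<Rightarrow> bool" where
  "smooth_on U f \<longleftrightarrow> (\<forall>k. ck_on k U f)"

definition alternating :: "nat \<Rightarrow> ('e::real_vector list \<Rightarrow> complex) \<Rightarrow> bool" where
  "alternating p f \<longleftrightarrow>
     (\<forall>vs. length vs \<noteq> p \<longrightarrow> f vs = 0) \<and>
     (\<forall>us vs. length us + 1 + length vs = p \<longrightarrow> linear (\<lambda>v. f (us @ v # vs))) \<and>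
     (\<forall>vs. \<not> distinct vs \<longrightarrow> f vs = 0)"

text \<open>Forms on an open set \<open>U\<close> are extended by zero to the whole space, so that equality of
  forms on \<open>U\<close> is equality of functions.\<close>

definition forms_on :: "nat \<Rightarrow> 'e::real_normed_vector set \<Rightarrow> 'e form set" where
  "forms_on p U = {\<omega>. (\<forall>x\<in>U. alternating p (\<omega> x)) \<and>
                      (\<forall>vs. smooth_on U (\<lambda>x. \<omega> x vs)) \<and>
                      (\<forall>x. x \<notin> U \<longrightarrow> \<omega> x = 0)}"

definition restrict_form :: "'e set \<Rightarrow> 'e form \<Rightarrow> 'e form" where
  "restrict_form U \<omega> = (\<lambda>x. if x \<in> U then \<omega> x else 0)"

definition ext_deriv :: "'e::real_normed_vector set \<Rightarrow> 'e form \<Rightarrow> 'e form" where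
  "ext_deriv U \<omega> = restrict_form U (\<lambda>x vs. \<Sum>i<length vs.
     (-1) ^ i * frechet_derivative (\<lambda>y. \<omega> y (take i vs @ drop (Suc i) vs)) (at x) (vs ! i))"

definition pullback :: "('e::real_normed_vector \<Rightarrow> 'e) \<Rightarrow> 'e form \<Rightarrow> 'e form" where
  "pullback f \<omega> = (\<lambda>x vs. \<omega> (f x) (map (frechet_derivative f (at x)) vs))"

definition wedge :: "('e \<Rightarrow> 'e \<Rightarrow> complex) list \<Rightarrow> 'e form" where
  "wedge \<theta>s = (\<lambda>x vs. if length vs = length \<theta>s
     then \<Sum>\<pi> | \<pi> permutes {..<length \<theta>s}. of_int (sign \<pi>) * (\<Prod>i<length \<theta>s. (\<theta>s ! i) x (vs ! \<pi> i))
     else 0)"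


section \<open>Differential forms on a manifold given by an atlas, and de Rham cohomology\<close>

text \<open>An atlas is given by local parametrizations: a chart \<open>(U, \<phi>)\<close> consists of an open set \<open>U\<close>
  of the model space and an injective map \<open>\<phi>\<close> from \<open>U\<close> onto a subset of the manifold.\<close>

type_synonym ('a, 'e) chart = "'e set \<times> ('e \<Rightarrow> 'a)"

definition overlap :: "('a, 'e) chart \<Rightarrow> ('a, 'e) chart \<Rightarrow> 'e set" where
  "overlap c c' = {x \<in> fst c. snd c x \<in> snd c' ` fst c'}"

definition transition :: "('a, 'e) chart \<Rightarrow> ('a, 'e) chart \<Rightarrow> 'e \<Rightarrow> 'e" where
  "transition c c' = inv_into (fst c') (snd c') \<circ> snd c"

text \<open>A form on the manifold is the family of its local representatives, which correspond to each
  other under the transition maps.\<close>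

type_synonym ('a, 'e) mform = "('a, 'e) chart \<Rightarrow> 'e form"

definition mforms :: "('a, 'e::real_normed_vector) chart set \<Rightarrow> nat \<Rightarrow> ('a, 'e) mform set" where
  "mforms \<A> p = {\<omega>. (\<forall>c. c \<notin> \<A> \<longrightarrow> \<omega> c = 0) \<and>
                    (\<forall>c\<in>\<A>. \<omega> c \<in> forms_on p (fst c)) \<and>
                    (\<forall>c\<in>\<A>. \<forall>c'\<in>\<A>. \<forall>x\<in>overlap c c'. \<omega> c x = pullback (transition c c') (\<omega> c') x)}"

definition mderiv :: "('a, 'e::real_normed_vector) mform \<Rightarrow> ('a, 'e) mform" where
  "mderiv \<omega> = (\<lambda>c. ext_deriv (fst c) (\<omega> c))"

definition mscale :: "complex \<Rightarrow> ('a, 'e) mform \<Rightarrow> ('a, 'e) mform" where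
  "mscale z \<omega> = (\<lambda>c x vs. z * \<omega> c x vs)"

interpretation mform: vector_space mscale
  by unfold_locales (auto simp: mscale_def plus_fun_def fun_eq_iff algebra_simps)

definition closed_forms :: "('a, 'e::real_normed_vector) chart set \<Rightarrow> nat \<Rightarrow> ('a, 'e) mform set" where
  "closed_forms \<A> p = {\<omega> \<in> mforms \<A> p. mderiv \<omega> = 0}"

definition exact_forms :: "('a, 'e::real_normed_vector) chart set \<Rightarrow> nat \<Rightarrow> ('a, 'e) mform set" where
  "exact_forms \<A> p = (case p of 0 \<Rightarrow> {0} | Suc q \<Rightarrow> mderiv ` mforms \<A> q)"

text \<open>The quotient space of closed by exact forms consists of cosets. Addition of cosets is
  addition of sets; in the scalar multiplication the summand \<open>exact_forms\<close> only matters for the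
  scalar 0.\<close>

definition de_Rham :: "('a, 'e::real_normed_vector) chart set \<Rightarrow> nat \<Rightarrow> ('a, 'e) mform set set" where
  "de_Rham \<A> p = (\<lambda>\<omega>. \<omega> +o exact_forms \<A> p) ` closed_forms \<A> p"

definition class_scale :: "('a, 'e::real_normed_vector) chart set \<Rightarrow> nat \<Rightarrow> complex \<Rightarrow>
    ('a, 'e) mform set \<Rightarrow> ('a, 'e) mform set" where
  "class_scale \<A> p z X = mscale z ` X + exact_forms \<A> p"

definition linear_iso :: "('u::plus) set \<Rightarrow> (complex \<Rightarrow> 'u \<Rightarrow> 'u) \<Rightarrow>
    ('v::plus) set \<Rightarrow> (complex \<Rightarrow> 'v \<Rightarrow> 'v) \<Rightarrow> ('u \<Rightarrow> 'v) \<Rightarrow> bool" where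
  "linear_iso V s W t f \<longleftrightarrow> bij_betw f V W \<and>
     (\<forall>x\<in>V. \<forall>y\<in>V. f (x + y) = f x + f y) \<and> (\<forall>z. \<forall>x\<in>V. f (s z x) = t z (f x))"


section \<open>The group and the lattice\<close>

text \<open>The coordinates \<open>w_(2i-1)\<close>, \<open>w_(2i)\<close> are indexed by the pairs \<open>(i, False)\<close>, \<open>(i, True)\<close>,
  and likewise for \<open>z\<close>. The sizes n and m are the cardinalities of the finite linearly ordered
  types \<open>'n\<close> and \<open>'m\<close>.\<close>

type_synonym ('n, 'm) G = "(complex ^ ('n \<times> bool)) \<times> (complex ^ ('m \<times> bool))"

definition diag_mat :: "'a::zero ^ 'i \<Rightarrow> 'a ^ 'i ^ 'i" where
  "diag_mat d = (\<chi> i j. if i = j then d $ i else 0)"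

definition a_fun :: "complex ^ ('n::finite \<times> bool) \<Rightarrow> complex" where
  "a_fun w = (\<Sum>i\<in>UNIV. w $ (i, False) + cnj (w $ (i, True)))"

definition rho :: "real \<Rightarrow> complex ^ ('n::finite \<times> bool) \<Rightarrow>
    complex ^ ('m::finite \<times> bool) ^ ('m \<times> bool)" where
  "rho l w = diag_mat (\<chi> i. if snd i then exp (- of_real l * cnj (a_fun w))
                                    else exp (of_real l * a_fun w))"

definition gmult :: "real \<Rightarrow> ('n::finite, 'm::finite) G \<Rightarrow> ('n, 'm) G \<Rightarrow> ('n, 'm) G" where
  "gmult l g h = (fst g + fst h, rho l (fst g) *v snd h + snd g)"

definition int_vecs :: "(real ^ 'i) set" where
  "int_vecs = {v. \<forall>i. v $ i \<in> \<int>}"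

definition cvec :: "real ^ 'i \<Rightarrow> complex ^ 'i" where
  "cvec v = (\<chi> i. of_real (v $ i))"

definition Gamma1 :: "real ^ ('n::finite \<times> bool) ^ ('n \<times> bool) \<Rightarrow> (complex ^ ('n \<times> bool)) set" where
  "Gamma1 \<mu> = {cvec a + \<i> *s cvec (\<mu> *v b) | a b. a \<in> int_vecs \<and> b \<in> int_vecs}"

definition Gamma2 :: "real ^ ('m::finite \<times> bool) ^ ('m \<times> bool) \<Rightarrow> (complex ^ ('m \<times> bool)) set" where
  "Gamma2 P = {cvec (P *v a) + \<i> *s cvec (P *v b) | a b. a \<in> int_vecs \<and> b \<in> int_vecs}"

definition Gamma :: "real ^ ('n::finite \<times> bool) ^ ('n \<times> bool) \<Rightarrow>
    real ^ ('m::finite \<times> bool) ^ ('m \<times> bool) \<Rightarrow> ('n, 'm) G set" where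
  "Gamma \<mu> P = Gamma1 \<mu> \<times> Gamma2 P"


section \<open>The quotient manifold\<close>

text \<open>The points of the quotient are the cosets \<open>\<Gamma> g\<close>. Its charts are the restrictions of the
  projection to the open sets on which it is injective.\<close>

definition proj :: "real \<Rightarrow> ('n::finite, 'm::finite) G set \<Rightarrow> ('n, 'm) G \<Rightarrow> ('n, 'm) G set" where
  "proj l \<Gamma> g = (\<lambda>\<gamma>. gmult l \<gamma> g) ` \<Gamma>"

definition quotient_atlas :: "real \<Rightarrow> ('n::finite, 'm::finite) G set \<Rightarrow>
    (('n, 'm) G set, ('n, 'm) G) chart set" where
  "quotient_atlas l \<Gamma> = {(U, proj l \<Gamma>) | U. open U \<and> inj_on (proj l \<Gamma>) U}"

text \<open>The form on the quotient to which a \<open>\<Gamma>\<close>-invariant form on the group descends. As the charts are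
  restrictions of the projection, its local representatives are restrictions of the given form.\<close>

definition descend :: "real \<Rightarrow> ('n::finite, 'm::finite) G set \<Rightarrow> ('n, 'm) G form \<Rightarrow>
    (('n, 'm) G set, ('n, 'm) G) mform" where
  "descend l \<Gamma> \<omega> = (\<lambda>c. if c \<in> quotient_atlas l \<Gamma> then restrict_form (fst c) \<omega> else 0)"


section \<open>The coframe, the characters and the space of forms\<close>

definition phi :: "'n::finite \<times> bool \<Rightarrow> ('n, 'm::finite) G \<Rightarrow> ('n, 'm) G \<Rightarrow> complex" where
  "phi i g v = fst v $ i"

definition psi :: "real \<Rightarrow> 'm::finite \<times> bool \<Rightarrow> ('n::finite, 'm) G \<Rightarrow> ('n, 'm) G \<Rightarrow> complex" where
  "psi l k g v = (if snd k then exp (of_real l * cnj (a_fun (fst g)))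
                           else exp (- of_real l * a_fun (fst g))) * snd v $ k"

definition phi_bar :: "'n::finite \<times> bool \<Rightarrow> ('n, 'm::finite) G \<Rightarrow> ('n, 'm) G \<Rightarrow> complex" where
  "phi_bar i g v = cnj (phi i g v)"

definition psi_bar :: "real \<Rightarrow> 'm::finite \<times> bool \<Rightarrow> ('n::finite, 'm) G \<Rightarrow> ('n, 'm) G \<Rightarrow> complex" where
  "psi_bar l k g v = cnj (psi l k g v)"

definition char_psi :: "real \<Rightarrow> 'm::finite \<times> bool \<Rightarrow> ('n::finite, 'm) G \<Rightarrow> complex" where
  "char_psi l k g = (if snd k then exp (- of_real l * cnj (a_fun (fst g)))
                              else exp (of_real l * a_fun (fst g)))"

definition char_psi_bar :: "real \<Rightarrow> 'm::finite \<times> bool \<Rightarrow> ('n::finite, 'm) G \<Rightarrow> complex" where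
  "char_psi_bar l k g = (if snd k then exp (- of_real l * a_fun (fst g))
                                  else exp (of_real l * cnj (a_fun (fst g))))"

definition char_phi :: "'n::finite \<times> bool \<Rightarrow> ('n, 'm::finite) G \<Rightarrow> complex" where
  "char_phi i g = 1"

definition char_phi_bar :: "'n::finite \<times> bool \<Rightarrow> ('n, 'm::finite) G \<Rightarrow> complex" where
  "char_phi_bar i g = 1"

definition alpha :: "real \<Rightarrow> ('n::finite \<times> bool) set \<Rightarrow> ('n \<times> bool) set \<Rightarrow>
    ('m::finite \<times> bool) set \<Rightarrow> ('m \<times> bool) set \<Rightarrow> ('n, 'm) G \<Rightarrow> complex" where
  "alpha l I J K H g = (\<Prod>i\<in>I. char_phi i g) * (\<Prod>j\<in>J. char_phi_bar j g) *
     (\<Prod>k\<in>K. char_psi l k g) * (\<Prod>h\<in>H. char_psi_bar l h g)"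

text \<open>The elements of a multiindex in the order 1, 2, 3, ... of the coordinates.\<close>

definition index_list :: "('k::{finite,linorder} \<times> bool) set \<Rightarrow> ('k \<times> bool) list" where
  "index_list I = filter (\<lambda>i. i \<in> I) (List.product (sorted_list_of_set UNIV) [False, True])"

definition coframe_wedge :: "real \<Rightarrow> ('n::{finite,linorder} \<times> bool) set \<Rightarrow> ('n \<times> bool) set \<Rightarrow>
    ('m::{finite,linorder} \<times> bool) set \<Rightarrow> ('m \<times> bool) set \<Rightarrow> ('n, 'm) G form" where
  "coframe_wedge l I J K H =
     wedge (map phi (index_list I) @ map phi_bar (index_list J) @
            map (psi l) (index_list K) @ map (psi_bar l) (index_list H))"

definition A_space :: "real \<Rightarrow> ('n::{finite,linorder}, 'm::{finite,linorder}) G set \<Rightarrow> nat \<Rightarrow>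
    (('n, 'm) G set, ('n, 'm) G) mform set" where
  "A_space l \<Gamma> p = mform.span
     {descend l \<Gamma> (\<lambda>g vs. alpha l I J K H g * coframe_wedge l I J K H g vs) | I J K H.
        (\<forall>g\<in>\<Gamma>. alpha l I J K H g = 1) \<and> card I + card J + card K + card H = p}"

end

(* On the lattice the character exp (l a(w)) takes the real value exp (l s) with s = Re a(w) an
   integer, so Gamma acts on the real vector space of all (w, z) by x |-> R(s) x + gamma, where R(s)
   stretches z by exp (l s) and exp (- l s). Hence N is the mapping torus of the linear automorphism
   R(1) of the torus ker s / (Gamma n ker s). Averaging an invariant closed form over the fibre torus,
   then projecting to the eigenvalue 1 of R(1)*, then averaging over the base circle changes it only by
   differentials of invariant forms: R(1)* acts as the identity on cohomology because R(1) is isotopic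
   to the identity through translations along the base. The result is a constant coefficient form fixed
   by R(1)*. A differential is sent to 0, and the constant coefficient forms fixed by R(1)* are exactly
   the combinations of dw_I dwbar_J dz_K dzbar_H whose character is trivial on Gamma. *)

theory Submission
  imports Defs
begin

section \<open>Smooth functions\<close>

text \<open>Every operator has to stay within the invariant forms. The fibre average does, because
  it does not depend on the spanning vectors along which it is taken; the homotopy to it does not,
  and repairing this costs a partition of unity on the base and a correction. Let T be the pullback
  by R(1). The projection to its eigenvalue 1 is a product of factors (T - q) / (1 - q). Each factor
  is the identity plus a multiple of T - 1, which sends closed invariant forms to differentials of
  invariant forms, and the product over the other eigenvalues q annihilates all of them. These are
  finitely many: a monomial of degree p has eigenvalue exp (l j) with \<bar>j\<bar> \<le> p. The
  order of the three operations matters. Only after the fibre average does T act on the values of a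
  form alone, and only after the projection is the form periodic along the base, so that its average
  there is constant. The basic homotopies come from Cartan's formula for a constant vector v: the
  derivative along v is d i_v + i_v d, and integrating it along v writes a difference of closed
  forms as a differential. Forms on N are the invariant forms upstairs because the charts restrict
  the projection.\<close>

abbreviation dird :: "('e::real_normed_vector \<Rightarrow> 'f::real_normed_vector) \<Rightarrow> 'e \<Rightarrow> 'e \<Rightarrow> 'f" where
  "dird f x v \<equiv> frechet_derivative f (at x) v"

lemma has_derivative_dird:
  "f differentiable (at x) \<Longrightarrow> (f has_derivative dird f x) (at x)"
  by (simp add: frechet_derivative_works)

lemma dird_eq: "(f has_derivative f') (at x) \<Longrightarrow> dird f x v = f' v"
  using frechet_derivative_at by metis

lemma differentiable_has_derivativeI: "(f has_derivative f') (at x) \<Longrightarrow> f differentiable (at x)"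
  by (auto simp: differentiable_def)

lemma dird_cong_open:
  assumes "open U" "x \<in> U" "\<And>y. y \<in> U \<Longrightarrow> f y = g y"
  shows "dird f x v = dird g x v" "f differentiable (at x) \<longleftrightarrow> g differentiable (at x)"
proof -
  have *: "(f has_derivative f') (at x) \<longleftrightarrow> (g has_derivative f') (at x)" for f'
    using assms has_derivative_transform_within_open[of f f' x UNIV U g]
      has_derivative_transform_within_open[of g f' x UNIV U f] by auto
  then show "dird f x v = dird g x v" by (simp add: frechet_derivative_def)
  show "f differentiable (at x) \<longleftrightarrow> g differentiable (at x)" using * by (simp add: differentiable_def)
qed

text \<open>Above level 0 the recursion of \<open>ck_on\<close> does not mention continuity; it is
  recovered from differentiability at the bottom of the induction.\<close>

lemma ck_on_Suc_imp: "ck_on (Suc k) U f \<Longrightarrow> ck_on k U f"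
proof (induction k arbitrary: f)
  case 0
  then show ?case
    by (auto simp: continuous_on_eq_continuous_within
        intro: differentiable_imp_continuous_within differentiable_at_withinI)
next
  case (Suc k)
  then show ?case by (simp only: ck_on.simps(2)) blast
qed

lemma ck_on_subset: "ck_on k U f \<Longrightarrow> V \<subseteq> U \<Longrightarrow> ck_on k V f"
  by (induction k arbitrary: f) (auto intro: continuous_on_subset)

lemma ck_on_cong:
  "open U \<Longrightarrow> (\<And>x. x \<in> U \<Longrightarrow> f x = g x) \<Longrightarrow> ck_on k U f \<longleftrightarrow> ck_on k U g"
proof (induction k arbitrary: f g)
  case 0
  then show ?case by (auto intro: continuous_on_cong[THEN iffD1])
next
  case (Suc k)
  have "ck_on k U (\<lambda>x. dird f x v) \<longleftrightarrow> ck_on k U (\<lambda>x. dird g x v)" for v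
    using Suc.prems by (intro Suc.IH) (auto intro: dird_cong_open(1))
  then show ?case using dird_cong_open(2)[OF Suc.prems(1) _ Suc.prems(2)] by auto
qed

text \<open>Used where a function has a smooth formula only near each point: for sums over
  translates and for forms glued from charts.\<close>

lemma ck_on_local:
  "(\<And>x. x \<in> U \<Longrightarrow> \<exists>V. open V \<and> x \<in> V \<and> ck_on k V f) \<Longrightarrow> ck_on k U f"
proof (induction k arbitrary: f)
  case 0
  have "isCont f x" if "x \<in> U" for x
    using 0[OF that] by (auto simp: continuous_on_eq_continuous_at)
  then show ?case by (simp add: continuous_at_imp_continuous_on)
next
  case (Suc k)
  have "ck_on k U (\<lambda>x. dird f x v)" for v
    using Suc.prems by (intro Suc.IH) (metis ck_on.simps(2))
  then show ?case using Suc.prems by (metis ck_on.simps(2))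
qed

lemma ck_on_const: "ck_on k U (\<lambda>x. c)"
  by (induction k arbitrary: c) auto

lemma ck_on_bounded_linear:
  assumes "bounded_linear h" "open U"
  shows "ck_on k U f \<Longrightarrow> ck_on k U (\<lambda>x. h (f x))"
proof (induction k arbitrary: f)
  case 0
  then show ?case using assms(1) by (simp add: linear_continuous_on bounded_linear.continuous_on)
next
  case (Suc k)
  have d: "((\<lambda>x. h (f x)) has_derivative (\<lambda>v. h (dird f x v))) (at x)" if "x \<in> U" for x
    using that Suc.prems by (intro bounded_linear.has_derivative[OF assms(1)] has_derivative_dird) auto
  have "ck_on k U (\<lambda>x. dird (\<lambda>x. h (f x)) x v)" for v
    using Suc.IH Suc.prems ck_on_cong[OF assms(2), of "\<lambda>x. dird (\<lambda>x. h (f x)) x v" "\<lambda>x. h (dird f x v)"]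
      dird_eq[OF d] by auto
  then show ?case using d by (auto intro: differentiable_has_derivativeI)
qed

lemma ck_on_add:
  assumes "open U"
  shows "ck_on k U f \<Longrightarrow> ck_on k U g \<Longrightarrow> ck_on k U (\<lambda>x. f x + g x)"
proof (induction k arbitrary: f g)
  case 0
  then show ?case by (auto intro: continuous_on_add)
next
  case (Suc k)
  have d: "((\<lambda>x. f x + g x) has_derivative (\<lambda>v. dird f x v + dird g x v)) (at x)" if "x \<in> U" for x
    using that Suc.prems by (intro has_derivative_add has_derivative_dird) auto
  have "ck_on k U (\<lambda>x. dird (\<lambda>x. f x + g x) x v)" for v
    using Suc.IH Suc.prems dird_eq[OF d]
      ck_on_cong[OF assms, of "\<lambda>x. dird (\<lambda>x. f x + g x) x v" "\<lambda>x. dird f x v + dird g x v"] by auto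
  then show ?case using d by (auto intro: differentiable_has_derivativeI)
qed

lemma ck_on_mult:
  fixes f g :: "'e::real_normed_vector \<Rightarrow> 'f::real_normed_algebra"
  assumes "open U"
  shows "ck_on k U f \<Longrightarrow> ck_on k U g \<Longrightarrow> ck_on k U (\<lambda>x. f x * g x)"
proof (induction k arbitrary: f g)
  case 0
  then show ?case by (auto intro: continuous_on_mult)
next
  case (Suc k)
  have d: "((\<lambda>x. f x * g x) has_derivative (\<lambda>v. f x * dird g x v + dird f x v * g x)) (at x)"
    if "x \<in> U" for x
    using that Suc.prems by (intro has_derivative_mult has_derivative_dird) auto
  \<comment> \<open>The product rule leaves undifferentiated factors, so \<open>f\<close> and
    \<open>g\<close> themselves are needed at level \<open>k\<close>.\<close>
  have "ck_on k U f" "ck_on k U g" using Suc.prems ck_on_Suc_imp by blast+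
  then have "ck_on k U (\<lambda>x. f x * dird g x v + dird f x v * g x)" for v
    using Suc by (intro ck_on_add[OF assms]) auto
  then have "ck_on k U (\<lambda>x. dird (\<lambda>x. f x * g x) x v)" for v
    using dird_eq[OF d] ck_on_cong[OF assms, of "\<lambda>x. dird (\<lambda>x. f x * g x) x v"
        "\<lambda>x. f x * dird g x v + dird f x v * g x"] by auto
  then show ?case using d by (auto intro: differentiable_has_derivativeI)
qed

lemma has_derivative_affine:
  assumes "bounded_linear A" "f differentiable (at (A x + c))"
  shows "((\<lambda>x. f (A x + c)) has_derivative (\<lambda>v. dird f (A x + c) (A v))) (at x)"
proof -
  have "((\<lambda>x. A x + c) has_derivative A) (at x)"
    using assms(1) by (auto intro!: derivative_eq_intros bounded_linear_imp_has_derivative)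
  from diff_chain_at[OF this has_derivative_dird[OF assms(2)]] show ?thesis by (simp add: o_def)
qed

lemma ck_on_affine:
  assumes "bounded_linear A"
  shows "ck_on k UNIV f \<Longrightarrow> ck_on k UNIV (\<lambda>x. f (A x + c))"
proof (induction k arbitrary: f)
  case 0
  have "continuous_on UNIV (\<lambda>x. A x + c)"
    using assms by (intro continuous_intros) (simp add: linear_continuous_on)
  with 0 show ?case using continuous_on_compose2[of UNIV f UNIV "\<lambda>x. A x + c"] by simp
next
  case (Suc k)
  have d: "((\<lambda>x. f (A x + c)) has_derivative (\<lambda>v. dird f (A x + c) (A v))) (at x)" for x
    using Suc.prems assms by (auto intro: has_derivative_affine)
  have "ck_on k UNIV (\<lambda>x. dird f (A x + c) (A v))" for v
    using Suc.IH[of "\<lambda>x. dird f x (A v)"] Suc.prems by auto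
  then show ?case using dird_eq[OF d] differentiable_has_derivativeI[OF d] by simp
qed

abbreviation smooth :: "('e::real_normed_vector \<Rightarrow> 'f::real_normed_vector) \<Rightarrow> bool" where
  "smooth \<equiv> smooth_on UNIV"

lemma smooth_dird: "smooth f \<Longrightarrow> smooth (\<lambda>x. dird f x v)"
  unfolding smooth_on_def using ck_on.simps(2) by metis

lemma smooth_differentiable: "smooth f \<Longrightarrow> f differentiable (at x)"
  unfolding smooth_on_def using ck_on.simps(2)[of 0 UNIV f] by blast

lemma smooth_continuous: "smooth f \<Longrightarrow> continuous_on UNIV f"
  unfolding smooth_on_def by (metis ck_on.simps(1))

lemma smooth_has_derivative: "smooth f \<Longrightarrow> (f has_derivative dird f x) (at x)"
  by (simp add: has_derivative_dird smooth_differentiable)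

lemma smooth_linear_dird: "smooth f \<Longrightarrow> linear (dird f x)"
  using smooth_has_derivative has_derivative_linear by blast

lemma smooth_const [intro]: "smooth (\<lambda>x. c)"
  by (simp add: smooth_on_def ck_on_const)

lemma smooth_add [intro]: "smooth f \<Longrightarrow> smooth g \<Longrightarrow> smooth (\<lambda>x. f x + g x)"
  by (simp add: smooth_on_def ck_on_add)

lemma smooth_mult [intro]:
  fixes f g :: "'e::real_normed_vector \<Rightarrow> 'f::real_normed_algebra"
  shows "smooth f \<Longrightarrow> smooth g \<Longrightarrow> smooth (\<lambda>x. f x * g x)"
  by (simp add: smooth_on_def ck_on_mult)

lemma smooth_sum [intro]: "(\<And>i. i \<in> I \<Longrightarrow> smooth (f i)) \<Longrightarrow> smooth (\<lambda>x. \<Sum>i\<in>I. f i x)"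
  by (induction I rule: infinite_finite_induct) auto

lemma smooth_affine: "bounded_linear A \<Longrightarrow> smooth f \<Longrightarrow> smooth (\<lambda>x. f (A x + c))"
  by (simp add: smooth_on_def ck_on_affine)

lemma smooth_bounded_linear: "bounded_linear h \<Longrightarrow> smooth f \<Longrightarrow> smooth (\<lambda>x. h (f x))"
  by (simp add: smooth_on_def ck_on_bounded_linear)

lemma smooth_local:
  assumes "\<And>x. \<exists>V g. open V \<and> x \<in> V \<and> smooth g \<and> (\<forall>y\<in>V. f y = g y)"
  shows "smooth f"
  unfolding smooth_on_def
proof (intro allI ck_on_local)
  fix k x
  obtain V g where V: "open V" "x \<in> V" "smooth g" "\<forall>y\<in>V. f y = g y" using assms by blast
  then have "ck_on k V g" using ck_on_subset unfolding smooth_on_def by blast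
  then have "ck_on k V f" using V ck_on_cong[of V f g] by auto
  then show "\<exists>V. open V \<and> x \<in> V \<and> ck_on k V f" using V by blast
qed

text \<open>Differentiation under the integral sign. \<open>leibniz_rule\<close> wants the
  derivative as a continuous family \<open>F\<close> of bounded linear maps; in finite dimension
  this continuity can be tested on one vector at a time.\<close>

lemma has_derivative_integral_translate:
  fixes f :: "'e::euclidean_space \<Rightarrow> complex"
  assumes "smooth f" "continuous_on UNIV \<phi>"
  shows "((\<lambda>x. integral {0..1} (\<lambda>t. \<phi> t * f (x + t *\<^sub>R v))) has_derivative
          (\<lambda>u. integral {0..1} (\<lambda>t. \<phi> t * dird f (x + t *\<^sub>R v) u))) (at x)"
proof -
  have bl: "bounded_linear (\<lambda>u. \<phi> t * dird f (x + t *\<^sub>R v) u)" for x t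
    using smooth_linear_dird[OF assms(1)]
    by (intro bounded_linear_mult_right[THEN bounded_linear_compose]) (simp add: linear_conv_bounded_linear)
  define F where "F x t = Blinfun (\<lambda>u. \<phi> t * dird f (x + t *\<^sub>R v) u)" for x t
  have F: "blinfun_apply (F x t) u = \<phi> t * dird f (x + t *\<^sub>R v) u" for x t u
    unfolding F_def by (simp add: bounded_linear_Blinfun_apply[OF bl])
  have cont: "continuous_on S (\<lambda>z. g (fst z + snd z *\<^sub>R v))" if "smooth g" for g :: "'e \<Rightarrow> complex" and S
    by (rule continuous_on_compose2[OF smooth_continuous[OF that]]) (auto intro!: continuous_intros)
  have cphi: "continuous_on S (\<lambda>z. \<phi> (snd z))" for S :: "('e \<times> real) set"
    by (rule continuous_on_compose2[OF assms(2)]) (auto intro!: continuous_intros)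
  have cf: "continuous_on S (\<lambda>t. \<phi> t * f (x + t *\<^sub>R v))" for x S
    by (intro continuous_intros continuous_on_compose2[OF smooth_continuous[OF assms(1)]]
        continuous_on_subset[OF assms(2)]) auto
  have cF: "continuous_on (UNIV \<times> cbox 0 1) (\<lambda>(x, t). F x t)"
    by (rule continuous_on_blinfun_componentwise)
      (auto simp: split_beta F intro!: continuous_intros cphi cont smooth_dird assms(1))
  have "((\<lambda>x. integral (cbox 0 1) (\<lambda>t. \<phi> t * f (x + t *\<^sub>R v))) has_derivative integral (cbox 0 1) (F x))
      (at x within UNIV)"
  proof (rule leibniz_rule[OF _ _ cF])
    fix x t
    have "((\<lambda>x. f (x + t *\<^sub>R v)) has_derivative dird f (x + t *\<^sub>R v)) (at x)"
      using has_derivative_affine[of id f x "t *\<^sub>R v"] smooth_differentiable[OF assms(1)]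
      by (simp add: id_def)
    then show "((\<lambda>x. \<phi> t * f (x + t *\<^sub>R v)) has_derivative (F x t)) (at x within UNIV)"
      using F by (auto intro!: derivative_eq_intros)
    show "(\<lambda>t. \<phi> t * f (x + t *\<^sub>R v)) integrable_on cbox 0 1" for x
      by (rule integrable_continuous) (rule cf)
  qed auto
  moreover have "F x integrable_on cbox 0 1"
    by (rule integrable_continuous, rule continuous_on_blinfun_componentwise)
      (auto simp: F intro!: continuous_intros continuous_on_subset[OF assms(2)]
        continuous_on_compose2[OF smooth_continuous[OF smooth_dird[OF assms(1)]]])
  then have "blinfun_apply (integral (cbox 0 1) (F x))
      = (\<lambda>u. integral (cbox 0 1) (\<lambda>t. \<phi> t * dird f (x + t *\<^sub>R v) u))"
    by (intro ext, subst blinfun_apply_integral) (auto simp: F)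
  ultimately show ?thesis by simp
qed

lemma continuous_on_integral_translate:
  fixes f :: "'e::euclidean_space \<Rightarrow> complex"
  assumes "continuous_on UNIV f" "continuous_on UNIV \<phi>"
  shows "continuous_on UNIV (\<lambda>x. integral {0..1} (\<lambda>t. \<phi> t * f (x + t *\<^sub>R v)))"
proof -
  have "continuous_on UNIV (\<lambda>x. integral (cbox 0 1) (\<lambda>t. \<phi> t * f (x + t *\<^sub>R v)))"
    by (rule integral_continuous_on_param)
      (auto simp: split_beta intro!: continuous_intros continuous_on_compose2[OF assms(1)]
        continuous_on_compose2[OF assms(2)])
  then show ?thesis by simp
qed

text \<open>A directional derivative of such an integral is the same integral for a derivative of
  \<open>f\<close>, so the induction on the order closes up.\<close>

lemma smooth_integral_translate:
  fixes f :: "'e::euclidean_space \<Rightarrow> complex"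
  assumes "smooth f" "continuous_on UNIV \<phi>"
  shows "smooth (\<lambda>x. integral {0..1} (\<lambda>t. \<phi> t * f (x + t *\<^sub>R v)))"
proof -
  have "smooth f \<Longrightarrow> ck_on k UNIV (\<lambda>x. integral {0..1} (\<lambda>t. \<phi> t * f (x + t *\<^sub>R v)))" for k
  proof (induction k arbitrary: f)
    case 0
    then show ?case using continuous_on_integral_translate smooth_continuous assms(2) by auto
  next
    case (Suc k)
    note d = has_derivative_integral_translate[OF Suc.prems assms(2)]
    show ?case unfolding ck_on.simps using Suc.IH[OF smooth_dird[OF Suc.prems]] dird_eq[OF d]
      by (intro conjI ballI allI differentiable_has_derivativeI[OF d]) simp
  qed
  then show ?thesis using assms(1) by (simp add: smooth_on_def)
qed

section \<open>Alternating functions of lists of vectors\<close>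

lemma alternating_length: "alternating p f \<Longrightarrow> length vs \<noteq> p \<Longrightarrow> f vs = 0"
  and alternating_not_distinct: "alternating p f \<Longrightarrow> \<not> distinct vs \<Longrightarrow> f vs = 0"
  and alternating_linear: "alternating p f \<Longrightarrow> length us + 1 + length vs = p \<Longrightarrow> linear (\<lambda>v. f (us @ v # vs))"
  by (auto simp: alternating_def)

lemma alternating_zero: "alternating p (\<lambda>vs. 0)"
  by (auto simp: alternating_def linear_iff)

lemma alternating_add: "alternating p f \<Longrightarrow> alternating p g \<Longrightarrow> alternating p (\<lambda>vs. f vs + g vs)"
  by (auto simp: alternating_def intro: linear_compose_add)

lemma alternating_mult: "alternating p f \<Longrightarrow> alternating p (\<lambda>vs. c * f vs)"
  by (auto simp: alternating_def linear_iff algebra_simps)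

lemma alternating_sum: "(\<And>i. i \<in> I \<Longrightarrow> alternating p (f i)) \<Longrightarrow> alternating p (\<lambda>vs. \<Sum>i\<in>I. f i vs)"
  by (induction I rule: infinite_finite_induct) (auto intro: alternating_zero alternating_add)

lemma alternating_map:
  assumes "linear A" "alternating p f"
  shows "alternating p (\<lambda>vs. f (map A vs))"
  unfolding alternating_def
proof (intro conjI allI impI)
  fix us vs :: "'a list"
  assume "length us + 1 + length vs = p"
  then have "linear (\<lambda>v. f (map A us @ v # map A vs))"
    using assms(2) by (intro alternating_linear) auto
  then show "linear (\<lambda>v. f (map A (us @ v # vs)))"
    using linear_compose[OF assms(1)] by (simp add: o_def)
next
  fix vs :: "'a list"
  assume "\<not> distinct vs"
  then show "f (map A vs) = 0" using alternating_not_distinct[OF assms(2)] by (simp add: distinct_map)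
qed (use alternating_length[OF assms(2)] in auto)

text \<open>The truncated \<open>p - 1\<close> is harmless at \<open>p = 0\<close>, where
  \<open>f (v # vs)\<close> is always 0.\<close>

lemma alternating_Cons:
  assumes "alternating p f"
  shows "alternating (p - 1) (\<lambda>vs. f (v # vs))"
  unfolding alternating_def
proof (intro conjI allI impI)
  fix vs :: "'a list"
  assume "length vs \<noteq> p - 1"
  then show "f (v # vs) = 0" by (intro alternating_length[OF assms]) auto
next
  fix us vs :: "'a list"
  assume "length us + 1 + length vs = p - 1"
  then show "linear (\<lambda>w. f (v # us @ w # vs))"
    using alternating_linear[OF assms, of "v # us" vs] by auto
qed (auto intro: alternating_not_distinct[OF assms])

text \<open>\<open>alternating\<close> speaks only of zeros at repeated vectors; the sign comes from
  polarization, with \<open>a + b\<close> in both slots.\<close>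

lemma alternating_swap:
  assumes "alternating p f"
  shows "f (us @ a # b # vs) = - f (us @ b # a # vs)"
proof (cases "length us + 2 + length vs = p")
  case True
  have l1: "linear (\<lambda>v. f (us @ v # w # vs))" for w
    using alternating_linear[OF assms, of us "w # vs"] True by simp
  have l2: "linear (\<lambda>v. f (us @ w # v # vs))" for w
    using alternating_linear[OF assms, of "us @ [w]" vs] True by simp
  have z: "f (us @ w # w # vs) = 0" for w by (rule alternating_not_distinct[OF assms]) simp
  have "f (us @ (a + b) # (a + b) # vs) = f (us @ a # b # vs) + f (us @ b # a # vs)"
    unfolding linear_add[OF l1] linear_add[OF l2] by (simp add: z)
  from trans[OF this[symmetric] z] show ?thesis by (rule eq_neg_iff_add_eq_0[THEN iffD2])
qed (use alternating_length[OF assms] in auto)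

lemma alternating_move:
  assumes "alternating p f"
  shows "f (us @ as @ v # vs) = (-1) ^ length as * f (us @ v # as @ vs)"
proof (induction as arbitrary: us)
  case (Cons a as)
  have "f (us @ (a # as) @ v # vs) = (-1) ^ length as * f (us @ a # v # as @ vs)"
    using Cons[of "us @ [a]"] by simp
  then show ?case using alternating_swap[OF assms, of us a v] by simp
qed simp

text \<open>The common shape of the exterior derivative and of the product with a covector: the
  removed vector is handed to the first argument of \<open>L\<close>.\<close>

definition alt_sum :: "('e \<Rightarrow> 'e list \<Rightarrow> complex) \<Rightarrow> 'e list \<Rightarrow> complex" where
  "alt_sum L vs = (\<Sum>i<length vs. (-1) ^ i * L (vs ! i) (take i vs @ drop (Suc i) vs))"

lemma alt_sum_Nil [simp]: "alt_sum L [] = 0"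
  by (simp add: alt_sum_def)

text \<open>This recursion allows identities between forms to be proved by induction on the list of
  vectors, with contraction as the inductive step.\<close>

lemma alt_sum_Cons: "alt_sum L (v # vs) = L v vs - alt_sum (\<lambda>u us. L u (v # us)) vs"
  by (simp add: alt_sum_def sum.lessThan_Suc_shift sum_negf[symmetric] del: sum.lessThan_Suc)

lemma alt_sum_cong:
  "(\<And>u us. Suc (length us) = length vs \<Longrightarrow> L u us = L' u us) \<Longrightarrow> alt_sum L vs = alt_sum L' vs"
  unfolding alt_sum_def by (intro sum.cong refl) auto

lemma alt_sum_zero: "(\<And>u us. L u us = 0) \<Longrightarrow> alt_sum L vs = 0"
  by (simp add: alt_sum_def)

lemma alt_sum_add: "alt_sum (\<lambda>u us. L u us + L' u us) vs = alt_sum L vs + alt_sum L' vs"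
  by (simp add: alt_sum_def sum.distrib algebra_simps)

lemma alt_sum_mult: "alt_sum (\<lambda>u us. c * L u us) vs = c * alt_sum L vs"
  by (simp add: alt_sum_def sum_distrib_left algebra_simps)

lemma alt_sum_sum: "alt_sum (\<lambda>u us. \<Sum>k\<in>K. L k u us) vs = (\<Sum>k\<in>K. alt_sum (L k) vs)"
  by (induction K rule: infinite_finite_induct) (auto simp: alt_sum_add alt_sum_zero)

lemma alt_sum_map: "alt_sum L (map A vs) = alt_sum (\<lambda>u us. L (A u) (map A us)) vs"
  by (simp add: alt_sum_def take_map drop_map)

text \<open>Induction on \<open>us\<close> brings the slot to the head. There \<open>v\<close> is
  either the removed vector, where linearity in \<open>u\<close> is used, or the first of the
  remaining ones.\<close>

lemma linear_alt_sum:
  assumes "\<And>us. linear (\<lambda>u. L u us)" "\<And>u. alternating p (L u)" "length us + length ws = p"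
  shows "linear (\<lambda>v. alt_sum L (us @ v # ws))"
  using assms
proof (induction us arbitrary: L p)
  case Nil
  have "linear (\<lambda>v. alt_sum (\<lambda>u us. L u (v # us)) ws)"
    unfolding alt_sum_def
  proof (intro linear_compose_sum ballI)
    fix i assume "i \<in> {..<length ws}"
    then have "linear (\<lambda>v. L (ws ! i) (v # take i ws @ drop (Suc i) ws))"
      using alternating_linear[OF Nil(2), of "[]" "take i ws @ drop (Suc i) ws"] Nil(3) by simp
    then show "linear (\<lambda>v. (-1) ^ i * L (ws ! i) (v # take i ws @ drop (Suc i) ws))"
      by (simp add: linear_iff algebra_simps)
  qed
  then show ?case using Nil(1) by (simp add: alt_sum_Cons linear_compose_sub)
next
  case (Cons a us)
  have "linear (\<lambda>v. alt_sum (\<lambda>u us. L u (a # us)) (us @ v # ws))"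
  proof (rule Cons.IH)
    show "alternating (p - 1) (\<lambda>us. L u (a # us))" for u by (rule alternating_Cons[OF Cons.prems(2)])
  qed (use Cons.prems in auto)
  moreover have "linear (\<lambda>v. L a (us @ v # ws))"
    using Cons.prems(3) by (intro alternating_linear[OF Cons.prems(2)]) simp
  ultimately show ?case by (simp add: alt_sum_Cons linear_compose_sub)
qed

text \<open>Every term that keeps the displayed \<open>v\<close> vanishes; only the one that removes
  it is left.\<close>

lemma alt_sum_repeated:
  assumes "\<And>u us. v \<in> set us \<Longrightarrow> L u us = 0"
  shows "alt_sum L (as @ v # bs) = (-1) ^ length as * L v (as @ bs)"
  using assms
proof (induction as arbitrary: L)
  case Nil
  then show ?case by (simp add: alt_sum_Cons alt_sum_zero)
next
  case (Cons a as)
  then show ?case using Cons.IH[of "\<lambda>u us. L u (a # us)"] by (simp add: alt_sum_Cons)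
qed

lemma alt_sum_not_distinct:
  assumes "\<And>u. alternating p (L u)" "\<not> distinct vs"
  shows "alt_sum L vs = 0"
  using assms
proof (induction vs arbitrary: L p)
  case (Cons v vs)
  show ?case
  proof (cases "distinct vs")
    case False
    have "alt_sum (\<lambda>u us. L u (v # us)) vs = 0"
      by (rule Cons.IH[OF alternating_Cons[OF Cons.prems(1)] False])
    then show ?thesis using alternating_not_distinct[OF Cons.prems(1) False] by (simp add: alt_sum_Cons)
  next
    case True
    then have "v \<in> set vs" using Cons.prems(2) by simp
    \<comment> \<open>One copy of \<open>v\<close> is the head, the other sits after
      \<open>xs\<close>. The two terms that remove a copy differ by the sign of moving
      \<open>v\<close> past \<open>xs\<close> and cancel; all other terms contain \<open>v\<close>
      twice.\<close>
    then obtain xs ys where vs: "vs = xs @ v # ys" using split_list[of v vs] by blast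
    have "alt_sum (\<lambda>u us. L u (v # us)) (xs @ v # ys) = (-1) ^ length xs * L v (v # xs @ ys)"
      by (intro alt_sum_repeated alternating_not_distinct[OF Cons.prems(1)]) auto
    moreover have "L v (xs @ v # ys) = (-1) ^ length xs * L v (v # xs @ ys)"
      using alternating_move[where us = "[]", OF Cons.prems(1)] by simp
    ultimately show ?thesis using vs by (simp add: alt_sum_Cons)
  qed
qed simp

lemma alternating_alt_sum:
  assumes "\<And>us. linear (\<lambda>u. L u us)" "\<And>u. alternating p (L u)"
  shows "alternating (Suc p) (alt_sum L)"
  unfolding alternating_def
proof (intro conjI allI impI)
  fix vs :: "'a list"
  assume "length vs \<noteq> Suc p"
  then have "alt_sum L vs = alt_sum (\<lambda>u us. 0) vs"
    by (intro alt_sum_cong) (auto intro: alternating_length[OF assms(2)])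
  then show "alt_sum L vs = 0" by (simp add: alt_sum_zero)
qed (auto intro: linear_alt_sum[OF assms] alt_sum_not_distinct[OF assms(2)])


section \<open>Operators on differential forms\<close>

abbreviation forms :: "nat \<Rightarrow> 'e::real_normed_vector form set" where
  "forms p \<equiv> forms_on p UNIV"

abbreviation ed :: "'e::real_normed_vector form \<Rightarrow> 'e form" where
  "ed \<equiv> ext_deriv UNIV"

definition fscale :: "complex \<Rightarrow> 'e form \<Rightarrow> 'e form" where
  "fscale c \<omega> = (\<lambda>x vs. c * \<omega> x vs)"

text \<open>The pullback under x to A x + c, written without a derivative, since that of an affine
  map is \<open>A\<close> everywhere.\<close>

definition pullback_affine :: "('e::real_normed_vector \<Rightarrow> 'e) \<Rightarrow> 'e \<Rightarrow> 'e form \<Rightarrow> 'e form" where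
  "pullback_affine A c \<omega> = (\<lambda>x vs. \<omega> (A x + c) (map A vs))"

definition contract :: "'e \<Rightarrow> 'e form \<Rightarrow> 'e form" where
  "contract v \<omega> = (\<lambda>x vs. \<omega> x (v # vs))"

text \<open>Weight 1 gives the mean over a segment; weight t - 1 is the one that gives a homotopy
  from the identity to that mean.\<close>

definition average :: "(real \<Rightarrow> complex) \<Rightarrow> 'e::real_normed_vector \<Rightarrow> 'e form \<Rightarrow> 'e form" where
  "average \<phi> v \<omega> = (\<lambda>x vs. integral {0..1} (\<lambda>t. \<phi> t * \<omega> (x + t *\<^sub>R v) vs))"

text \<open>The exterior product with the constant 1-form \<open>\<theta>\<close>, in the
  normalization without factorials.\<close>

definition wedge1 :: "('e \<Rightarrow> real) \<Rightarrow> 'e form \<Rightarrow> 'e form" where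
  "wedge1 \<theta> \<omega> = (\<lambda>x vs. alt_sum (\<lambda>u us. of_real (\<theta> u) * \<omega> x us) vs)"

lemma forms_iff: "\<omega> \<in> forms p \<longleftrightarrow> (\<forall>x. alternating p (\<omega> x)) \<and> (\<forall>vs. smooth (\<lambda>x. \<omega> x vs))"
  by (simp add: forms_on_def)

lemma forms_smooth: "\<omega> \<in> forms p \<Longrightarrow> smooth (\<lambda>x. \<omega> x vs)"
  and forms_alternating: "\<omega> \<in> forms p \<Longrightarrow> alternating p (\<omega> x)"
  by (auto simp: forms_iff)

lemma ed_eq: "ed \<omega> x vs = alt_sum (\<lambda>v us. dird (\<lambda>y. \<omega> y us) x v) vs"
  by (simp add: ext_deriv_def restrict_form_def alt_sum_def)

lemma ed_at: "ed \<omega> x = alt_sum (\<lambda>v us. dird (\<lambda>y. \<omega> y us) x v)"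
  by (simp add: fun_eq_iff ed_eq)

lemma forms_zero: "0 \<in> forms p"
  using alternating_zero by (auto simp: forms_iff zero_fun_def)

lemma forms_add: "\<omega> \<in> forms p \<Longrightarrow> \<eta> \<in> forms p \<Longrightarrow> \<omega> + \<eta> \<in> forms p"
  by (auto simp: forms_iff plus_fun_def intro: alternating_add)

lemma forms_fscale: "\<omega> \<in> forms p \<Longrightarrow> fscale c \<omega> \<in> forms p"
  by (auto simp: forms_iff fscale_def intro: alternating_mult)

lemma diff_fscale: "\<omega> - \<eta> = \<omega> + fscale (-1) \<eta>"
  by (simp add: fscale_def fun_eq_iff)

lemma forms_diff: "\<omega> \<in> forms p \<Longrightarrow> \<eta> \<in> forms p \<Longrightarrow> \<omega> - \<eta> \<in> forms p"
  unfolding diff_fscale by (intro forms_add forms_fscale)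

text \<open>Base point and slots are independent variables, so differentiation in the point inherits
  linearity and alternation in the slots.\<close>

lemma forms_ed:
  assumes "\<omega> \<in> forms p"
  shows "ed \<omega> \<in> forms (Suc p)"
proof -
  have "alternating (Suc p) (alt_sum (\<lambda>v us. dird (\<lambda>y. \<omega> y us) x v))" for x
  proof (rule alternating_alt_sum)
    show "linear (\<lambda>v. dird (\<lambda>y. \<omega> y us) x v)" for us
      by (rule smooth_linear_dird[OF forms_smooth[OF assms]])
    note d = smooth_has_derivative[OF forms_smooth[OF assms]]
    show "alternating p (\<lambda>us. dird (\<lambda>y. \<omega> y us) x v)" for v
      unfolding alternating_def
    proof (intro conjI allI impI)
      fix us vs :: "'a list"
      assume l: "length us + 1 + length vs = p"
      have lin: "linear (\<lambda>v. \<omega> y (us @ v # vs))" for y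
        by (rule alternating_linear[OF forms_alternating[OF assms] l])
      show "linear (\<lambda>u. dird (\<lambda>y. \<omega> y (us @ u # vs)) x v)"
      proof (rule linearI)
        fix a b :: 'a and c :: real
        have "((\<lambda>y. \<omega> y (us @ (a + b) # vs)) has_derivative
          (\<lambda>v. dird (\<lambda>y. \<omega> y (us @ a # vs)) x v + dird (\<lambda>y. \<omega> y (us @ b # vs)) x v)) (at x)"
          unfolding linear_add[OF lin] by (intro has_derivative_add d)
        then show "dird (\<lambda>y. \<omega> y (us @ (a + b) # vs)) x v =
          dird (\<lambda>y. \<omega> y (us @ a # vs)) x v + dird (\<lambda>y. \<omega> y (us @ b # vs)) x v" by (rule dird_eq)
        have "((\<lambda>y. \<omega> y (us @ (c *\<^sub>R a) # vs)) has_derivative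
          (\<lambda>v. c *\<^sub>R dird (\<lambda>y. \<omega> y (us @ a # vs)) x v)) (at x)"
          unfolding linear_scale[OF lin] by (intro has_derivative_scaleR_right d)
        then show "dird (\<lambda>y. \<omega> y (us @ (c *\<^sub>R a) # vs)) x v =
          c *\<^sub>R dird (\<lambda>y. \<omega> y (us @ a # vs)) x v" by (rule dird_eq)
      qed
    next
      fix vs :: "'a list"
      assume "length vs \<noteq> p"
      then have "(\<lambda>y. \<omega> y vs) = (\<lambda>y. 0)" using alternating_length[OF forms_alternating[OF assms]] by auto
      then show "dird (\<lambda>y. \<omega> y vs) x v = 0" by simp
    next
      fix vs :: "'a list"
      assume "\<not> distinct vs"
      then have "(\<lambda>y. \<omega> y vs) = (\<lambda>y. 0)" using alternating_not_distinct[OF forms_alternating[OF assms]] by auto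
      then show "dird (\<lambda>y. \<omega> y vs) x v = 0" by simp
    qed
  qed
  moreover have "smooth (\<lambda>x. alt_sum (\<lambda>v us. dird (\<lambda>y. \<omega> y us) x v) vs)" for vs
    unfolding alt_sum_def by (intro smooth_sum smooth_mult smooth_const smooth_dird forms_smooth[OF assms])
  ultimately show ?thesis by (simp add: forms_iff ed_at)
qed

lemma ed_add:
  assumes "\<omega> \<in> forms p" "\<eta> \<in> forms q"
  shows "ed (\<omega> + \<eta>) = ed \<omega> + ed \<eta>"
proof -
  have "dird (\<lambda>y. \<omega> y us + \<eta> y us) x v = dird (\<lambda>y. \<omega> y us) x v + dird (\<lambda>y. \<eta> y us) x v" for us x v
    by (intro dird_eq has_derivative_add smooth_has_derivative forms_smooth[OF assms(1)] forms_smooth[OF assms(2)])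
  then show ?thesis by (simp add: fun_eq_iff ed_eq alt_sum_add)
qed

lemma ed_fscale:
  assumes "\<omega> \<in> forms p"
  shows "ed (fscale c \<omega>) = fscale c (ed \<omega>)"
proof -
  have "dird (\<lambda>y. c * \<omega> y us) x v = c * dird (\<lambda>y. \<omega> y us) x v" for us x v
    by (intro dird_eq has_derivative_mult_right smooth_has_derivative forms_smooth[OF assms(1)])
  then show ?thesis by (simp add: fun_eq_iff ed_eq alt_sum_mult fscale_def)
qed

lemma ed_diff: "\<omega> \<in> forms p \<Longrightarrow> \<eta> \<in> forms q \<Longrightarrow> ed (\<omega> - \<eta>) = ed \<omega> - ed \<eta>"
  by (simp add: diff_fscale ed_add[of _ p _ q] ed_fscale forms_fscale)

lemma ed_zero [simp]: "ed 0 = 0"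
  by (simp add: fun_eq_iff ed_eq alt_sum_zero)

lemma forms_contract: "\<omega> \<in> forms p \<Longrightarrow> contract v \<omega> \<in> forms (p - 1)"
  unfolding forms_iff contract_def by (blast intro: alternating_Cons)

text \<open>Cartan's formula for the constant field \<open>v\<close>: split off the head of
  \<open>v # vs\<close> in \<open>ed\<close>.\<close>

lemma ed_contract: "ed (contract v \<omega>) x vs = dird (\<lambda>y. \<omega> y vs) x v - ed \<omega> x (v # vs)"
  by (simp add: ed_eq alt_sum_Cons contract_def)

lemma forms_pullback_affine:
  "bounded_linear A \<Longrightarrow> \<omega> \<in> forms p \<Longrightarrow> pullback_affine A c \<omega> \<in> forms p"
  by (auto simp: forms_iff pullback_affine_def bounded_linear.linear intro: alternating_map smooth_affine)

lemma ed_pullback_affine: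
  assumes "bounded_linear A" "\<omega> \<in> forms p"
  shows "ed (pullback_affine A c \<omega>) = pullback_affine A c (ed \<omega>)"
proof -
  have "dird (\<lambda>y. \<omega> (A y + c) us) x v = dird (\<lambda>y. \<omega> y us) (A x + c) (A v)" for us x v
    by (intro dird_eq has_derivative_affine assms(1) smooth_differentiable forms_smooth[OF assms(2)])
  then show ?thesis by (simp add: fun_eq_iff ed_eq pullback_affine_def alt_sum_map)
qed

section \<open>Averages along a vector and the homotopies that they provide\<close>

lemma integrable_translate:
  fixes f :: "'e::euclidean_space \<Rightarrow> complex"
  assumes "continuous_on UNIV f" "continuous_on UNIV \<phi>"
  shows "(\<lambda>t. \<phi> t * f (x + t *\<^sub>R v)) integrable_on {0..1}"
  by (intro integrable_continuous_interval continuous_intros continuous_on_compose2[OF assms(1)]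
        continuous_on_subset[OF assms(2)]) auto

lemma integral_alt_sum:
  assumes "\<And>u us. (\<lambda>t. \<phi> t * L t u us) integrable_on S"
  shows "integral S (\<lambda>t. \<phi> t * alt_sum (L t) vs) = alt_sum (\<lambda>u us. integral S (\<lambda>t. \<phi> t * L t u us)) vs"
proof -
  have "integral S (\<lambda>t. \<phi> t * alt_sum (L t) vs) =
    integral S (\<lambda>t. \<Sum>i<length vs. (-1) ^ i * (\<phi> t * L t (vs ! i) (take i vs @ drop (Suc i) vs)))"
    by (simp add: alt_sum_def sum_distrib_left algebra_simps)
  also have "\<dots> = (\<Sum>i<length vs. (-1) ^ i * integral S (\<lambda>t. \<phi> t * L t (vs ! i) (take i vs @ drop (Suc i) vs)))"
    using assms by (subst integral_sum) (auto intro: integrable_on_mult_right)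
  finally show ?thesis by (simp add: alt_sum_def)
qed

lemma forms_average:
  fixes \<omega> :: "'e::euclidean_space form"
  assumes "\<omega> \<in> forms p" "continuous_on UNIV \<phi>"
  shows "average \<phi> v \<omega> \<in> forms p"
proof -
  note int = integrable_translate[OF smooth_continuous[OF forms_smooth[OF assms(1)]] assms(2)]
  have "alternating p (average \<phi> v \<omega> x)" for x
    unfolding alternating_def
  proof (intro conjI allI impI)
    fix us vs :: "'e list"
    assume l: "length us + 1 + length vs = p"
    have lin: "linear (\<lambda>v. \<omega> y (us @ v # vs))" for y
      by (rule alternating_linear[OF forms_alternating[OF assms(1)] l])
    show "linear (\<lambda>w. average \<phi> v \<omega> x (us @ w # vs))"
      by (rule linearI)
        (simp_all add: average_def linear_add[OF lin] linear_scale[OF lin] distrib_left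
          integral_add int flip: integral_cmul)
  qed (simp_all add: average_def alternating_length[OF forms_alternating[OF assms(1)]]
      alternating_not_distinct[OF forms_alternating[OF assms(1)]])
  moreover have "smooth (\<lambda>x. average \<phi> v \<omega> x vs)" for vs
    unfolding average_def by (intro smooth_integral_translate forms_smooth[OF assms(1)] assms(2))
  ultimately show ?thesis by (simp add: forms_iff)
qed

lemma dird_average:
  fixes \<omega> :: "'e::euclidean_space form"
  assumes "\<omega> \<in> forms p" "continuous_on UNIV \<phi>"
  shows "dird (\<lambda>y. average \<phi> v \<omega> y us) x u =
    integral {0..1} (\<lambda>t. \<phi> t * dird (\<lambda>y. \<omega> y us) (x + t *\<^sub>R v) u)"
  unfolding average_def
  by (intro dird_eq has_derivative_integral_translate forms_smooth[OF assms(1)] assms(2))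

lemma ed_average:
  fixes \<omega> :: "'e::euclidean_space form"
  assumes "\<omega> \<in> forms p" "continuous_on UNIV \<phi>"
  shows "ed (average \<phi> v \<omega>) = average \<phi> v (ed \<omega>)"
proof (intro ext)
  fix x vs
  have "average \<phi> v (ed \<omega>) x vs =
    alt_sum (\<lambda>u us. integral {0..1} (\<lambda>t. \<phi> t * dird (\<lambda>y. \<omega> y us) (x + t *\<^sub>R v) u)) vs"
    unfolding average_def ed_eq
    by (intro integral_alt_sum integrable_translate smooth_continuous smooth_dird forms_smooth[OF assms(1)] assms(2))
  then show "ed (average \<phi> v \<omega>) x vs = average \<phi> v (ed \<omega>) x vs"
    by (simp add: ed_eq dird_average[OF assms])
qed

lemma average_add:
  fixes \<omega> :: "'e::euclidean_space form"
  assumes "\<omega> \<in> forms p" "\<eta> \<in> forms q" "continuous_on UNIV \<phi>"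
  shows "average \<phi> v (\<omega> + \<eta>) = average \<phi> v \<omega> + average \<phi> v \<eta>"
  using integrable_translate[OF smooth_continuous[OF forms_smooth[OF assms(1)]] assms(3)]
    integrable_translate[OF smooth_continuous[OF forms_smooth[OF assms(2)]] assms(3)]
  by (simp add: average_def fun_eq_iff distrib_left integral_add)

lemma average_fscale: "average \<phi> v (fscale c \<omega>) = fscale c (average \<phi> v \<omega>)"
  by (simp add: average_def fscale_def fun_eq_iff mult.left_commute[of _ c])

lemma average_zero: "average \<phi> v 0 = 0"
  by (simp add: average_def fun_eq_iff)

text \<open>Fubini for a continuous integrand on the unit square.\<close>

lemma average_commute:
  fixes \<omega> :: "'e::euclidean_space form"
  assumes "\<omega> \<in> forms p" "continuous_on UNIV \<phi>" "continuous_on UNIV \<psi>"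
  shows "average \<phi> v (average \<psi> u \<omega>) = average \<psi> u (average \<phi> v \<omega>)"
proof (intro ext)
  fix x vs
  have c: "continuous_on S (\<lambda>z. \<omega> (x + fst z *\<^sub>R v + snd z *\<^sub>R u) vs)" for S
    by (rule continuous_on_compose2[OF smooth_continuous[OF forms_smooth[OF assms(1)]]])
      (auto intro!: continuous_intros)
  have "continuous_on (cbox (0, 0) (1, 1)) (\<lambda>(t, r). \<phi> t * (\<psi> r * \<omega> (x + t *\<^sub>R v + r *\<^sub>R u) vs))"
    unfolding split_beta
    by (intro continuous_intros c continuous_on_compose2[OF assms(2), of _ fst]
        continuous_on_compose2[OF assms(3), of _ snd]) auto
  from integral_swap_continuous[OF this]
  have "integral {0..1} (\<lambda>t. integral {0..1} (\<lambda>r. \<phi> t * (\<psi> r * \<omega> (x + t *\<^sub>R v + r *\<^sub>R u) vs)))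
      = integral {0..1} (\<lambda>r. integral {0..1} (\<lambda>t. \<psi> r * (\<phi> t * \<omega> (x + r *\<^sub>R u + t *\<^sub>R v) vs)))"
    by (simp only: cbox_interval mult.left_commute[of "\<psi> _"] add.commute[of "_ *\<^sub>R v"] add.assoc)
  then show "average \<phi> v (average \<psi> u \<omega>) x vs = average \<psi> u (average \<phi> v \<omega>) x vs"
    unfolding average_def by (simp only: integral_mult_right)
qed

lemma pullback_affine_average:
  assumes "linear A"
  shows "pullback_affine A c (average \<phi> (A v) \<omega>) = average \<phi> v (pullback_affine A c \<omega>)"
  by (simp add: pullback_affine_def average_def linear_add[OF assms] linear_scale[OF assms] algebra_simps)

lemma average_invariant:
  assumes "\<And>t x. \<omega> (x + t *\<^sub>R v) = \<omega> x"
  shows "average (\<lambda>t. 1) v \<omega> = \<omega>"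
  by (simp add: average_def assms)

lemma integral_dird_line:
  fixes f :: "'e::euclidean_space \<Rightarrow> complex"
  assumes "smooth f"
  shows "integral {0..1} (\<lambda>t. dird f (x + t *\<^sub>R v) v) = f (x + v) - f x"
    and "integral {0..1} (\<lambda>t. of_real (t - 1) * dird f (x + t *\<^sub>R v) v) =
      f x - integral {0..1} (\<lambda>t. f (x + t *\<^sub>R v))"
proof -
  have d: "((\<lambda>t. f (x + t *\<^sub>R v)) has_vector_derivative dird f (x + t *\<^sub>R v) v) (at t within S)" for t S
  proof -
    have "((\<lambda>t. x + t *\<^sub>R v) has_derivative (\<lambda>t. t *\<^sub>R v)) (at t)"
      by (auto intro!: derivative_eq_intros)
    from diff_chain_at[OF this smooth_has_derivative[OF assms]]
    have "((\<lambda>t. f (x + t *\<^sub>R v)) has_derivative (\<lambda>r. dird f (x + t *\<^sub>R v) (r *\<^sub>R v))) (at t)"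
      by (simp add: o_def)
    then show ?thesis
      by (auto simp: has_vector_derivative_def linear_scale[OF smooth_linear_dird[OF assms]]
          intro: has_derivative_at_withinI)
  qed
  have "((\<lambda>t. dird f (x + t *\<^sub>R v) v) has_integral f (x + 1 *\<^sub>R v) - f (x + 0 *\<^sub>R v)) {0..1}"
    by (rule fundamental_theorem_of_calculus) (use d in auto)
  then show "integral {0..1} (\<lambda>t. dird f (x + t *\<^sub>R v) v) = f (x + v) - f x"
    by (simp add: integral_unique)
  \<comment> \<open>The weight t - 1 is the primitive of 1 that vanishes at 1, so integration by
    parts leaves only the boundary value \<open>f x\<close> from the end point 0.\<close>
  have "((\<lambda>t. of_real (t - 1) * f (x + t *\<^sub>R v)) has_vector_derivative
      of_real (t - 1) * dird f (x + t *\<^sub>R v) v + 1 * f (x + t *\<^sub>R v)) (at t within S)" (is "(?g has_vector_derivative ?g' t) _") for t S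
  proof (rule has_vector_derivative_mult[OF _ d])
    show "((\<lambda>t. of_real (t - 1)) has_vector_derivative 1) (at t within S)"
      by (auto intro!: derivative_eq_intros simp: has_vector_derivative_def scaleR_conv_of_real)
  qed
  then have "(?g' has_integral ?g 1 - ?g 0) {0..1}"
    by (intro fundamental_theorem_of_calculus) auto
  then have I: "((\<lambda>t. of_real (t - 1) * dird f (x + t *\<^sub>R v) v + f (x + t *\<^sub>R v)) has_integral f x) {0..1}"
    by simp
  have "((\<lambda>t. f (x + t *\<^sub>R v)) has_integral integral {0..1} (\<lambda>t. f (x + t *\<^sub>R v))) {0..1}"
    using integrable_translate[OF smooth_continuous[OF assms], of "\<lambda>t. 1"] by (simp add: integrable_integral)
  from has_integral_diff[OF I this]
  show "integral {0..1} (\<lambda>t. of_real (t - 1) * dird f (x + t *\<^sub>R v) v) =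
      f x - integral {0..1} (\<lambda>t. f (x + t *\<^sub>R v))"
    by (simp add: integral_unique)
qed

text \<open>Averaging commutes with \<open>ed\<close>, so for closed \<open>\<omega>\<close>
  Cartan's formula leaves the integral of a derivative along \<open>v\<close>. Thus translation by
  \<open>v\<close>, and the mean along \<open>v\<close>, change a closed form only by a
  differential.\<close>

lemma ed_contract_average:
  fixes \<omega> :: "'e::euclidean_space form"
  assumes "\<omega> \<in> forms p" "ed \<omega> = 0"
  shows "ed (contract v (average (\<lambda>t. 1) v \<omega>)) = pullback_affine (\<lambda>x. x) v \<omega> - \<omega>"
    and "ed (contract v (average (\<lambda>t. of_real (t - 1)) v \<omega>)) = \<omega> - average (\<lambda>t. 1) v \<omega>"
proof -
  have c: "continuous_on UNIV (\<lambda>t::real. complex_of_real (t - 1))" by (intro continuous_intros)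
  have *: "ed (contract v (average \<phi> v \<omega>)) x vs
      = integral {0..1} (\<lambda>t. \<phi> t * dird (\<lambda>y. \<omega> y vs) (x + t *\<^sub>R v) v)"
    if "continuous_on UNIV \<phi>" for \<phi> x vs
    by (simp add: ed_contract dird_average[OF assms(1) that] ed_average[OF assms(1) that] assms(2) average_zero)
  show "ed (contract v (average (\<lambda>t. 1) v \<omega>)) = pullback_affine (\<lambda>x. x) v \<omega> - \<omega>"
    by (intro ext) (simp add: * integral_dird_line(1)[OF forms_smooth[OF assms(1)]] pullback_affine_def)
  show "ed (contract v (average (\<lambda>t. of_real (t - 1)) v \<omega>)) = \<omega> - average (\<lambda>t. 1) v \<omega>"
  proof (intro ext)
    fix x vs
    have "ed (contract v (average (\<lambda>t. of_real (t - 1)) v \<omega>)) x vs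
        = \<omega> x vs - integral {0..1} (\<lambda>t. \<omega> (x + t *\<^sub>R v) vs)"
      by (rule trans[OF *[OF c] integral_dird_line(2)[OF forms_smooth[OF assms(1)]]])
    also have "\<dots> = (\<omega> - average (\<lambda>t. 1) v \<omega>) x vs" by (simp add: average_def)
    finally show "ed (contract v (average (\<lambda>t. of_real (t - 1)) v \<omega>)) x vs = \<dots>" .
  qed
qed

section \<open>Exterior product with a constant covector\<close>

lemma forms_wedge1:
  assumes "bounded_linear \<theta>" "\<omega> \<in> forms p"
  shows "wedge1 \<theta> \<omega> \<in> forms (Suc p)"
proof -
  have "alternating (Suc p) (alt_sum (\<lambda>u us. of_real (\<theta> u) * \<omega> x us))" for x
  proof (rule alternating_alt_sum)
    note l = bounded_linear.linear[OF assms(1)]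
    show "linear (\<lambda>u. of_real (\<theta> u) * \<omega> x us)" for us
      by (rule linearI) (simp_all add: linear_add[OF l] linear_scale[OF l] algebra_simps scaleR_conv_of_real)
  qed (intro alternating_mult forms_alternating[OF assms(2)])
  moreover have "smooth (\<lambda>x. wedge1 \<theta> \<omega> x vs)" for vs
    unfolding wedge1_def alt_sum_def by (intro smooth_sum smooth_mult smooth_const forms_smooth[OF assms(2)])
  ultimately show ?thesis unfolding forms_iff by (simp add: wedge1_def)
qed

lemma wedge1_Cons: "wedge1 \<theta> \<omega> x (v # vs) = of_real (\<theta> v) * \<omega> x vs - wedge1 \<theta> (contract v \<omega>) x vs"
  by (simp add: wedge1_def alt_sum_Cons contract_def)

lemma contract_wedge1: "contract v (wedge1 \<theta> \<omega>) = fscale (of_real (\<theta> v)) \<omega> - wedge1 \<theta> (contract v \<omega>)"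
  by (simp add: fun_eq_iff contract_def[of v "wedge1 \<theta> \<omega>"] wedge1_Cons fscale_def)

lemma wedge1_add: "wedge1 \<theta> (\<omega> + \<eta>) = wedge1 \<theta> \<omega> + wedge1 \<theta> \<eta>"
  by (simp add: fun_eq_iff wedge1_def distrib_left alt_sum_add)

lemma wedge1_fscale: "wedge1 \<theta> (fscale c \<omega>) = fscale c (wedge1 \<theta> \<omega>)"
  by (simp add: fun_eq_iff wedge1_def fscale_def mult.left_commute[of _ c] alt_sum_mult)

lemma wedge1_diff: "wedge1 \<theta> (\<omega> - \<eta>) = wedge1 \<theta> \<omega> - wedge1 \<theta> \<eta>"
  by (simp add: diff_fscale wedge1_add wedge1_fscale)

lemma wedge1_zero: "wedge1 \<theta> 0 = 0"
  by (simp add: fun_eq_iff wedge1_def alt_sum_zero)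

text \<open>Contracting with \<open>v\<close> gives two opposite terms and the same double product
  of the contracted form, to which the induction on the vectors applies.\<close>

lemma wedge1_wedge1: "wedge1 \<theta> (wedge1 \<theta> \<omega>) = 0"
proof -
  have "wedge1 \<theta> (wedge1 \<theta> \<omega>) x vs = 0" for x vs
  proof (induction vs arbitrary: \<omega>)
    case Nil
    show ?case by (simp add: wedge1_def)
  next
    case (Cons v vs)
    show ?case
      by (simp add: wedge1_Cons contract_wedge1 wedge1_diff wedge1_fscale Cons.IH) (simp add: fscale_def)
  qed
  then show ?thesis by (simp add: fun_eq_iff)
qed

lemma average_wedge1:
  fixes \<omega> :: "'e::euclidean_space form"
  assumes "\<omega> \<in> forms p" "continuous_on UNIV \<phi>"
  shows "average \<phi> v (wedge1 \<theta> \<omega>) = wedge1 \<theta> (average \<phi> v \<omega>)"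
proof (intro ext)
  fix x vs
  note int = integrable_translate[OF smooth_continuous[OF forms_smooth[OF assms(1)]] assms(2)]
  have i: "(\<lambda>t. \<phi> t * (of_real (\<theta> u) * \<omega> (x + t *\<^sub>R v) us)) integrable_on {0..1}" for u us
    using integrable_on_mult_right[OF int, of "of_real (\<theta> u)"] by (simp add: mult.left_commute)
  show "average \<phi> v (wedge1 \<theta> \<omega>) x vs = wedge1 \<theta> (average \<phi> v \<omega>) x vs"
    unfolding average_def wedge1_def integral_alt_sum[OF i]
    by (intro alt_sum_cong) (simp only: mult.left_commute[of _ "of_real (\<theta> _)"] integral_mult_right)
qed

lemma pullback_affine_wedge1:
  "(\<And>u. \<theta> (A u) = \<theta> u) \<Longrightarrow> pullback_affine A c (wedge1 \<theta> \<omega>) = wedge1 \<theta> (pullback_affine A c \<omega>)"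
  by (simp add: pullback_affine_def wedge1_def alt_sum_map)

lemma dird_wedge1:
  assumes "\<omega> \<in> forms p"
  shows "dird (\<lambda>y. wedge1 \<theta> \<omega> y us) x v = alt_sum (\<lambda>u us. of_real (\<theta> u) * dird (\<lambda>y. \<omega> y us) x v) us"
  unfolding wedge1_def alt_sum_def
  by (intro dird_eq has_derivative_sum has_derivative_mult_right smooth_has_derivative forms_smooth[OF assms])

lemma ed_wedge1:
  assumes \<theta>: "bounded_linear \<theta>" and "\<omega> \<in> forms p"
  shows "ed (wedge1 \<theta> \<omega>) = fscale (-1) (wedge1 \<theta> (ed \<omega>))"
proof -
  have "\<omega> \<in> forms p \<Longrightarrow> ed (wedge1 \<theta> \<omega>) x vs = - wedge1 \<theta> (ed \<omega>) x vs" for p x vs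
  proof (induction vs arbitrary: \<omega> p)
    case Nil
    show ?case by (simp add: wedge1_def ed_eq)
  next
    case (Cons v vs)
    note c = forms_contract[OF Cons.prems, of v]
    define \<zeta> where "\<zeta> = (\<lambda>x us. dird (\<lambda>y. \<omega> y us) x v)"
    have "ed (wedge1 \<theta> \<omega>) x (v # vs) =
        dird (\<lambda>y. wedge1 \<theta> \<omega> y vs) x v - ed (contract v (wedge1 \<theta> \<omega>)) x vs"
      by (simp add: ed_contract)
    also have "ed (contract v (wedge1 \<theta> \<omega>)) =
        fscale (of_real (\<theta> v)) (ed \<omega>) - ed (wedge1 \<theta> (contract v \<omega>))"
      unfolding contract_wedge1
      by (simp add: ed_diff[OF forms_fscale[OF Cons.prems] forms_wedge1[OF \<theta> c]] ed_fscale[OF Cons.prems])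
    also have "dird (\<lambda>y. wedge1 \<theta> \<omega> y vs) x v = wedge1 \<theta> \<zeta> x vs"
      by (simp add: dird_wedge1[OF Cons.prems]) (simp add: wedge1_def \<zeta>_def)
    \<comment> \<open>Cartan's formula: the first summand cancels against the inductive hypothesis,
      the second completes \<open>wedge1_Cons\<close> for \<open>ed \<omega>\<close>.\<close>
    also have "\<zeta> = ed (contract v \<omega>) + contract v (ed \<omega>)"
      by (simp add: fun_eq_iff ed_contract \<zeta>_def) (simp add: contract_def)
    finally show ?case
      unfolding wedge1_add wedge1_Cons by (simp add: Cons.IH[OF c] fscale_def)
  qed
  then show ?thesis using assms by (simp add: fun_eq_iff fscale_def)
qed

section \<open>A smooth partition of unity on the line\<close>

text \<open>The derivative of each of these functions is a combination of two others, which makes all of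
  them smooth.\<close>

definition flat :: "nat \<Rightarrow> real \<Rightarrow> real" where
  "flat n u = (if u > 0 then inverse u ^ n * exp (- inverse u) else 0)"

lemma flat_tendsto_0: "(flat n \<longlongrightarrow> 0) (at 0)"
proof -
  have "((\<lambda>x. x ^ n / exp x) \<longlongrightarrow> 0) (at_top :: real filter)"
    by (rule tendsto_power_div_exp_0)
  then have "((\<lambda>u. inverse u ^ n / exp (inverse u)) \<longlongrightarrow> 0) (at_right (0::real))"
    by (rule filterlim_compose) (rule filterlim_inverse_at_top_right)
  then have r: "(flat n \<longlongrightarrow> 0) (at_right 0)"
    by (rule Lim_transform_eventually)
      (auto simp: flat_def eventually_at_right_field exp_minus divide_inverse intro!: exI[of _ 1])
  have "(flat n \<longlongrightarrow> 0) (at_left 0)"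
    by (rule Lim_transform_eventually[OF tendsto_const])
      (auto simp: flat_def eventually_at_left_field intro!: exI[of _ "-1"])
  with r show ?thesis by (simp add: filterlim_split_at)
qed

lemma flat_has_derivative:
  "(flat n has_real_derivative (- real n * flat (Suc n) u + flat (Suc (Suc n)) u)) (at u)"
proof -
  consider "u < 0" | "u = 0" | "u > 0" by linarith
  then show ?thesis
  proof cases
    case 1
    have "((\<lambda>u. 0) has_real_derivative 0) (at u)" by simp
    then have "(flat n has_real_derivative 0) (at u)"
      by (rule has_field_derivative_transform_within_open[where S = "{..<0}"]) (use 1 in \<open>auto simp: flat_def\<close>)
    then show ?thesis using 1 by (simp add: flat_def)
  next
    case 2
    \<comment> \<open>The difference quotient at 0 is a member of the same family,
      \<open>flat (Suc n) h\<close>, and tends to 0.\<close>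
    have "((\<lambda>h. (flat n (0 + h) - flat n 0) / h) \<longlongrightarrow> 0) (at 0)"
    proof (rule Lim_transform_eventually[OF flat_tendsto_0[of "Suc n"]])
      show "\<forall>\<^sub>F h in at 0. flat (Suc n) h = (flat n (0 + h) - flat n 0) / h"
        by (intro always_eventually) (simp add: flat_def field_simps)
    qed
    then show ?thesis using 2 by (simp add: flat_def DERIV_def)
  next
    case 3
    have "((\<lambda>u. inverse u ^ n * exp (- inverse u)) has_real_derivative
      (- real n * flat (Suc n) u + flat (Suc (Suc n)) u)) (at u)"
    proof -
      have "(inverse has_real_derivative - (inverse u * inverse u)) (at u)"
        using DERIV_inverse[of u UNIV] 3 by (simp add: power2_eq_square numeral_2_eq_2)
      note d = DERIV_mult[OF DERIV_power[OF this, of n] DERIV_chain2[OF DERIV_exp DERIV_minus[OF this]]]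
      show ?thesis
        by (rule DERIV_cong[OF d]) (use 3 in \<open>cases n; simp add: flat_def algebra_simps\<close>)
    qed
    then show ?thesis
      by (rule has_field_derivative_transform_within_open[where S = "{0<..}"]) (use 3 in \<open>auto simp: flat_def\<close>)
  qed
qed

lemma dird_real: "(f has_real_derivative f') (at x) \<Longrightarrow> dird f x v = v * f'"
  using dird_eq[of f "(*) f'" x v] by (simp add: has_field_derivative_def mult.commute)

lemma differentiable_real: "(f has_real_derivative f') (at x) \<Longrightarrow> f differentiable (at x)"
  by (auto simp: has_field_derivative_def differentiable_def)

lemma smooth_antiderivative:
  fixes f :: "real \<Rightarrow> real"
  assumes "\<And>x. (f has_real_derivative f' x) (at x)" "smooth f'"
  shows "smooth f"
proof -
  have "ck_on k UNIV f" for k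
  proof (cases k)
    case 0
    have "continuous_on UNIV f" by (rule DERIV_continuous_on) (use assms(1) in auto)
    then show ?thesis using 0 by simp
  next
    case (Suc j)
    have "ck_on j UNIV (\<lambda>x. v * f' x)" for v
      using smooth_mult[OF smooth_const assms(2)] by (auto simp: smooth_on_def)
    then show ?thesis
      unfolding Suc ck_on.simps using dird_real[OF assms(1)] differentiable_real[OF assms(1)] by simp
  qed
  then show ?thesis by (simp add: smooth_on_def)
qed

lemma smooth_flat: "smooth (flat n)"
proof -
  have "ck_on k UNIV (flat n)" for k
  proof (induction k arbitrary: n)
    case 0
    have "continuous_on UNIV (flat n)" by (rule DERIV_continuous_on) (use flat_has_derivative in auto)
    then show ?case by simp
  next
    case (Suc k)
    have "ck_on k UNIV (\<lambda>x. v * (- real n * flat (Suc n) x + flat (Suc (Suc n)) x))" for v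
      by (intro ck_on_mult ck_on_add ck_on_const Suc open_UNIV)
    then show ?case unfolding ck_on.simps
      using dird_real[OF flat_has_derivative] differentiable_real[OF flat_has_derivative] by simp
  qed
  then show ?thesis by (simp add: smooth_on_def)
qed

lemma smooth_step_exists:
  obtains f f' :: "real \<Rightarrow> real" where "smooth f'" "\<And>u. (f has_real_derivative f' u) (at u)"
    "\<And>u. u \<le> 0 \<Longrightarrow> f u = 0" "\<And>u. u \<ge> 1 \<Longrightarrow> f u = 1" "\<And>u. u \<le> 0 \<or> u \<ge> 1 \<Longrightarrow> f' u = 0"
proof -
  \<comment> \<open>A bump that is positive exactly between 0 and 1; its normalized integral is the
    step.\<close>
  define g where "g u = flat 0 u * flat 0 (1 - u)" for u
  have "smooth (\<lambda>u. flat 0 (- u + 1))"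
    by (rule smooth_affine[OF _ smooth_flat]) (simp add: bounded_linear_minus bounded_linear_ident)
  then have g: "smooth g" unfolding g_def using smooth_mult[OF smooth_flat[of 0]] by simp
  have g0: "g u = 0" if "u \<le> 0 \<or> u \<ge> 1" for u using that by (auto simp: g_def flat_def)
  have gpos: "g u > 0" if "0 < u" "u < 1" for u using that by (auto simp: g_def flat_def)
  \<comment> \<open>Starting at -1 rather than 0 makes every u \<ge> 0 an interior point of the
    interval used below, so that the derivative is two-sided.\<close>
  define F where "F u = integral {-1..u} g" for u
  have F0: "F u = 0" if "u \<le> 0" for u
  proof -
    have "F u = integral {-1..u} (\<lambda>_. 0)" unfolding F_def by (rule integral_cong) (use g0 that in auto)
    then show ?thesis by simp
  qed
  have dF: "(F has_real_derivative g u) (at u)" for u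
  proof (cases "u < 0")
    case True
    have "((\<lambda>u. 0) has_real_derivative 0) (at u)" by simp
    then have "(F has_real_derivative 0) (at u)"
      by (rule has_field_derivative_transform_within_open[where S = "{..<0}"]) (use True F0 in auto)
    then show ?thesis using True g0 by simp
  next
    case False
    have "(F has_vector_derivative g u) (at u within {-1..u+1})"
      unfolding F_def
      by (rule integral_has_vector_derivative)
        (use False in \<open>auto intro: continuous_on_subset[OF smooth_continuous[OF g]]\<close>)
    moreover have "at u within {-1..u+1} = at u"
      by (rule at_within_interior) (use False in auto)
    ultimately show ?thesis by (simp add: has_real_derivative_iff_has_vector_derivative)
  qed
  have contF: "continuous_on S F" for S
    by (rule DERIV_continuous_on) (use dF in \<open>blast intro: has_field_derivative_at_within\<close>)
  have "F 0 < F 1"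
    by (rule DERIV_pos_imp_increasing_open) (use dF gpos contF in auto)
  then have c: "F 1 > 0" using F0[of 0] by simp
  have F1: "F u = F 1" if "u \<ge> 1" for u
  proof (cases "u = 1")
    case False
    show ?thesis
      by (rule DERIV_isconst_end) (use False that contF dF g0 in \<open>auto, metis less_imp_le\<close>)
  qed simp
  show thesis
  proof (rule that[of "\<lambda>u. inverse (F 1) * g u" "\<lambda>u. inverse (F 1) * F u"])
    show "smooth (\<lambda>u. inverse (F 1) * g u)" using g by auto
    show "((\<lambda>u. inverse (F 1) * F u) has_real_derivative inverse (F 1) * g u) (at u)" for u
      by (rule DERIV_cmult[OF dF])
    show "inverse (F 1) * F u = 1" if "u \<ge> 1" for u using F1[OF that] c by simp
  qed (use F0 g0 in auto)
qed

lemma sum_telescope_int_translates: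
  fixes f :: "real \<Rightarrow> real"
  assumes "\<And>u. u \<le> 0 \<Longrightarrow> f u = a" "\<And>u. u \<ge> 1 \<Longrightarrow> f u = b"
  shows "(\<Sum>k | \<bar>u + of_int k\<bar> < 2. f (u + of_int k + 1) - f (u + of_int k)) = b - a"
proof -
  \<comment> \<open>With this choice -1 < u + m \<le> 0, and only the differences at
    \<open>m\<close> and \<open>m + 1\<close> can be nonzero.\<close>
  define m where "m = \<lfloor>- u\<rfloor>"
  have m: "u + of_int m \<le> 0" "u + of_int m > -1" unfolding m_def by linarith+
  have fin: "finite {k::int. \<bar>u + of_int k\<bar> < 2}"
    by (rule finite_subset[of _ "{m-3..m+3}"]) (use m in auto)
  have "(\<Sum>k | \<bar>u + of_int k\<bar> < 2. f (u + of_int k + 1) - f (u + of_int k))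
     = (\<Sum>k\<in>{m, m+1}. f (u + of_int k + 1) - f (u + of_int k))"
  proof (rule sum.mono_neutral_right[OF fin])
    show "{m, m + 1} \<subseteq> {k. \<bar>u + of_int k\<bar> < 2}" using m by auto
    show "\<forall>k\<in>{k. \<bar>u + of_int k\<bar> < 2} - {m, m + 1}. f (u + of_int k + 1) - f (u + of_int k) = 0"
    proof
      fix k assume "k \<in> {k. \<bar>u + of_int k\<bar> < 2} - {m, m + 1}"
      then have "k \<le> m - 1 \<or> k \<ge> m + 2" by auto
      then have "of_int k \<le> (of_int m - 1 :: real) \<or> of_int k \<ge> (of_int m + 2 :: real)"
        by (metis of_int_1 of_int_add of_int_diff of_int_le_iff of_int_numeral)
      then have "u + of_int k + 1 \<le> 0 \<or> u + of_int k \<ge> 1" using m by linarith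
      then show "f (u + of_int k + 1) - f (u + of_int k) = 0"
        using assms(1)[of "u + of_int k + 1"] assms(1)[of "u + of_int k"]
          assms(2)[of "u + of_int k + 1"] assms(2)[of "u + of_int k"] by auto
    qed
  qed
  also have "\<dots> = f (u + of_int m + 2) - f (u + of_int m)" by (simp add: add.assoc)
  also have "\<dots> = b - a" using m assms by auto
  finally show ?thesis .
qed

text \<open>Differences of unit translates of a step telescope to 1, and those of its derivative to
  0. A second derivative is recorded because the error of the first gluing carries
  \<open>\<kappa>1\<close> and is differentiated again. The supports lie within distance 1 of 0; the
  bound 2 stays clear of the end points, where \<open>f2_0\<close> says nothing.\<close>

lemma partition_of_unity_exists:
  obtains \<kappa> \<kappa>1 \<kappa>2 :: "real \<Rightarrow> real" where "smooth \<kappa>" "smooth \<kappa>1"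
    "\<And>u. (\<kappa> has_real_derivative \<kappa>1 u) (at u)" "\<And>u. (\<kappa>1 has_real_derivative \<kappa>2 u) (at u)"
    "\<And>u. \<bar>u\<bar> \<ge> 2 \<Longrightarrow> \<kappa> u = 0" "\<And>u. \<bar>u\<bar> \<ge> 2 \<Longrightarrow> \<kappa>1 u = 0" "\<And>u. \<bar>u\<bar> \<ge> 2 \<Longrightarrow> \<kappa>2 u = 0"
    "\<And>u. (\<Sum>k | \<bar>u + of_int k\<bar> < 2. \<kappa> (u + of_int k)) = 1"
    "\<And>u. (\<Sum>k | \<bar>u + of_int k\<bar> < 2. \<kappa>1 (u + of_int k)) = 0"
proof (rule smooth_step_exists)
  fix f f' :: "real \<Rightarrow> real"
  assume f: "smooth f'" "\<And>u. (f has_real_derivative f' u) (at u)"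
    "\<And>u. u \<le> 0 \<Longrightarrow> f u = 0" "\<And>u. u \<ge> 1 \<Longrightarrow> f u = 1" "\<And>u. u \<le> 0 \<or> u \<ge> 1 \<Longrightarrow> f' u = 0"
  define f2 where "f2 u = dird f' u 1" for u
  have f2: "(f' has_real_derivative f2 u) (at u)" for u
  proof -
    have "dird f' u v = f2 u * v" for v
      using linear_scale[OF smooth_linear_dird[OF f(1)], of u v 1] by (simp add: f2_def mult.commute)
    then have "dird f' u = (*) (f2 u)" by blast
    with smooth_has_derivative[OF f(1), of u] show ?thesis by (simp only: has_field_derivative_def)
  qed
  have f2_0: "f2 u = 0" if "u < 0 \<or> u > 1" for u
  proof (rule DERIV_unique[OF f2])
    have "((\<lambda>u. 0) has_real_derivative 0) (at u)" by simp
    then show "(f' has_real_derivative 0) (at u)"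
      by (rule has_field_derivative_transform_within_open[where S = "{..<0} \<union> {1<..}"]) (use that f(5) in auto)
  qed
  have sm: "smooth (\<lambda>u. g (u + 1) - g u)" if "smooth g" for g :: "real \<Rightarrow> real"
  proof -
    have "smooth (\<lambda>u. g (u + 1) + (-1) * g u)"
      using smooth_affine[OF bounded_linear_ident that, of 1] that by (intro smooth_add smooth_mult) auto
    then show ?thesis by simp
  qed
  show thesis
  proof (rule that[of "\<lambda>u. f (u + 1) - f u" "\<lambda>u. f' (u + 1) - f' u" "\<lambda>u. f2 (u + 1) - f2 u"])
    show "smooth (\<lambda>u. f (u + 1) - f u)" "smooth (\<lambda>u. f' (u + 1) - f' u)"
      using sm smooth_antiderivative[OF f(2,1)] f(1) by auto
    show "((\<lambda>u. f (u + 1) - f u) has_real_derivative f' (u + 1) - f' u) (at u)" for u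
      using f(2)[of "u + 1"] by (intro DERIV_diff f(2)) (simp add: DERIV_shift)
    show "((\<lambda>u. f' (u + 1) - f' u) has_real_derivative f2 (u + 1) - f2 u) (at u)" for u
      using f2[of "u + 1"] by (intro DERIV_diff f2) (simp add: DERIV_shift)
    show "(\<Sum>k | \<bar>u + of_int k\<bar> < 2. f (u + of_int k + 1) - f (u + of_int k)) = 1" for u
      using sum_telescope_int_translates[of f 0 1] f by simp
    show "(\<Sum>k | \<bar>u + of_int k\<bar> < 2. f' (u + of_int k + 1) - f' (u + of_int k)) = 0" for u
      using sum_telescope_int_translates[of f' 0 0] f by simp
    show "f (u + 1) - f u = 0" if "\<bar>u\<bar> \<ge> 2" for u using that f(3,4)[of u] f(3,4)[of "u + 1"] by linarith
    show "f' (u + 1) - f' u = 0" if "\<bar>u\<bar> \<ge> 2" for u using that f(5)[of u] f(5)[of "u + 1"] by linarith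
    show "f2 (u + 1) - f2 u = 0" if "\<bar>u\<bar> \<ge> 2" for u using that f2_0[of u] f2_0[of "u + 1"] by linarith
  qed
qed


section \<open>Iterated averages\<close>

primrec iter_average :: "'e::real_normed_vector list \<Rightarrow> 'e form \<Rightarrow> 'e form" where
  "iter_average [] \<omega> = \<omega>"
| "iter_average (b # bs) \<omega> = iter_average bs (average (\<lambda>t. 1) b \<omega>)"

text \<open>Telescoping: each vector contributes the homotopy from the form averaged so far to its
  next average.\<close>

primrec iter_homotopy :: "'e::real_normed_vector list \<Rightarrow> 'e form \<Rightarrow> 'e form" where
  "iter_homotopy [] \<omega> = 0"
| "iter_homotopy (b # bs) \<omega> =
    contract b (average (\<lambda>t. of_real (t - 1)) b \<omega>) + iter_homotopy bs (average (\<lambda>t. 1) b \<omega>)"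

lemma continuous_weight: "continuous_on UNIV (\<lambda>t::real. complex_of_real (t - 1))"
  by (intro continuous_intros)

lemma forms_iter_average:
  fixes \<omega> :: "'e::euclidean_space form"
  shows "\<omega> \<in> forms p \<Longrightarrow> iter_average bs \<omega> \<in> forms p"
  by (induction bs arbitrary: \<omega>) (auto simp: forms_average)

lemma ed_iter_average:
  fixes \<omega> :: "'e::euclidean_space form"
  shows "\<omega> \<in> forms p \<Longrightarrow> ed (iter_average bs \<omega>) = iter_average bs (ed \<omega>)"
  by (induction bs arbitrary: \<omega>) (auto simp: ed_average forms_average)

lemma iter_average_add:
  fixes \<omega> :: "'e::euclidean_space form"
  shows "\<omega> \<in> forms p \<Longrightarrow> \<eta> \<in> forms q \<Longrightarrow> iter_average bs (\<omega> + \<eta>) = iter_average bs \<omega> + iter_average bs \<eta>"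
  by (induction bs arbitrary: \<omega> \<eta>) (auto simp: average_add forms_average)

lemma iter_average_fscale:
  fixes \<omega> :: "'e::euclidean_space form"
  shows "iter_average bs (fscale c \<omega>) = fscale c (iter_average bs \<omega>)"
  by (induction bs arbitrary: \<omega>) (auto simp: average_fscale)

lemma iter_average_commute_average:
  fixes \<omega> :: "'e::euclidean_space form"
  shows "\<omega> \<in> forms p \<Longrightarrow> continuous_on UNIV \<phi> \<Longrightarrow>
    iter_average bs (average \<phi> v \<omega>) = average \<phi> v (iter_average bs \<omega>)"
proof (induction bs arbitrary: \<omega>)
  case (Cons b bs)
  then show ?case
    by (simp add: average_commute[OF Cons.prems(1), of "\<lambda>t. 1" \<phi>] forms_average)
qed simp

lemma forms_iter_homotopy:
  fixes \<omega> :: "'e::euclidean_space form"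
  shows "\<omega> \<in> forms p \<Longrightarrow> iter_homotopy bs \<omega> \<in> forms (p - 1)"
proof (induction bs arbitrary: \<omega>)
  case (Cons b bs)
  then show ?case
    unfolding iter_homotopy.simps
    by (intro forms_add forms_contract forms_average continuous_weight continuous_on_const Cons.IH)
qed (simp add: forms_zero)

lemma ed_iter_homotopy:
  fixes \<omega> :: "'e::euclidean_space form"
  shows "\<omega> \<in> forms p \<Longrightarrow> ed \<omega> = 0 \<Longrightarrow> ed (iter_homotopy bs \<omega>) = \<omega> - iter_average bs \<omega>"
proof (induction bs arbitrary: \<omega>)
  case (Cons b bs)
  have av: "average (\<lambda>t. 1) b \<omega> \<in> forms p" by (rule forms_average) (auto simp: Cons.prems)
  have "ed (average (\<lambda>t. 1) b \<omega>) = 0" 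
    unfolding ed_average[OF Cons.prems(1) continuous_on_const] Cons.prems(2) by (rule average_zero)
  then have IH: "ed (iter_homotopy bs (average (\<lambda>t. 1) b \<omega>)) = average (\<lambda>t. 1) b \<omega> - iter_average (b # bs) \<omega>"
    using Cons.IH[OF av] by (simp only: iter_average.simps)
  have "ed (iter_homotopy (b # bs) \<omega>) = ed (contract b (average (\<lambda>t. of_real (t - 1)) b \<omega>)) +
      ed (iter_homotopy bs (average (\<lambda>t. 1) b \<omega>))"
    unfolding iter_homotopy.simps
    by (rule ed_add[OF forms_contract[OF forms_average[OF Cons.prems(1) continuous_weight]]
          forms_iter_homotopy[OF av]])
  also have "\<dots> = \<omega> - iter_average (b # bs) \<omega>"
    unfolding IH ed_contract_average(2)[OF Cons.prems] by (intro ext) (simp del: iter_average.simps)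
  finally show ?case .
qed (simp add: fun_eq_iff)

text \<open>Contraction with a vector in the kernel of \<open>\<theta>\<close> anticommutes with the
  product by \<open>\<theta>\<close>, so the homotopy of a multiple of \<open>\<theta>\<close> is
  again such a multiple.\<close>

lemma iter_homotopy_wedge1:
  fixes \<omega> :: "'e::euclidean_space form"
  shows "\<omega> \<in> forms p \<Longrightarrow> (\<And>b. b \<in> set bs \<Longrightarrow> \<theta> b = 0) \<Longrightarrow>
    iter_homotopy bs (wedge1 \<theta> \<omega>) = fscale (-1) (wedge1 \<theta> (iter_homotopy bs \<omega>))"
proof (induction bs arbitrary: \<omega>)
  case Nil
  show ?case unfolding iter_homotopy.simps wedge1_zero by (simp add: fscale_def fun_eq_iff)
next
  case (Cons b bs)
  have av: "average (\<lambda>t. 1) b \<omega> \<in> forms p" by (rule forms_average) (auto simp: Cons.prems)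
  have c: "contract b (wedge1 \<theta> \<eta>) = fscale (-1) (wedge1 \<theta> (contract b \<eta>))" for \<eta>
    using Cons.prems(2)[of b] by (simp add: contract_wedge1) (simp add: fscale_def fun_eq_iff)
  show ?case
    using Cons.prems(2)
    by (simp only: iter_homotopy.simps average_wedge1[OF Cons.prems(1) continuous_weight]
        average_wedge1[OF Cons.prems(1) continuous_on_const] c Cons.IH[OF av] wedge1_add list.set_intros)
      (simp add: fscale_def fun_eq_iff)
qed

lemma translation_invariant_average:
  fixes \<omega> :: "'e::euclidean_space form"
  shows "(\<And>x. \<omega> (x + u) = \<omega> x) \<Longrightarrow> average \<phi> v \<omega> (x + u) = average \<phi> v \<omega> x"
  by (simp add: average_def add.assoc add.commute[of u]) (simp add: add.assoc[symmetric])

lemma translation_invariant_iter_average: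
  fixes \<omega> :: "'e::euclidean_space form"
  shows "(\<And>x. \<omega> (x + u) = \<omega> x) \<Longrightarrow> iter_average bs \<omega> (x + u) = iter_average bs \<omega> x"
  by (induction bs arbitrary: \<omega> x) (auto simp: translation_invariant_average)

lemma translation_invariant_iter_homotopy:
  fixes \<omega> :: "'e::euclidean_space form"
  shows "(\<And>x. \<omega> (x + u) = \<omega> x) \<Longrightarrow> iter_homotopy bs \<omega> (x + u) = iter_homotopy bs \<omega> x"
  by (induction bs arbitrary: \<omega> x) (auto simp: translation_invariant_average contract_def)

text \<open>The derivative of the mean along \<open>b\<close> is
  \<open>\<omega> (x + b) - \<omega> x\<close>, which is 0; hence a mean over one period is constant
  on the whole line.\<close>

lemma average_periodic:
  fixes \<omega> :: "'e::euclidean_space form"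
  assumes "\<omega> \<in> forms p" "\<And>x. \<omega> (x + b) = \<omega> x"
  shows "average (\<lambda>t. 1) b \<omega> (x + r *\<^sub>R b) = average (\<lambda>t. 1) b \<omega> x"
proof
  fix vs
  note s = forms_smooth[OF forms_average[OF assms(1), of "\<lambda>t. 1" b]]
  have "dird (\<lambda>y. average (\<lambda>t. 1) b \<omega> y vs) x b = 0" for x
    using integral_dird_line(1)[OF forms_smooth[OF assms(1)]] assms(2)
    by (simp add: dird_average[OF assms(1)])
  then have "dird (\<lambda>y. average (\<lambda>t. 1) b \<omega> y vs) x (r *\<^sub>R b) = 0" for x
    using linear_scale[OF smooth_linear_dird[OF s], of vs x r b] by simp
  then show "average (\<lambda>t. 1) b \<omega> (x + r *\<^sub>R b) vs = average (\<lambda>t. 1) b \<omega> x vs"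
    using integral_dird_line(1)[OF s, of vs x "r *\<^sub>R b"] by simp
qed

lemma iter_average_periodic:
  fixes \<omega> :: "'e::euclidean_space form"
  assumes "\<omega> \<in> forms p" "\<And>b x. b \<in> set bs \<Longrightarrow> \<omega> (x + b) = \<omega> x" "b \<in> set bs"
  shows "iter_average bs \<omega> (x + r *\<^sub>R b) = iter_average bs \<omega> x"
  using assms
proof (induction bs arbitrary: \<omega> x)
  case (Cons c bs)
  let ?a = "average (\<lambda>t. 1) c \<omega>"
  show ?case
  proof (cases "b = c")
    case True
    then have "?a (y + r *\<^sub>R b) = ?a y" for y using average_periodic[OF Cons.prems(1), of c y r] Cons.prems(2) by simp
    then show ?thesis by (simp add: translation_invariant_iter_average)
  next
    case False
    then show ?thesis
      using Cons.prems by (auto intro!: Cons.IH forms_average translation_invariant_average)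
  qed
qed simp

lemma iter_average_commute:
  fixes \<omega> :: "'e::euclidean_space form"
  shows "\<omega> \<in> forms p \<Longrightarrow> iter_average bs (iter_average cs \<omega>) = iter_average cs (iter_average bs \<omega>)"
proof (induction cs arbitrary: \<omega>)
  case (Cons c cs)
  have "average (\<lambda>t. 1) c \<omega> \<in> forms p" by (intro forms_average Cons.prems continuous_on_const)
  from Cons.IH[OF this] show ?case
    by (simp only: iter_average.simps iter_average_commute_average[OF Cons.prems continuous_on_const])
qed simp

lemma iter_average_zero: "iter_average bs 0 = 0"
proof (induction bs)
  case (Cons b bs)
  then show ?case by (simp only: iter_average.simps average_zero)
qed simp

lemma iter_average_invariant:
  "(\<And>b r x. b \<in> set bs \<Longrightarrow> \<omega> (x + r *\<^sub>R b) = \<omega> x) \<Longrightarrow> iter_average bs \<omega> = \<omega>"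
  by (induction bs) (auto simp: average_invariant)

lemma pullback_affine_iter_average:
  "linear A \<Longrightarrow> pullback_affine A c (iter_average (map A bs) \<omega>) = iter_average bs (pullback_affine A c \<omega>)"
  by (induction bs arbitrary: \<omega>) (auto simp: pullback_affine_average)

lemma translation_invariant_span:
  assumes "\<And>b r x. b \<in> B \<Longrightarrow> \<omega> (x + r *\<^sub>R b) = \<omega> x" "v \<in> span B"
  shows "\<omega> (x + v) = \<omega> x"
  using assms(2)
proof (induction arbitrary: x rule: span_induct_alt)
  case (step c b y)
  have "\<omega> (x + (c *\<^sub>R b + y)) = \<omega> ((x + y) + c *\<^sub>R b)" by (simp add: algebra_simps)
  then show ?case using step assms(1) by simp
qed simp

section \<open>The cohomology of a mapping torus\<close>

text \<open>A polynomial in the pullback by \<open>D\<close>: the factor for \<open>q\<close> annihilates the eigenvectors with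
  eigenvalue \<open>q\<close> and fixes those with eigenvalue 1 (it is junk for \<open>q = 1\<close>).\<close>

primrec kill_eigen :: "complex list \<Rightarrow> ('e \<Rightarrow> 'e) \<Rightarrow> ('e list \<Rightarrow> complex) \<Rightarrow> 'e list \<Rightarrow> complex" where
  "kill_eigen [] D f = f"
| "kill_eigen (q # qs) D f = kill_eigen qs D (\<lambda>vs. (f (map D vs) - q * f vs) / (1 - q))"

lemma pullback_affine_compose:
  "linear A' \<Longrightarrow> pullback_affine A c (pullback_affine A' c' \<omega>) = pullback_affine (A' \<circ> A) (A' c + c') \<omega>"
  by (simp add: pullback_affine_def linear_add fun_eq_iff add.assoc)

lemma pullback_affine_add: "pullback_affine A c (\<omega> + \<eta>) = pullback_affine A c \<omega> + pullback_affine A c \<eta>"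
  by (simp add: pullback_affine_def fun_eq_iff)

lemma pullback_affine_fscale: "pullback_affine A c (fscale z \<omega>) = fscale z (pullback_affine A c \<omega>)"
  by (simp add: pullback_affine_def fscale_def)

lemma pullback_affine_contract:
  "A v = v \<Longrightarrow> pullback_affine A c (contract v \<omega>) = contract v (pullback_affine A c \<omega>)"
  by (simp add: pullback_affine_def contract_def)

text \<open>Used in degree 0: there the truncated \<open>p - 1\<close> is again 0, and a function
  that is written as a differential must vanish because the differential has degree 1.\<close>

lemma forms_disjoint:
  assumes "\<omega> \<in> forms p" "\<omega> \<in> forms q" "p \<noteq> q"
  shows "\<omega> = 0"
proof (intro ext)
  fix x vs
  show "\<omega> x vs = 0 x vs"
    using alternating_length[OF forms_alternating[OF assms(1)], of vs]
      alternating_length[OF forms_alternating[OF assms(2)], of vs] assms(3) by (cases "length vs = p") auto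
qed

text \<open>The group of the maps \<open>x \<mapsto> R (s \<gamma>) x + \<gamma>\<close> for \<open>\<gamma> \<in> \<Gamma>\<close> acts on \<open>'e\<close>; the quotient is the mapping
  torus of \<open>R 1\<close> on the torus \<open>ker s / (\<Gamma> \<inter> ker s)\<close>. The vectors \<open>B\<close> need not generate \<open>\<Gamma> \<inter> ker s\<close>.\<close>

locale mapping_torus =
  fixes s :: "'e::euclidean_space \<Rightarrow> real" and R :: "real \<Rightarrow> 'e \<Rightarrow> 'e" and e :: 'e
    and \<Gamma> :: "'e set" and B :: "'e list"
  assumes linear_s: "linear s" and linear_R: "\<And>c. linear (R c)"
    and R_0: "\<And>x. R 0 x = x" and R_add: "\<And>a b x. R (a + b) x = R a (R b x)"
    and s_R [simp]: "\<And>c x. s (R c x) = s x" and R_e [simp]: "\<And>c. R c e = e" and s_e [simp]: "s e = 1"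
    and e_in: "e \<in> \<Gamma>" and add_in: "\<And>\<gamma> \<delta>. \<gamma> \<in> \<Gamma> \<Longrightarrow> \<delta> \<in> \<Gamma> \<Longrightarrow> \<gamma> + \<delta> \<in> \<Gamma>"
    and uminus_in: "\<And>\<gamma>. \<gamma> \<in> \<Gamma> \<Longrightarrow> - \<gamma> \<in> \<Gamma>" and s_in_Ints: "\<And>\<gamma>. \<gamma> \<in> \<Gamma> \<Longrightarrow> s \<gamma> \<in> \<int>"
    and R_in: "\<And>\<gamma> c. \<gamma> \<in> \<Gamma> \<Longrightarrow> c \<in> \<int> \<Longrightarrow> R c \<gamma> \<in> \<Gamma>"
    and B_in: "set B \<subseteq> \<Gamma>" and s_B: "\<And>b. b \<in> set B \<Longrightarrow> s b = 0"
    and span_B: "\<And>x. s x = 0 \<Longrightarrow> x \<in> span (set B)"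
    and discrete: "\<exists>\<delta>>0. \<forall>\<gamma>\<in>\<Gamma>. norm \<gamma> < \<delta> \<longrightarrow> \<gamma> = 0"
begin

lemmas s_add [simp] = linear_add[OF linear_s] and s_scale [simp] = linear_scale[OF linear_s]
  and s_minus [simp] = linear_neg[OF linear_s] and s_diff [simp] = linear_diff[OF linear_s]
  and s_zero [simp] = linear_0[OF linear_s]
lemmas R_plus = linear_add[OF linear_R] and R_scale = linear_scale[OF linear_R]
  and R_minus = linear_neg[OF linear_R] and R_diff = linear_diff[OF linear_R]

lemma bounded_linear_s: "bounded_linear s" and bounded_linear_R: "bounded_linear (R c)"
  using linear_s linear_R by (simp_all add: linear_conv_bounded_linear)

lemma R_compose: "R a \<circ> R b = R (a + b)"
  by (simp add: fun_eq_iff R_add)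

lemma zero_in: "0 \<in> \<Gamma>"
  using add_in[OF e_in uminus_in[OF e_in]] by simp

lemma scale_e_in: "of_int k *\<^sub>R e \<in> \<Gamma>"
proof (induction k rule: int_induct[of _ 0])
  case (step1 k)
  then show ?case using add_in[OF step1(2) e_in] by (simp add: scaleR_left_distrib)
next
  case (step2 k)
  then show ?case using add_in[OF step2(2) uminus_in[OF e_in]] by (simp add: scaleR_left_diff_distrib)
qed (simp add: zero_in)

section \<open>The action of the group and its invariant forms\<close>

definition act :: "'e \<Rightarrow> 'e form \<Rightarrow> 'e form" where
  "act \<gamma> \<omega> = pullback_affine (R (s \<gamma>)) \<gamma> \<omega>"

definition invforms :: "nat \<Rightarrow> 'e form set" where
  "invforms p = {\<omega> \<in> forms p. \<forall>\<gamma>\<in>\<Gamma>. act \<gamma> \<omega> = \<omega>}"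

lemma invforms_forms: "\<omega> \<in> invforms p \<Longrightarrow> \<omega> \<in> forms p"
  and invforms_act: "\<omega> \<in> invforms p \<Longrightarrow> \<gamma> \<in> \<Gamma> \<Longrightarrow> act \<gamma> \<omega> = \<omega>"
  by (auto simp: invforms_def)

lemma invformsI: "\<omega> \<in> forms p \<Longrightarrow> (\<And>\<gamma>. \<gamma> \<in> \<Gamma> \<Longrightarrow> act \<gamma> \<omega> = \<omega>) \<Longrightarrow> \<omega> \<in> invforms p"
  by (auto simp: invforms_def)

lemma act_add: "act \<gamma> (\<omega> + \<eta>) = act \<gamma> \<omega> + act \<gamma> \<eta>"
  and act_fscale: "act \<gamma> (fscale z \<omega>) = fscale z (act \<gamma> \<omega>)"
  by (simp_all add: act_def pullback_affine_add pullback_affine_fscale)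

lemma act_ed: "\<omega> \<in> forms p \<Longrightarrow> act \<gamma> (ed \<omega>) = ed (act \<gamma> \<omega>)"
  unfolding act_def by (rule ed_pullback_affine[OF bounded_linear_R, symmetric])

text \<open>Pullbacks compose contravariantly: the affine map of \<open>\<gamma>\<close> comes
  first, then that of \<open>\<delta>\<close>. The heights add because \<open>R\<close> preserves
  \<open>s\<close>.\<close>

lemma act_act: "act \<gamma> (act \<delta> \<omega>) = act (R (s \<delta>) \<gamma> + \<delta>) \<omega>"
  by (simp add: act_def pullback_affine_compose[OF linear_R] R_compose add.commute)

lemma R_0_eq_id: "R 0 = (\<lambda>x. x)"
  by (simp add: fun_eq_iff R_0)

lemma act_kernel: "s \<gamma> = 0 \<Longrightarrow> act \<gamma> \<omega> x = \<omega> (x + \<gamma>)"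
  by (simp add: act_def pullback_affine_def R_0_eq_id fun_eq_iff)

lemma invforms_translate: "\<omega> \<in> invforms p \<Longrightarrow> \<gamma> \<in> \<Gamma> \<Longrightarrow> s \<gamma> = 0 \<Longrightarrow> \<omega> (x + \<gamma>) = \<omega> x"
  using invforms_act[of \<omega> p \<gamma>] act_kernel[of \<gamma> \<omega> x] by simp

lemma invforms_add:
  assumes "\<omega> \<in> invforms p" "\<eta> \<in> invforms p"
  shows "\<omega> + \<eta> \<in> invforms p"
  by (rule invformsI[OF forms_add[OF assms[THEN invforms_forms]]]) (simp only: act_add assms[THEN invforms_act])

lemma invforms_fscale:
  assumes "\<omega> \<in> invforms p"
  shows "fscale z \<omega> \<in> invforms p"
  by (rule invformsI[OF forms_fscale[OF assms[THEN invforms_forms]]]) (simp only: act_fscale assms[THEN invforms_act])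

lemma invforms_diff: "\<omega> \<in> invforms p \<Longrightarrow> \<eta> \<in> invforms p \<Longrightarrow> \<omega> - \<eta> \<in> invforms p"
  unfolding diff_fscale by (intro invforms_add invforms_fscale)

lemma invforms_zero: "0 \<in> invforms p"
  by (rule invformsI[OF forms_zero]) (simp add: act_def pullback_affine_def fun_eq_iff)

lemma invforms_ed:
  assumes "\<omega> \<in> invforms p"
  shows "ed \<omega> \<in> invforms (Suc p)"
  by (rule invformsI[OF forms_ed[OF assms[THEN invforms_forms]]])
    (simp only: act_ed[OF assms[THEN invforms_forms]] assms[THEN invforms_act])

lemma invforms_fixed_contract:
  assumes "\<omega> \<in> invforms p" "\<And>c. R c v = v"
  shows "contract v \<omega> \<in> invforms (p - 1)"
proof (rule invformsI[OF forms_contract[OF assms(1)[THEN invforms_forms]]])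
  show "act \<gamma> (contract v \<omega>) = contract v \<omega>" if "\<gamma> \<in> \<Gamma>" for \<gamma>
    using pullback_affine_contract[of "R (s \<gamma>)" v \<gamma> \<omega>] assms(2) invforms_act[OF assms(1) that]
    by (simp only: act_def)
qed

lemma act_average: "act \<gamma> (average \<phi> (R (s \<gamma>) v) \<omega>) = average \<phi> v (act \<gamma> \<omega>)"
  unfolding act_def by (rule pullback_affine_average[OF linear_R])

lemma invforms_fixed_average:
  assumes "\<omega> \<in> invforms p" "\<And>c. R c v = v" "continuous_on UNIV \<phi>"
  shows "average \<phi> v \<omega> \<in> invforms p"
proof (rule invformsI)
  show "average \<phi> v \<omega> \<in> forms p" by (rule forms_average[OF invforms_forms[OF assms(1)] assms(3)])
  show "act \<gamma> (average \<phi> v \<omega>) = average \<phi> v \<omega>" if "\<gamma> \<in> \<Gamma>" for \<gamma>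
    using act_average[of \<gamma> \<phi> v \<omega>] invforms_act[OF assms(1) that] assms(2) by simp
qed

lemma iter_average_translate:
  assumes "\<omega> \<in> invforms p" "set C \<subseteq> \<Gamma>" "\<And>b. b \<in> set C \<Longrightarrow> s b = 0" "v \<in> span (set C)"
  shows "iter_average C \<omega> (x + v) = iter_average C \<omega> x"
  by (rule translation_invariant_span[OF _ assms(4)], rule iter_average_periodic[OF invforms_forms[OF assms(1)]])
    (use assms invforms_translate[OF assms(1)] in auto)

text \<open>Averages over two bases commute, and each fixes the image of the other one.\<close>

lemma iter_average_basis_independent:
  assumes "\<omega> \<in> invforms p" "set C \<subseteq> \<Gamma>" "\<And>b. b \<in> set C \<Longrightarrow> s b = 0" "\<And>x. s x = 0 \<Longrightarrow> x \<in> span (set C)"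
  shows "iter_average C \<omega> = iter_average B \<omega>"
proof -
  have "iter_average C (iter_average B \<omega>) = iter_average B \<omega>"
    by (rule iter_average_invariant, rule iter_average_translate[OF assms(1) B_in s_B])
      (auto intro: span_B simp: assms(3))
  moreover have "iter_average B (iter_average C \<omega>) = iter_average C \<omega>"
    by (rule iter_average_invariant, rule iter_average_translate[OF assms(1-3)])
      (auto intro: assms(4) simp: s_B)
  ultimately show ?thesis using iter_average_commute[OF invforms_forms[OF assms(1)], of B C] by simp
qed

lemma iter_average_B_translate: "\<omega> \<in> invforms p \<Longrightarrow> s v = 0 \<Longrightarrow> iter_average B \<omega> (x + v) = iter_average B \<omega> x"
  by (rule iter_average_translate[OF _ B_in s_B span_B])

lemma invforms_iter_average:
  assumes "\<omega> \<in> invforms p"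
  shows "iter_average B \<omega> \<in> invforms p"
proof (rule invformsI)
  show "iter_average B \<omega> \<in> forms p" by (rule forms_iter_average[OF invforms_forms[OF assms]])
  fix \<gamma> assume \<gamma>: "\<gamma> \<in> \<Gamma>"
  \<comment> \<open>The pullback by \<open>\<gamma>\<close> turns the average along \<open>B\<close>
    into the one along the vectors that \<open>R (s \<gamma>)\<close> maps to \<open>B\<close>.
    These again lie in \<open>\<Gamma>\<close> and span the kernel of \<open>s\<close>, so the
    average is unchanged.\<close>
  let ?C = "map (R (- s \<gamma>)) B"
  have RR: "R a (R (- a) x) = x" "R (- a) (R a x) = x" for a x
    using R_add[of a "- a" x] R_add[of "- a" a x] by (simp_all add: R_0)
  have C: "map (R (s \<gamma>)) ?C = B" by (simp add: o_def RR)
  have "act \<gamma> (iter_average B \<omega>) = iter_average ?C (act \<gamma> \<omega>)"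
    unfolding act_def using pullback_affine_iter_average[OF linear_R, of "s \<gamma>" \<gamma> ?C \<omega>] C by simp
  also have "act \<gamma> \<omega> = \<omega>" by (rule invforms_act[OF assms \<gamma>])
  also have "iter_average ?C \<omega> = iter_average B \<omega>"
  proof (rule iter_average_basis_independent[OF assms])
    show "set ?C \<subseteq> \<Gamma>" using B_in R_in s_in_Ints[OF \<gamma>] by auto
    show "s b = 0" if "b \<in> set ?C" for b using that s_B by auto
    fix x assume "s x = 0"
    then have "R (s \<gamma>) x \<in> span (set B)" by (intro span_B) simp
    then have "R (- s \<gamma>) (R (s \<gamma>) x) \<in> span (R (- s \<gamma>) ` set B)"
      by (simp add: linear_span_image[OF linear_R])
    then show "x \<in> span (set ?C)" by (simp add: RR)
  qed
  finally show "act \<gamma> (iter_average B \<omega>) = iter_average B \<omega>" .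
qed

section \<open>Gluing translates with weights on the base\<close>

definition periodize :: "(real \<Rightarrow> real) \<Rightarrow> 'e form \<Rightarrow> 'e form" where
  "periodize \<kappa> \<eta> = (\<lambda>x vs. \<Sum>k::int | \<bar>s x + of_int k\<bar> < 2.
     of_real (\<kappa> (s x + of_int k)) * act (of_int k *\<^sub>R e) \<eta> x vs)"

lemma finite_translates: "finite {k::int. \<bar>u + of_int k\<bar> < r}" for u :: real
proof (rule finite_subset)
  show "{k::int. \<bar>u + of_int k\<bar> < r} \<subseteq> {\<lfloor>- u - r\<rfloor>..\<lceil>- u + r\<rceil>}"
    by (auto; linarith)
qed simp

lemma periodize_local:
  assumes "\<And>u. \<bar>u\<bar> \<ge> 2 \<Longrightarrow> \<kappa> u = 0" "\<bar>s y - s x\<bar> < 1"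
  shows "periodize \<kappa> \<eta> y vs = (\<Sum>k::int | \<bar>s x + of_int k\<bar> < 3.
     of_real (\<kappa> (s y + of_int k)) * act (of_int k *\<^sub>R e) \<eta> y vs)"
  unfolding periodize_def
  by (rule sum.mono_neutral_left) (use assms finite_translates in \<open>auto simp: not_less\<close>)

lemma open_slab: "open {y. \<bar>s y - s x\<bar> < 1}"
  by (intro open_Collect_less continuous_intros linear_continuous_on bounded_linear_s)

lemma smooth_comp_s: "smooth \<kappa> \<Longrightarrow> smooth (\<lambda>x. complex_of_real (\<kappa> (s x + c)))" for \<kappa> :: "real \<Rightarrow> real"
  by (rule smooth_bounded_linear[OF bounded_linear_of_real smooth_affine[OF bounded_linear_s]])

lemma forms_act: "\<omega> \<in> forms p \<Longrightarrow> act \<gamma> \<omega> \<in> forms p"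
  unfolding act_def by (rule forms_pullback_affine[OF bounded_linear_R])

lemma forms_periodize:
  assumes "\<eta> \<in> forms p" "smooth \<kappa>" "\<And>u. \<bar>u\<bar> \<ge> 2 \<Longrightarrow> \<kappa> u = 0"
  shows "periodize \<kappa> \<eta> \<in> forms p"
  unfolding forms_iff
proof (intro conjI allI)
  show "alternating p (periodize \<kappa> \<eta> x)" for x
    unfolding periodize_def
    by (intro alternating_sum alternating_mult forms_alternating[OF forms_act[OF assms(1)]])
  show "smooth (\<lambda>x. periodize \<kappa> \<eta> x vs)" for vs
  proof (rule smooth_local)
    fix x
    have "smooth (\<lambda>y. \<Sum>k::int | \<bar>s x + of_int k\<bar> < 3.
        of_real (\<kappa> (s y + of_int k)) * act (of_int k *\<^sub>R e) \<eta> y vs)"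
      by (intro smooth_sum smooth_mult smooth_comp_s assms(2) forms_smooth[OF forms_act[OF assms(1)]])
    then show "\<exists>V g. open V \<and> x \<in> V \<and> smooth g \<and> (\<forall>y\<in>V. periodize \<kappa> \<eta> y vs = g y)"
      using open_slab[of x] periodize_local[OF assms(3)]
      by (intro exI[of _ "{y. \<bar>s y - s x\<bar> < 1}"] exI[of _ "\<lambda>y. \<Sum>k::int | \<bar>s x + of_int k\<bar> < 3.
        of_real (\<kappa> (s y + of_int k)) * act (of_int k *\<^sub>R e) \<eta> y vs"]) simp
  qed
qed

lemma act_periodize:
  assumes "\<And>\<gamma> x. \<gamma> \<in> \<Gamma> \<Longrightarrow> s \<gamma> = 0 \<Longrightarrow> \<eta> (x + \<gamma>) = \<eta> x" "\<gamma> \<in> \<Gamma>"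
  shows "act \<gamma> (periodize \<kappa> \<eta>) = periodize \<kappa> \<eta>"
proof (intro ext)
  fix x vs
  obtain j where j: "s \<gamma> = of_int j" using s_in_Ints[OF assms(2)] Ints_cases by blast
  \<comment> \<open>In the group, \<open>\<gamma>\<close> is a multiple of \<open>e\<close> combined
    with an element of height 0. The latter is absorbed by the invariance of \<open>\<eta>\<close>,
    the former shifts the summation index by \<open>j\<close>.\<close>
  define \<nu> where "\<nu> = \<gamma> - of_int j *\<^sub>R e"
  have *: "act \<gamma> (act (of_int k *\<^sub>R e) \<eta>) = act (of_int (k + j) *\<^sub>R e) \<eta>" for k
  proof -
    let ?d = "R (of_int k) \<nu>"
    have d: "?d \<in> \<Gamma>" "s ?d = 0"
      using add_in[OF assms(2) uminus_in[OF scale_e_in[of j]]] j by (auto simp: \<nu>_def intro!: R_in)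
    have "act \<gamma> (act (of_int k *\<^sub>R e) \<eta>) = act (R (of_int k) \<gamma> + of_int k *\<^sub>R e) \<eta>"
      by (simp add: act_act)
    also have "R (of_int k) \<gamma> + of_int k *\<^sub>R e = of_int (k + j) *\<^sub>R e + ?d"
      by (simp add: \<nu>_def R_diff R_scale algebra_simps)
    also have "act (of_int (k + j) *\<^sub>R e + ?d) \<eta> = act (of_int (k + j) *\<^sub>R e) (act ?d \<eta>)"
      using d(2) by (simp add: act_act R_0)
    also have "act ?d \<eta> = \<eta>"
      using assms(1)[OF d] act_kernel[OF d(2), of \<eta>] by (intro ext) simp
    finally show ?thesis .
  qed
  have "act \<gamma> (periodize \<kappa> \<eta>) x vs = (\<Sum>k::int | \<bar>s x + of_int (k + j)\<bar> < 2.
     of_real (\<kappa> (s x + of_int (k + j))) * act \<gamma> (act (of_int k *\<^sub>R e) \<eta>) x vs)"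
    unfolding periodize_def act_def[of \<gamma>] pullback_affine_def by (simp add: j add_ac)
  also have "\<dots> = periodize \<kappa> \<eta> x vs"
    unfolding periodize_def *
    by (rule sum.reindex_bij_witness[of _ "\<lambda>k. k - j" "\<lambda>k. k + j"]) auto
  finally show "act \<gamma> (periodize \<kappa> \<eta>) x vs = periodize \<kappa> \<eta> x vs" .
qed

lemma act_wedge1: "act \<gamma> (wedge1 s \<omega>) = wedge1 s (act \<gamma> \<omega>)"
  unfolding act_def by (rule pullback_affine_wedge1) simp

lemma periodize_wedge1: "periodize \<kappa> (wedge1 s \<eta>) = wedge1 s (periodize \<kappa> \<eta>)"
proof (intro ext)
  fix x vs
  have "wedge1 s (periodize \<kappa> \<eta>) x vs = (\<Sum>k::int | \<bar>s x + of_int k\<bar> < 2.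
      of_real (\<kappa> (s x + of_int k)) * wedge1 s (act (of_int k *\<^sub>R e) \<eta>) x vs)"
    by (simp add: wedge1_def periodize_def sum_distrib_left alt_sum_sum alt_sum_mult[symmetric] mult.left_commute)
  then show "periodize \<kappa> (wedge1 s \<eta>) x vs = wedge1 s (periodize \<kappa> \<eta>) x vs"
    by (simp add: periodize_def act_wedge1)
qed

lemma periodize_fscale: "periodize \<kappa> (fscale c \<eta>) = fscale c (periodize \<kappa> \<eta>)"
  by (simp add: periodize_def act_fscale fun_eq_iff) (simp add: fscale_def sum_distrib_left mult.left_commute)

lemma periodize_invariant:
  assumes "\<omega> \<in> invforms p"
  shows "periodize \<kappa> \<omega> x vs = of_real (\<Sum>k | \<bar>s x + of_int k\<bar> < 2. \<kappa> (s x + of_int k)) * \<omega> x vs"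
  by (simp add: periodize_def invforms_act[OF assms scale_e_in] sum_distrib_right)

text \<open>Leibniz rule: differentiating a weight \<kappa>(s + k) produces the factor ds, and the
  translates commute with \<open>ed\<close>.\<close>

lemma ed_periodize:
  assumes "\<eta> \<in> forms p" "\<And>u. (\<kappa> has_real_derivative \<kappa>' u) (at u)"
    and "\<And>u. \<bar>u\<bar> \<ge> 2 \<Longrightarrow> \<kappa> u = 0" "\<And>u. \<bar>u\<bar> \<ge> 2 \<Longrightarrow> \<kappa>' u = 0"
  shows "ed (periodize \<kappa> \<eta>) = wedge1 s (periodize \<kappa>' \<eta>) + periodize \<kappa> (ed \<eta>)"
proof (intro ext)
  fix x vs
  let ?K = "{k::int. \<bar>s x + of_int k\<bar> < 3}"
  have d: "dird (\<lambda>y. periodize \<kappa> \<eta> y us) x v = of_real (s v) * periodize \<kappa>' \<eta> x us +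
      (\<Sum>k\<in>?K. of_real (\<kappa> (s x + of_int k)) * dird (\<lambda>y. act (of_int k *\<^sub>R e) \<eta> y us) x v)" for us v
  proof -
    have \<kappa>: "((\<lambda>y. complex_of_real (\<kappa> (s y + c))) has_derivative (\<lambda>v. of_real (s v * \<kappa>' (s x + c)))) (at x)" for c
    proof -
      have "((\<lambda>y. s y + c) has_derivative s) (at x)"
        by (auto intro!: derivative_eq_intros bounded_linear_imp_has_derivative[OF bounded_linear_s])
      from diff_chain_at[OF this assms(2)[of "s x + c", unfolded has_field_derivative_def]]
      have "((\<lambda>y. \<kappa> (s y + c)) has_derivative (\<lambda>v. s v * \<kappa>' (s x + c))) (at x)"
        by (simp add: o_def mult.commute)
      then show ?thesis by (rule bounded_linear.has_derivative[OF bounded_linear_of_real])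
    qed
    have "((\<lambda>y. \<Sum>k\<in>?K. of_real (\<kappa> (s y + of_int k)) * act (of_int k *\<^sub>R e) \<eta> y us) has_derivative
      (\<lambda>v. \<Sum>k\<in>?K. of_real (\<kappa> (s x + of_int k)) * dird (\<lambda>y. act (of_int k *\<^sub>R e) \<eta> y us) x v +
         of_real (s v * \<kappa>' (s x + of_int k)) * act (of_int k *\<^sub>R e) \<eta> x us)) (at x)"
      by (intro has_derivative_sum has_derivative_mult \<kappa> smooth_has_derivative forms_smooth[OF forms_act[OF assms(1)]])
    from dird_eq[OF this]
    have "dird (\<lambda>y. \<Sum>k\<in>?K. of_real (\<kappa> (s y + of_int k)) * act (of_int k *\<^sub>R e) \<eta> y us) x v =
      of_real (s v) * (\<Sum>k\<in>?K. of_real (\<kappa>' (s x + of_int k)) * act (of_int k *\<^sub>R e) \<eta> x us) +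
      (\<Sum>k\<in>?K. of_real (\<kappa> (s x + of_int k)) * dird (\<lambda>y. act (of_int k *\<^sub>R e) \<eta> y us) x v)"
      by (simp add: sum.distrib sum_distrib_left mult_ac add.commute)
    also have "dird (\<lambda>y. \<Sum>k\<in>?K. of_real (\<kappa> (s y + of_int k)) * act (of_int k *\<^sub>R e) \<eta> y us) x v =
        dird (\<lambda>y. periodize \<kappa> \<eta> y us) x v"
      by (rule dird_cong_open(1)[OF open_slab[of x]]) (auto simp: periodize_local[OF assms(3)])
    also have "(\<Sum>k\<in>?K. of_real (\<kappa>' (s x + of_int k)) * act (of_int k *\<^sub>R e) \<eta> x us) = periodize \<kappa>' \<eta> x us"
      by (rule periodize_local[symmetric]) (auto simp: assms(4))
    finally show ?thesis .
  qed
  have "ed (periodize \<kappa> \<eta>) x vs = wedge1 s (periodize \<kappa>' \<eta>) x vs +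
      (\<Sum>k\<in>?K. of_real (\<kappa> (s x + of_int k)) * ed (act (of_int k *\<^sub>R e) \<eta>) x vs)"
    by (simp add: ed_eq d alt_sum_add alt_sum_sum alt_sum_mult wedge1_def)
  also have "(\<Sum>k\<in>?K. of_real (\<kappa> (s x + of_int k)) * ed (act (of_int k *\<^sub>R e) \<eta>) x vs) = periodize \<kappa> (ed \<eta>) x vs"
    by (subst periodize_local[where x = x and y = x, OF assms(3)]) (auto simp: act_ed[OF assms(1)])
  finally show "ed (periodize \<kappa> \<eta>) x vs = (wedge1 s (periodize \<kappa>' \<eta>) + periodize \<kappa> (ed \<eta>)) x vs" by simp
qed

text \<open>The homotopy operator on the fibre is not equivariant under the monodromy. Gluing its translates
  with a partition of unity on the base leaves an error term of the form \<open>ds \<and> \<beta>\<close>; applying the same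
  construction to the error term gives no new error, because \<open>ds \<and> ds = 0\<close>.\<close>

theorem exact_minus_iter_average:
  assumes "\<omega> \<in> invforms (Suc q)" "ed \<omega> = 0"
  shows "\<exists>\<eta>\<in>invforms q. ed \<eta> = \<omega> - iter_average B \<omega>"
proof (rule partition_of_unity_exists)
  fix \<kappa> \<kappa>1 \<kappa>2 :: "real \<Rightarrow> real"
  assume smooth: "smooth \<kappa>" "smooth \<kappa>1"
    and deriv: "\<And>u. (\<kappa> has_real_derivative \<kappa>1 u) (at u)" "\<And>u. (\<kappa>1 has_real_derivative \<kappa>2 u) (at u)"
    and supp: "\<And>u. \<bar>u\<bar> \<ge> 2 \<Longrightarrow> \<kappa> u = 0" "\<And>u. \<bar>u\<bar> \<ge> 2 \<Longrightarrow> \<kappa>1 u = 0" "\<And>u. \<bar>u\<bar> \<ge> 2 \<Longrightarrow> \<kappa>2 u = 0"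
    and sums: "\<And>u. (\<Sum>k | \<bar>u + of_int k\<bar> < 2. \<kappa> (u + of_int k)) = 1"
      "\<And>u. (\<Sum>k | \<bar>u + of_int k\<bar> < 2. \<kappa>1 (u + of_int k)) = 0"
  let ?av = "iter_average B"
  \<comment> \<open>All translates of an invariant form agree, so only the sum of the weights
    counts: 1 for \<open>\<kappa>\<close> and 0 for \<open>\<kappa>1\<close>.\<close>
  have per1: "periodize \<kappa> \<alpha> = \<alpha>" if "\<alpha> \<in> invforms p" for \<alpha> p
    by (intro ext) (simp only: periodize_invariant[OF that] sums of_real_1 mult_1)
  have per0: "periodize \<kappa>1 \<alpha> = 0" if "\<alpha> \<in> invforms p" for \<alpha> p
    by (intro ext) (simp only: periodize_invariant[OF that] sums of_real_0 mult_zero_left zero_fun_apply)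
  have periodize_inv: "periodize \<kappa> (iter_homotopy B \<alpha>) \<in> invforms q" if "\<alpha> \<in> invforms (Suc q)" for \<alpha>
  proof (rule invformsI)
    have "iter_homotopy B \<alpha> \<in> forms q" using forms_iter_homotopy[OF invforms_forms[OF that]] by simp
    then show "periodize \<kappa> (iter_homotopy B \<alpha>) \<in> forms q" by (rule forms_periodize) (rule smooth supp; assumption)+
    fix \<gamma> assume \<gamma>: "\<gamma> \<in> \<Gamma>"
    show "act \<gamma> (periodize \<kappa> (iter_homotopy B \<alpha>)) = periodize \<kappa> (iter_homotopy B \<alpha>)"
      by (rule act_periodize[OF translation_invariant_iter_homotopy \<gamma>]) (rule invforms_translate[OF that])
  qed
  define \<omega>0 where "\<omega>0 = \<omega> - ?av \<omega>"
  have av_inv: "?av \<omega> \<in> invforms (Suc q)" by (rule invforms_iter_average[OF assms(1)])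
  have \<omega>0: "\<omega>0 \<in> invforms (Suc q)" unfolding \<omega>0_def by (rule invforms_diff[OF assms(1) av_inv])
  have "?av (?av \<omega>) = ?av \<omega>"
    by (rule iter_average_invariant) (auto intro!: iter_average_B_translate[OF assms(1)] simp: s_B)
  then have av_\<omega>0: "?av \<omega>0 = 0"
    unfolding \<omega>0_def diff_fscale
    by (simp only: iter_average_add[OF invforms_forms[OF assms(1)] forms_fscale[OF invforms_forms[OF av_inv]]]
        iter_average_fscale) (simp add: fscale_def fun_eq_iff)
  define \<eta> where "\<eta> = iter_homotopy B \<omega>"
  have \<eta>: "\<eta> \<in> forms q" unfolding \<eta>_def using forms_iter_homotopy[OF invforms_forms[OF assms(1)]] by simp
  have ed_\<eta>: "ed \<eta> = \<omega>0"
    unfolding \<eta>_def \<omega>0_def by (rule ed_iter_homotopy[OF invforms_forms[OF assms(1)] assms(2)])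
  define \<theta> where "\<theta> = periodize \<kappa> \<eta>"
  have \<theta>: "\<theta> \<in> invforms q" unfolding \<theta>_def \<eta>_def by (rule periodize_inv[OF assms(1)])
  have \<eta>1: "periodize \<kappa>1 \<eta> \<in> forms q" by (rule forms_periodize[OF \<eta> smooth(2) supp(2)])
  \<comment> \<open>The gluing error: the part of \<open>ed \<theta>\<close> in which the weights
    were differentiated.\<close>
  define \<zeta> where "\<zeta> = wedge1 s (periodize \<kappa>1 \<eta>)"
  have "ed \<theta> = wedge1 s (periodize \<kappa>1 \<eta>) + periodize \<kappa> (ed \<eta>)"
    unfolding \<theta>_def by (rule ed_periodize[OF \<eta>]) (rule deriv supp; assumption)+
  then have ed_\<theta>: "ed \<theta> = \<zeta> + \<omega>0" by (simp only: ed_\<eta> per1[OF \<omega>0] \<zeta>_def)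
  then have \<zeta>_eq: "\<zeta> = ed \<theta> - \<omega>0" by (simp only: add_diff_cancel_right')
  have \<zeta>: "\<zeta> \<in> invforms (Suc q)" unfolding \<zeta>_eq by (intro invforms_diff invforms_ed \<theta> \<omega>0)
  have "ed (periodize \<kappa>1 \<eta>) = wedge1 s (periodize \<kappa>2 \<eta>) + periodize \<kappa>1 (ed \<eta>)"
    by (rule ed_periodize[OF \<eta>]) (rule deriv supp; assumption)+
  \<comment> \<open>The first summand dies because ds wedge ds is 0, the second because
    \<open>\<omega>0\<close> is invariant and \<open>\<kappa>1\<close> sums to 0.\<close>
  then have "wedge1 s (ed (periodize \<kappa>1 \<eta>)) = 0"
    by (simp only: ed_\<eta> per0[OF \<omega>0] wedge1_add wedge1_wedge1 wedge1_zero add_0)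
  then have ed_\<zeta>: "ed \<zeta> = 0"
    unfolding \<zeta>_def ed_wedge1[OF bounded_linear_s \<eta>1] by (simp add: fscale_def fun_eq_iff)
  have hom_\<zeta>: "iter_homotopy B \<zeta> = fscale (-1) (wedge1 s (iter_homotopy B (periodize \<kappa>1 \<eta>)))"
    unfolding \<zeta>_def by (rule iter_homotopy_wedge1[OF \<eta>1 s_B])
  have hom_\<zeta>_form: "iter_homotopy B \<zeta> \<in> forms q"
    using forms_iter_homotopy[OF invforms_forms[OF \<zeta>]] by simp
  define \<xi> where "\<xi> = periodize \<kappa> (iter_homotopy B \<zeta>)"
  have \<xi>: "\<xi> \<in> invforms q" unfolding \<xi>_def by (rule periodize_inv[OF \<zeta>])
  \<comment> \<open>The vectors of \<open>B\<close> have height 0, so the homotopy of the error is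
    again ds times a form, and gluing it creates no further error.\<close>
  have "wedge1 s (periodize \<kappa>1 (iter_homotopy B \<zeta>)) = 0"
    unfolding hom_\<zeta> periodize_fscale periodize_wedge1 wedge1_fscale wedge1_wedge1
    by (simp add: fscale_def fun_eq_iff)
  moreover have "ed \<xi> = wedge1 s (periodize \<kappa>1 (iter_homotopy B \<zeta>)) + periodize \<kappa> (ed (iter_homotopy B \<zeta>))"
    unfolding \<xi>_def by (rule ed_periodize[OF hom_\<zeta>_form]) (rule deriv supp; assumption)+
  ultimately have ed_\<xi>: "ed \<xi> = \<zeta> - ?av \<zeta>"
    by (simp only: ed_iter_homotopy[OF invforms_forms[OF \<zeta>] ed_\<zeta>]
      per1[OF invforms_diff[OF \<zeta> invforms_iter_average[OF \<zeta>]]] add_0)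
  \<comment> \<open>\<open>\<omega>0\<close> averages to 0, so averaging the equation for
    \<open>\<zeta>\<close> leaves only the differential.\<close>
  have av_\<zeta>: "?av \<zeta> = ed (?av \<theta>)"
    unfolding \<zeta>_eq diff_fscale
      iter_average_add[OF invforms_forms[OF invforms_ed[OF \<theta>]] forms_fscale[OF invforms_forms[OF \<omega>0]]]
      iter_average_fscale av_\<omega>0 ed_iter_average[OF invforms_forms[OF \<theta>]]
    by (simp add: fscale_def fun_eq_iff)
  \<comment> \<open>\<open>\<xi>\<close> removes the error up to its average, and
    \<open>?av \<theta>\<close> removes that average.\<close>
  have "ed (\<theta> - \<xi> - ?av \<theta>) = ed \<theta> - ed \<xi> - ed (?av \<theta>)"
    using invforms_forms[OF \<theta>] invforms_forms[OF \<xi>]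
    by (simp only: ed_diff[of _ q _ q] forms_diff forms_iter_average)
  also have "\<dots> = \<omega>0" unfolding ed_\<theta> ed_\<xi> av_\<zeta> by (simp add: fun_eq_iff)
  finally show ?thesis
    using invforms_diff[OF invforms_diff[OF \<theta> \<xi>] invforms_iter_average[OF \<theta>]] \<omega>0_def by blast
qed

text \<open>On invariant forms the pullback by \<open>R 1\<close> equals the translation by \<open>- e\<close>, which is homotopic to the
  identity. Hence in cohomology only the eigenvalue 1 of the monodromy survives.\<close>

definition monodromy :: "'e form \<Rightarrow> 'e form" where
  "monodromy \<omega> = pullback_affine (R 1) 0 \<omega>"

lemma monodromy_invforms:
  assumes "\<omega> \<in> invforms p"
  shows "monodromy \<omega> = pullback_affine (\<lambda>x. x) (- e) \<omega>" "monodromy \<omega> \<in> invforms p"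
proof -
  \<comment> \<open>Invariance under \<open>e\<close>, read at x - e: \<open>R 1\<close> fixes
    \<open>e\<close>, so the translation cancels and the plain pullback by \<open>R 1\<close>
    remains.\<close>
  have "act e \<omega> (x - e) vs = \<omega> (x - e) vs" for x vs using invforms_act[OF assms e_in] by simp
  then show *: "monodromy \<omega> = pullback_affine (\<lambda>x. x) (- e) \<omega>"
    by (simp add: monodromy_def act_def pullback_affine_def fun_eq_iff R_diff)
  show "monodromy \<omega> \<in> invforms p"
  proof (rule invformsI)
    show "monodromy \<omega> \<in> forms p"
      unfolding monodromy_def by (rule forms_pullback_affine[OF bounded_linear_R invforms_forms[OF assms]])
    fix \<gamma> assume \<gamma>: "\<gamma> \<in> \<Gamma>"
    have "act \<gamma> (monodromy \<omega>) x vs = act \<gamma> \<omega> (x - e) vs" for x vs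
      by (simp add: * act_def pullback_affine_def R_diff algebra_simps)
    then show "act \<gamma> (monodromy \<omega>) = monodromy \<omega>"
      by (simp add: invforms_act[OF assms \<gamma>]) (simp add: * pullback_affine_def fun_eq_iff)
  qed
qed

lemma ed_monodromy: "\<omega> \<in> forms p \<Longrightarrow> ed (monodromy \<omega>) = monodromy (ed \<omega>)"
  unfolding monodromy_def by (rule ed_pullback_affine[OF bounded_linear_R])

text \<open>The homotopy that translates along \<open>- e\<close> stays within the invariant forms
  because \<open>R\<close> fixes \<open>e\<close>.\<close>

lemma exact_monodromy_minus:
  assumes "\<omega> \<in> invforms p" "ed \<omega> = 0"
  shows "\<exists>\<eta>\<in>invforms (p - 1). ed \<eta> = monodromy \<omega> - \<omega>"
proof
  have e: "R c (- e) = - e" for c by (simp add: R_minus)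
  show "ed (contract (- e) (average (\<lambda>t. 1) (- e) \<omega>)) = monodromy \<omega> - \<omega>"
    unfolding monodromy_invforms(1)[OF assms(1)]
    by (rule ed_contract_average(1)[OF invforms_forms[OF assms(1)] assms(2)])
  show "contract (- e) (average (\<lambda>t. 1) (- e) \<omega>) \<in> invforms (p - 1)"
    by (intro invforms_fixed_contract invforms_fixed_average assms e continuous_on_const)
qed

section \<open>Projection to the eigenvalue 1 of the monodromy\<close>

primrec monodromy_filter :: "complex list \<Rightarrow> 'e form \<Rightarrow> 'e form" where
  "monodromy_filter [] \<omega> = \<omega>"
| "monodromy_filter (q # qs) \<omega> = monodromy_filter qs (fscale (1 / (1 - q)) (monodromy \<omega> - fscale q \<omega>))"

text \<open>Two readings of one factor: on the left it annihilates the eigenvalue \<open>q\<close>,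
  on the right it moves a closed invariant form only by a differential.\<close>

lemma monodromy_filter_step:
  "q \<noteq> 1 \<Longrightarrow> fscale (1 / (1 - q)) (monodromy \<omega> - fscale q \<omega>) = \<omega> + fscale (1 / (1 - q)) (monodromy \<omega> - \<omega>)"
  by (simp add: fun_eq_iff fscale_def field_simps)

lemma monodromy_add: "monodromy (\<omega> + \<eta>) = monodromy \<omega> + monodromy \<eta>"
  and monodromy_fscale: "monodromy (fscale c \<omega>) = fscale c (monodromy \<omega>)"
  by (simp_all only: monodromy_def pullback_affine_add pullback_affine_fscale)

lemma invforms_monodromy_filter: "\<omega> \<in> invforms p \<Longrightarrow> monodromy_filter qs \<omega> \<in> invforms p"
proof (induction qs arbitrary: \<omega>)
  case (Cons q qs)
  show ?case unfolding monodromy_filter.simps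
    by (intro Cons.IH invforms_fscale invforms_diff monodromy_invforms(2) Cons.prems)
qed simp

lemma monodromy_filter_add:
  "monodromy_filter qs (\<omega> + \<eta>) = monodromy_filter qs \<omega> + monodromy_filter qs \<eta>"
proof (induction qs arbitrary: \<omega> \<eta>)
  case (Cons q qs)
  have "fscale (1 / (1 - q)) (monodromy (\<omega> + \<eta>) - fscale q (\<omega> + \<eta>)) =
    fscale (1 / (1 - q)) (monodromy \<omega> - fscale q \<omega>) + fscale (1 / (1 - q)) (monodromy \<eta> - fscale q \<eta>)"
    by (simp add: monodromy_add) (simp add: fun_eq_iff fscale_def diff_divide_distrib add_divide_distrib algebra_simps)
  then show ?case by (simp only: monodromy_filter.simps Cons.IH)
qed (simp add: fun_eq_iff)

lemma monodromy_filter_fscale: "monodromy_filter qs (fscale c \<omega>) = fscale c (monodromy_filter qs \<omega>)"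
proof (induction qs arbitrary: \<omega>)
  case (Cons q qs)
  have "fscale (1 / (1 - q)) (monodromy (fscale c \<omega>) - fscale q (fscale c \<omega>)) =
    fscale c (fscale (1 / (1 - q)) (monodromy \<omega> - fscale q \<omega>))"
    by (simp add: monodromy_fscale) (simp add: fun_eq_iff fscale_def algebra_simps)
  then show ?case by (simp only: monodromy_filter.simps Cons.IH)
qed simp

lemma ed_monodromy_filter: "\<omega> \<in> forms p \<Longrightarrow> ed (monodromy_filter qs \<omega>) = monodromy_filter qs (ed \<omega>)"
proof (induction qs arbitrary: \<omega>)
  case (Cons q qs)
  have m: "monodromy \<omega> \<in> forms p"
    unfolding monodromy_def by (rule forms_pullback_affine[OF bounded_linear_R Cons.prems])
  note f = forms_fscale[OF Cons.prems, of q]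
  have "ed (fscale (1 / (1 - q)) (monodromy \<omega> - fscale q \<omega>)) =
      fscale (1 / (1 - q)) (monodromy (ed \<omega>) - fscale q (ed \<omega>))"
    by (simp only: ed_fscale[OF forms_diff[OF m f]] ed_diff[OF m f] ed_fscale[OF Cons.prems] ed_monodromy[OF Cons.prems])
  then show ?case
    by (simp only: monodromy_filter.simps Cons.IH[OF forms_fscale[OF forms_diff[OF m f]]])
qed simp

lemma exact_minus_monodromy_filter:
  assumes "\<omega> \<in> invforms p" "ed \<omega> = 0" "1 \<notin> set qs"
  shows "\<exists>\<eta>\<in>invforms (p - 1). ed \<eta> = \<omega> - monodromy_filter qs \<omega>"
  using assms
proof (induction qs arbitrary: \<omega>)
  case Nil
  then show ?case by (intro bexI[OF _ invforms_zero]) (simp only: ed_zero monodromy_filter.simps diff_self)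
next
  case (Cons q qs)
  let ?\<alpha> = "fscale (1 / (1 - q)) (monodromy \<omega> - fscale q \<omega>)"
  have q: "q \<noteq> 1" using Cons.prems by auto
  obtain \<eta> where \<eta>: "\<eta> \<in> invforms (p - 1)" "ed \<eta> = monodromy \<omega> - \<omega>"
    using exact_monodromy_minus[OF Cons.prems(1,2)] by blast
  note f = invforms_forms[OF Cons.prems(1)]
  have m: "monodromy \<omega> \<in> forms p" by (rule invforms_forms[OF monodromy_invforms(2)[OF Cons.prems(1)]])
  have "ed ?\<alpha> = fscale (1 / (1 - q)) (monodromy 0 - fscale q 0)"
    by (simp only: ed_fscale[OF forms_diff[OF m forms_fscale[OF f]]] ed_diff[OF m forms_fscale[OF f]]
        ed_fscale[OF f] ed_monodromy[OF f] Cons.prems(2))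
  then have "ed ?\<alpha> = 0" by (simp add: fscale_def monodromy_def pullback_affine_def fun_eq_iff)
  moreover have "?\<alpha> \<in> invforms p"
    by (intro invforms_fscale invforms_diff monodromy_invforms(2) Cons.prems)
  moreover have "1 \<notin> set qs" using Cons.prems(3) by simp
  ultimately obtain \<theta> where \<theta>: "\<theta> \<in> invforms (p - 1)" "ed \<theta> = ?\<alpha> - monodromy_filter qs ?\<alpha>"
    using Cons.IH[of ?\<alpha>] by blast
  have "ed (\<theta> + fscale (- (1 / (1 - q))) \<eta>) = (?\<alpha> - monodromy_filter qs ?\<alpha>) + fscale (- (1 / (1 - q))) (monodromy \<omega> - \<omega>)"
    by (simp only: ed_add[OF invforms_forms[OF \<theta>(1)] forms_fscale[OF invforms_forms[OF \<eta>(1)]]]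
        ed_fscale[OF invforms_forms[OF \<eta>(1)]] \<theta>(2) \<eta>(2))
  also have "\<dots> = \<omega> - monodromy_filter (q # qs) \<omega>"
    unfolding monodromy_filter.simps
    by (simp only: monodromy_filter_step[OF q]) (simp add: fun_eq_iff fscale_def)
  finally show ?case by (intro bexI[OF _ invforms_add[OF \<theta>(1) invforms_fscale[OF \<eta>(1)]]])
qed

text \<open>\<open>R 1 x\<close> and \<open>x\<close> have the same height, so a form that is
  constant along the fibres has equal values there, and the pullback acts on the vectors
  alone.\<close>

lemma monodromy_translate:
  assumes "\<And>v x. s v = 0 \<Longrightarrow> \<omega> (x + v) = \<omega> x"
  shows "monodromy \<omega> x vs = \<omega> x (map (R 1) vs)"
  using assms[of "R 1 x - x" x] by (simp add: monodromy_def pullback_affine_def)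

lemma monodromy_filter_translate:
  assumes "\<And>v x. s v = 0 \<Longrightarrow> \<omega> (x + v) = \<omega> x"
  shows "monodromy_filter qs \<omega> x = kill_eigen qs (R 1) (\<omega> x)"
  using assms
proof (induction qs arbitrary: \<omega>)
  case (Cons q qs)
  let ?\<alpha> = "fscale (1 / (1 - q)) (monodromy \<omega> - fscale q \<omega>)"
  have \<alpha>: "?\<alpha> x = (\<lambda>vs. (\<omega> x (map (R 1) vs) - q * \<omega> x vs) / (1 - q))" for x
    by (simp add: fscale_def monodromy_translate[OF Cons.prems] fun_eq_iff)
  have "?\<alpha> (x + v) = ?\<alpha> x" if "s v = 0" for v x
    unfolding \<alpha> using Cons.prems[OF that] by simp
  then show ?case unfolding monodromy_filter.simps kill_eigen.simps by (simp only: Cons.IH \<alpha>)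
qed simp

section \<open>The projection onto constant coefficient forms\<close>

definition constforms :: "nat \<Rightarrow> 'e form set" where
  "constforms p = {\<omega> \<in> invforms p. \<forall>x. \<omega> x = \<omega> 0}"

text \<open>The name recalls the part that it plays: for closed invariant forms it selects the
  constant coefficient representative of the class.\<close>

definition harmonic :: "complex list \<Rightarrow> 'e form \<Rightarrow> 'e form" where
  "harmonic qs \<omega> = average (\<lambda>t. 1) e (monodromy_filter qs (iter_average B \<omega>))"

lemma harmonic_add:
  assumes "\<omega> \<in> invforms p" "\<eta> \<in> invforms p"
  shows "harmonic qs (\<omega> + \<eta>) = harmonic qs \<omega> + harmonic qs \<eta>"
  unfolding harmonic_def iter_average_add[OF assms[THEN invforms_forms]] monodromy_filter_add
  by (rule average_add[OF invforms_forms[OF invforms_monodromy_filter[OF invforms_iter_average[OF assms(1)]]]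
        invforms_forms[OF invforms_monodromy_filter[OF invforms_iter_average[OF assms(2)]]] continuous_on_const])

lemma harmonic_fscale: "harmonic qs (fscale c \<omega>) = fscale c (harmonic qs \<omega>)"
  unfolding harmonic_def iter_average_fscale monodromy_filter_fscale average_fscale ..

context
  fixes qs :: "complex list" and p :: nat
  \<comment> \<open>This encodes that \<open>qs\<close> covers the eigenvalues other than 1 in
    degree \<open>p\<close>: whatever the filter leaves is fixed by \<open>R 1\<close>.\<close>
  assumes kill: "\<And>f. alternating p f \<Longrightarrow> kill_eigen qs (R 1) f (map (R 1) vs) = kill_eigen qs (R 1) f vs"
begin

lemma filtered_translate:
  assumes "\<omega> \<in> invforms p"
  shows "s v = 0 \<Longrightarrow> monodromy_filter qs (iter_average B \<omega>) (x + v) = monodromy_filter qs (iter_average B \<omega>) x"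
    and "monodromy_filter qs (iter_average B \<omega>) (x + e) = monodromy_filter qs (iter_average B \<omega>) x"
proof -
  let ?\<alpha> = "monodromy_filter qs (iter_average B \<omega>)"
  have eq: "?\<alpha> y = kill_eigen qs (R 1) (iter_average B \<omega> y)" for y
    by (rule monodromy_filter_translate) (rule iter_average_B_translate[OF assms])
  show t: "?\<alpha> (x + v) = ?\<alpha> x" if "s v = 0" for x v
    unfolding eq by (simp only: iter_average_B_translate[OF assms that])
  have inv: "?\<alpha> \<in> invforms p" by (intro invforms_monodromy_filter invforms_iter_average assms)
  show "?\<alpha> (x + e) = ?\<alpha> x"
  proof
    fix vs
    \<comment> \<open>Invariance under \<open>e\<close> concerns the map x to R 1 x + e. Constancy
      along the fibres removes \<open>R 1\<close> from the point, \<open>kill\<close> removes it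
      from the vectors, and a plain period \<open>e\<close> remains.\<close>
    have "?\<alpha> x vs = act e ?\<alpha> x vs" by (simp only: invforms_act[OF inv e_in])
    also have "\<dots> = ?\<alpha> (R 1 x + e) (map (R 1) vs)" by (simp add: act_def pullback_affine_def)
    also have "?\<alpha> (R 1 x + e) = ?\<alpha> (x + e)" using t[of "R 1 x - x" "x + e"] by (simp add: algebra_simps)
    also have "?\<alpha> (x + e) (map (R 1) vs) = ?\<alpha> (x + e) vs"
      unfolding eq by (intro kill forms_alternating[of _ p] forms_iter_average invforms_forms assms)
    finally show "?\<alpha> (x + e) vs = ?\<alpha> x vs" by simp
  qed
qed

lemma harmonic_constforms:
  assumes "\<omega> \<in> invforms p"
  shows "harmonic qs \<omega> \<in> constforms p"
proof -
  let ?\<alpha> = "monodromy_filter qs (iter_average B \<omega>)"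
  have inv: "?\<alpha> \<in> invforms p" by (intro invforms_monodromy_filter invforms_iter_average assms)
  have "harmonic qs \<omega> x = harmonic qs \<omega> 0" for x
  proof -
    have "harmonic qs \<omega> x = harmonic qs \<omega> (s x *\<^sub>R e + (x - s x *\<^sub>R e))" by simp
    also have "\<dots> = harmonic qs \<omega> (s x *\<^sub>R e)"
      unfolding harmonic_def by (intro translation_invariant_average filtered_translate(1)[OF assms]) simp
    also have "\<dots> = harmonic qs \<omega> (0 + s x *\<^sub>R e)" by simp
    also have "\<dots> = harmonic qs \<omega> 0"
      unfolding harmonic_def by (intro average_periodic[OF invforms_forms[OF inv]] filtered_translate(2)[OF assms])
    finally show ?thesis .
  qed
  then show ?thesis
    by (auto simp: constforms_def harmonic_def intro!: invforms_fixed_average inv)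
qed

lemma exact_minus_harmonic:
  assumes "\<omega> \<in> invforms p" "ed \<omega> = 0" "1 \<notin> set qs"
  shows "p = 0 \<Longrightarrow> \<omega> = harmonic qs \<omega>"
    and "p = Suc q \<Longrightarrow> \<exists>\<eta>\<in>invforms q. ed \<eta> = \<omega> - harmonic qs \<omega>"
proof -
  let ?\<beta> = "iter_average B \<omega>"
  let ?\<alpha> = "monodromy_filter qs ?\<beta>"
  have \<beta>: "?\<beta> \<in> invforms p" by (intro invforms_iter_average assms)
  have ed\<beta>: "ed ?\<beta> = 0"
    unfolding ed_iter_average[OF invforms_forms[OF assms(1)]] assms(2) by (rule iter_average_zero)
  have \<alpha>: "?\<alpha> \<in> invforms p" by (intro invforms_monodromy_filter \<beta>)
  have "monodromy_filter qs 0 = 0" using monodromy_filter_fscale[of qs 0 0] by (simp add: fscale_def zero_fun_def)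
  then have ed\<alpha>: "ed ?\<alpha> = 0" unfolding ed_monodromy_filter[OF invforms_forms[OF \<beta>]] ed\<beta> .
  have "\<exists>\<eta>\<in>invforms (p - 1). ed \<eta> = \<omega> - ?\<beta>"
  proof (cases p)
    case 0
    then have "ed (iter_homotopy B \<omega>) \<in> forms (Suc 0)" "\<omega> - ?\<beta> \<in> forms 0"
      using forms_ed[OF forms_iter_homotopy[OF invforms_forms[OF assms(1)], of B]]
        forms_diff[OF invforms_forms[OF assms(1)] invforms_forms[OF \<beta>]] by auto
    then have "\<omega> - ?\<beta> = 0"
      unfolding ed_iter_homotopy[OF invforms_forms[OF assms(1)] assms(2)] by (rule forms_disjoint) simp
    then show ?thesis by (intro bexI[OF _ invforms_zero]) (simp only: ed_zero)
  next
    case (Suc q)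
    then show ?thesis using exact_minus_iter_average[of \<omega> q] assms by simp
  qed
  then obtain \<eta>1 where \<eta>1: "\<eta>1 \<in> invforms (p - 1)" "ed \<eta>1 = \<omega> - ?\<beta>" by blast
  obtain \<eta>2 where \<eta>2: "\<eta>2 \<in> invforms (p - 1)" "ed \<eta>2 = ?\<beta> - ?\<alpha>"
    using exact_minus_monodromy_filter[OF \<beta> ed\<beta> assms(3)] by blast
  define \<eta>3 where "\<eta>3 = contract e (average (\<lambda>t. of_real (t - 1)) e ?\<alpha>)"
  have \<eta>3: "\<eta>3 \<in> invforms (p - 1)"
    unfolding \<eta>3_def by (intro invforms_fixed_contract invforms_fixed_average \<alpha> R_e continuous_weight)
  have ed\<eta>3: "ed \<eta>3 = ?\<alpha> - harmonic qs \<omega>"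
    unfolding \<eta>3_def harmonic_def by (rule ed_contract_average(2)[OF invforms_forms[OF \<alpha>] ed\<alpha>])
  have "ed (\<eta>1 + \<eta>2 + \<eta>3) = ed \<eta>1 + ed \<eta>2 + ed \<eta>3"
    using \<eta>1(1) \<eta>2(1) \<eta>3 by (simp only: ed_add[of _ "p - 1" _ "p - 1"] forms_add invforms_forms)
  also have "\<dots> = \<omega> - harmonic qs \<omega>"
    unfolding \<eta>1(2) \<eta>2(2) ed\<eta>3 by (simp add: fun_eq_iff)
  finally have ed: "ed (\<eta>1 + \<eta>2 + \<eta>3) = \<omega> - harmonic qs \<omega>" .
  have inv: "\<eta>1 + \<eta>2 + \<eta>3 \<in> invforms (p - 1)" by (intro invforms_add \<eta>1 \<eta>2 \<eta>3)
  show "\<omega> = harmonic qs \<omega>" if "p = 0"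
  proof -
    have h: "harmonic qs \<omega> \<in> forms p" using harmonic_constforms[OF assms(1)] by (simp add: constforms_def invforms_def)
    have "\<omega> - harmonic qs \<omega> = 0"
      using forms_disjoint[OF forms_ed[OF invforms_forms[OF inv], unfolded ed]
          forms_diff[OF invforms_forms[OF assms(1)] h]] that by simp
    then show ?thesis by (simp only: right_minus_eq)
  qed
  show "\<exists>\<eta>\<in>invforms q. ed \<eta> = \<omega> - harmonic qs \<omega>" if "p = Suc q"
    using inv ed that by auto
qed

end

text \<open>A constant form is fixed by all averages, and by the monodromy because on invariant
  forms that is a translation.\<close>

lemma harmonic_of_constforms:
  assumes "\<omega> \<in> constforms p" "1 \<notin> set qs"
  shows "harmonic qs \<omega> = \<omega>"
proof -
  have c: "\<omega> x = \<omega> y" for x y using assms(1) unfolding constforms_def by (metis (mono_tags, lifting) mem_Collect_eq)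
  have inv: "\<omega> \<in> invforms p" using assms(1) by (simp add: constforms_def)
  have "pullback_affine (\<lambda>x. x) (- e) \<omega> x vs = \<omega> x vs" for x vs
    using c[of "x - e" x] by (simp add: pullback_affine_def)
  then have "monodromy \<omega> = \<omega>"
    unfolding monodromy_invforms(1)[OF inv] by (intro ext)
  then have step: "fscale (1 / (1 - q)) (monodromy \<omega> - fscale q \<omega>) = \<omega>" if "q \<noteq> 1" for q
    unfolding monodromy_filter_step[OF that] by (simp add: fscale_def fun_eq_iff)
  have "monodromy_filter qs \<omega> = \<omega>" using assms(2)
  proof (induction qs)
    case (Cons q qs)
    then have q: "q \<noteq> 1" "1 \<notin> set qs" by auto
    show ?case by (simp only: monodromy_filter.simps step[OF q(1)] Cons.IH[OF q(2)])
  qed simp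
  moreover have "iter_average B \<omega> = \<omega>" by (rule iter_average_invariant) (rule c)
  ultimately show ?thesis unfolding harmonic_def by (simp only:) (rule average_invariant, rule c)
qed

lemma ed_constforms:
  assumes "\<omega> \<in> constforms p"
  shows "ed \<omega> = 0"
proof -
  have "\<omega> y = \<omega> 0" for y using assms unfolding constforms_def by blast
  then have "(\<lambda>y. \<omega> y us) = (\<lambda>y. \<omega> 0 us)" for us by (intro ext) (rule fun_cong)
  then have "dird (\<lambda>y. \<omega> y us) x v = 0" for us x v by (metis frechet_derivative_const)
  then show ?thesis by (simp add: fun_eq_iff ed_eq alt_sum_zero)
qed

text \<open>All three operators commute with \<open>ed\<close>, and the projection of
  \<open>\<eta>\<close> is constant, hence closed.\<close>

lemma harmonic_ed:
  assumes "\<eta> \<in> invforms p"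
    and "\<And>f vs. alternating p f \<Longrightarrow> kill_eigen qs (R 1) f (map (R 1) vs) = kill_eigen qs (R 1) f vs"
  shows "harmonic qs (ed \<eta>) = 0"
proof -
  have "harmonic qs (ed \<eta>) = ed (harmonic qs \<eta>)"
    unfolding harmonic_def ed_iter_average[OF invforms_forms[OF assms(1)], symmetric]
      ed_monodromy_filter[OF invforms_forms[OF invforms_iter_average[OF assms(1)]], symmetric]
    by (rule ed_average[symmetric, of _ p])
      (intro invforms_forms invforms_monodromy_filter invforms_iter_average assms(1) continuous_on_const)+
  also have "\<dots> = 0" by (rule ed_constforms[OF harmonic_constforms[OF assms(2) assms(1)]])
  finally show ?thesis .
qed

end

section \<open>Forms on the quotient\<close>

text \<open>\<open>P\<close> killing \<open>E\<close> gives independence of the representative,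
  congruence of \<open>P\<close> to the identity modulo \<open>E\<close> gives injectivity, and
  \<open>P\<close> fixing \<open>A\<close> gives surjectivity. Additivity is asked on
  \<open>M\<close> because differences of representatives lie in \<open>E\<close>.\<close>

lemma linear_iso_quotient:
  fixes P :: "'v::ab_group_add \<Rightarrow> 'v" and sc :: "complex \<Rightarrow> 'v \<Rightarrow> 'v"
  assumes vs: "vector_space sc"
    and M: "Z \<subseteq> M" "E \<subseteq> M" "\<And>x y. x \<in> M \<Longrightarrow> y \<in> M \<Longrightarrow> P (x + y) = P x + P y"
      "\<And>z x. x \<in> M \<Longrightarrow> P (sc z x) = sc z (P x)"
    and Z: "\<And>x y. x \<in> Z \<Longrightarrow> y \<in> Z \<Longrightarrow> x + y \<in> Z" "\<And>z x. x \<in> Z \<Longrightarrow> sc z x \<in> Z"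
    and E: "0 \<in> E" "\<And>x y. x \<in> E \<Longrightarrow> y \<in> E \<Longrightarrow> x + y \<in> E" "\<And>z x. x \<in> E \<Longrightarrow> sc z x \<in> E"
    and A: "A \<subseteq> Z" "\<And>x. x \<in> A \<Longrightarrow> P x = x" "\<And>x. x \<in> Z \<Longrightarrow> P x \<in> A"
    and PE: "\<And>x. x \<in> E \<Longrightarrow> P x = 0" "\<And>x. x \<in> Z \<Longrightarrow> x - P x \<in> E"
  shows "linear_iso ((\<lambda>\<omega>. \<omega> +o E) ` Z) (\<lambda>z X. sc z ` X + E) A sc
    (\<lambda>X. P (SOME \<omega>. \<omega> \<in> Z \<and> X = \<omega> +o E))"
proof -
  interpret vector_space sc by (rule vs)
  define \<Phi> where "\<Phi> X = P (SOME \<omega>. \<omega> \<in> Z \<and> X = \<omega> +o E)" for X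
  have mem: "y \<in> x +o E \<longleftrightarrow> y - x \<in> E" for x y
    by (auto simp: elt_set_plus_def algebra_simps intro: bexI[of _ "y - x"])
  have Em: "- x \<in> E" if "x \<in> E" for x using E(3)[OF that, of "-1"] by simp
  have coset: "x +o E = y +o E" if "x - y \<in> E" for x y
  proof -
    have "u - x \<in> E \<longleftrightarrow> u - y \<in> E" for u
      using E(2)[OF _ that, of "u - x"] E(2)[OF _ Em[OF that], of "u - y"] by auto
    then show ?thesis by (auto simp: mem)
  qed
  have P_eq: "P x = P y" if "x +o E = y +o E" "x \<in> Z" "y \<in> Z" for x y
  proof -
    have "y - x \<in> E" using mem[where x = x and y = y] mem[where x = y and y = y] E(1) that(1) by simp
    moreover have "P y = P x + P (y - x)"
      using M(3)[of x "y - x"] M(1,2) that calculation by auto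
    ultimately show ?thesis using PE(1) by simp
  qed
  have \<Phi>: "\<Phi> (x +o E) = P x" if "x \<in> Z" for x
  proof -
    have "(SOME \<omega>. \<omega> \<in> Z \<and> x +o E = \<omega> +o E) \<in> Z \<and> x +o E = (SOME \<omega>. \<omega> \<in> Z \<and> x +o E = \<omega> +o E) +o E"
      by (rule someI[of _ x]) (use that in simp)
    then show ?thesis unfolding \<Phi>_def using P_eq[of x] that by metis
  qed
  have add: "(x +o E) + (y +o E) = (x + y) +o E" for x y
  proof (rule set_eqI)
    fix u
    have "u \<in> (x +o E) + (y +o E) \<longleftrightarrow> (\<exists>a\<in>E. \<exists>b\<in>E. u = (x + a) + (y + b))"
      by (auto simp: set_plus_def elt_set_plus_def)
    also have "\<dots> \<longleftrightarrow> u - (x + y) \<in> E"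
    proof
      assume "\<exists>a\<in>E. \<exists>b\<in>E. u = (x + a) + (y + b)"
      then obtain a b where ab: "a \<in> E" "b \<in> E" "u = (x + a) + (y + b)" by blast
      then have "u - (x + y) = a + b" by (simp add: algebra_simps)
      then show "u - (x + y) \<in> E" using E(2)[OF ab(1,2)] by simp
    next
      assume "u - (x + y) \<in> E"
      then show "\<exists>a\<in>E. \<exists>b\<in>E. u = (x + a) + (y + b)"
        by (intro bexI[of _ "u - (x + y)"] bexI[of _ 0]) (auto simp: E(1) algebra_simps)
    qed
    finally show "u \<in> (x +o E) + (y +o E) \<longleftrightarrow> u \<in> (x + y) +o E" by (simp add: mem)
  qed
  have scale: "sc z ` (x +o E) + E = sc z x +o E" for z x
  proof (rule set_eqI)
    fix u
    have "u \<in> sc z ` (x +o E) + E \<longleftrightarrow> (\<exists>a\<in>E. \<exists>b\<in>E. u = sc z (x + a) + b)"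
      by (auto simp: set_plus_def elt_set_plus_def)
    also have "\<dots> \<longleftrightarrow> u - sc z x \<in> E"
    proof
      assume "\<exists>a\<in>E. \<exists>b\<in>E. u = sc z (x + a) + b"
      then obtain a b where ab: "a \<in> E" "b \<in> E" "u = sc z (x + a) + b" by blast
      then have "u - sc z x = sc z a + b" by (simp add: scale_right_distrib)
      then show "u - sc z x \<in> E" using E(2)[OF E(3)[OF ab(1)] ab(2)] by simp
    next
      assume "u - sc z x \<in> E"
      then show "\<exists>a\<in>E. \<exists>b\<in>E. u = sc z (x + a) + b"
        by (intro bexI[of _ 0] bexI[of _ "u - sc z x"]) (auto simp: E(1))
    qed
    finally show "u \<in> sc z ` (x +o E) + E \<longleftrightarrow> u \<in> sc z x +o E" by (simp add: mem)
  qed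
  have "bij_betw \<Phi> ((\<lambda>\<omega>. \<omega> +o E) ` Z) A"
  proof (rule bij_betwI')
    fix X Y assume "X \<in> (\<lambda>\<omega>. \<omega> +o E) ` Z" "Y \<in> (\<lambda>\<omega>. \<omega> +o E) ` Z"
    then obtain x y where xy: "X = x +o E" "Y = y +o E" "x \<in> Z" "y \<in> Z" by blast
    have "X = Y" if "P x = P y"
    proof -
      have "x - y = (x - P x) + - (y - P y)" using that by simp
      also have "\<dots> \<in> E" by (intro E(2) Em PE(2) xy)
      finally show ?thesis using coset xy by simp
    qed
    then show "(\<Phi> X = \<Phi> Y) = (X = Y)" using xy(1,2) \<Phi>[OF xy(3)] \<Phi>[OF xy(4)] by metis
  next
    show "\<Phi> X \<in> A" if "X \<in> (\<lambda>\<omega>. \<omega> +o E) ` Z" for X using that A(3) \<Phi> by auto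
    show "\<exists>X\<in>(\<lambda>\<omega>. \<omega> +o E) ` Z. a = \<Phi> X" if "a \<in> A" for a
      using that A(1,2) \<Phi>[of a] by (intro bexI[of _ "a +o E"]) auto
  qed
  then have "linear_iso ((\<lambda>\<omega>. \<omega> +o E) ` Z) (\<lambda>z X. sc z ` X + E) A sc \<Phi>"
    unfolding linear_iso_def using M Z by (auto simp: add scale \<Phi> subset_iff)
  then show ?thesis unfolding \<Phi>_def .
qed

lemma smooth_on_subset_cong:
  assumes "smooth f" "open U" "\<And>x. x \<in> U \<Longrightarrow> g x = f x"
  shows "smooth_on U g"
  using assms ck_on_cong[of U g f] ck_on_subset[of _ UNIV f U] by (auto simp: smooth_on_def)

context mapping_torus
begin

section \<open>Charts of the quotient and descent of invariant forms\<close>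

definition cover :: "'e \<Rightarrow> 'e set" where
  "cover x = (\<lambda>\<gamma>. R (s \<gamma>) x + \<gamma>) ` \<Gamma>"

definition cover_atlas :: "('e set, 'e) chart set" where
  "cover_atlas = {(U, cover) | U. open U \<and> inj_on cover U}"

definition desc :: "'e form \<Rightarrow> ('e set, 'e) mform" where
  "desc \<omega> = (\<lambda>c. if c \<in> cover_atlas then restrict_form (fst c) \<omega> else 0)"

lemma cover_translate:
  assumes "\<gamma> \<in> \<Gamma>"
  shows "cover (R (s \<gamma>) x + \<gamma>) = cover x"
proof -
  have "cover (R (s \<gamma>) x + \<gamma>) \<subseteq> cover x" if "\<gamma> \<in> \<Gamma>" for \<gamma> x
  proof
    fix y assume "y \<in> cover (R (s \<gamma>) x + \<gamma>)"
    then obtain \<delta> where \<delta>: "\<delta> \<in> \<Gamma>" "y = R (s \<delta>) (R (s \<gamma>) x + \<gamma>) + \<delta>" by (auto simp: cover_def)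
    then have "y = R (s (R (s \<delta>) \<gamma> + \<delta>)) x + (R (s \<delta>) \<gamma> + \<delta>)"
      by (simp add: R_plus R_add add_ac)
    then show "y \<in> cover x"
      unfolding cover_def
      by (rule image_eqI) (rule add_in[OF R_in[OF that s_in_Ints[OF \<delta>(1)]] \<delta>(1)])
  qed
  note * = this
  define \<gamma>' where "\<gamma>' = - R (- s \<gamma>) \<gamma>"
  have "\<gamma>' \<in> \<Gamma>" unfolding \<gamma>'_def by (intro uminus_in R_in assms Ints_minus s_in_Ints)
  moreover have "R (s \<gamma>') (R (s \<gamma>) x + \<gamma>) + \<gamma>' = x"
    by (simp add: \<gamma>'_def R_plus R_add[symmetric] R_0)
  ultimately have "cover x \<subseteq> cover (R (s \<gamma>) x + \<gamma>)" using *[of \<gamma>' "R (s \<gamma>) x + \<gamma>"] by simp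
  with *[OF assms] show ?thesis by blast
qed

lemma cover_eqD:
  assumes "cover x = cover y"
  shows "\<exists>\<gamma>\<in>\<Gamma>. y = R (s \<gamma>) x + \<gamma>"
proof -
  have "y \<in> cover y" unfolding cover_def by (rule image_eqI[OF _ zero_in]) (simp add: R_0)
  then show ?thesis using assms by (auto simp: cover_def)
qed

lemma chart_exists: "\<exists>U. open U \<and> x \<in> U \<and> inj_on cover U"
proof -
  obtain \<delta> where \<delta>: "\<delta> > 0" "\<And>\<gamma>. \<gamma> \<in> \<Gamma> \<Longrightarrow> norm \<gamma> < \<delta> \<Longrightarrow> \<gamma> = 0" using discrete by blast
  \<comment> \<open>Two points of this slab differ in height by less than 1, so an element of
    \<open>\<Gamma>\<close> relating them has height 0 and acts as a translation; the ball then
    makes it shorter than \<open>\<delta>\<close>.\<close>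
  define U where "U = {y. \<bar>s y - s x\<bar> < 1 / 2} \<inter> ball x (\<delta> / 2)"
  have "open {y. \<bar>s y - s x\<bar> < 1 / 2}"
    by (intro open_Collect_less continuous_intros linear_continuous_on bounded_linear_s)
  then have "open U" "x \<in> U" using \<delta>(1) by (auto simp: U_def)
  moreover have "inj_on cover U"
  proof (rule inj_onI)
    fix y y' assume yy: "y \<in> U" "y' \<in> U" "cover y = cover y'"
    then obtain \<gamma> where \<gamma>: "\<gamma> \<in> \<Gamma>" "y' = R (s \<gamma>) y + \<gamma>" using cover_eqD by blast
    obtain j where j: "s \<gamma> = of_int j" using s_in_Ints[OF \<gamma>(1)] Ints_cases by blast
    have "s \<gamma> = s y' - s y" using \<gamma>(2) by simp
    moreover have "\<bar>s y - s x\<bar> < 1 / 2" "\<bar>s y' - s x\<bar> < 1 / 2" using yy(1,2) by (simp_all add: U_def)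
    ultimately have "\<bar>of_int j\<bar> < (1::real)" using j by linarith
    then have "j = 0" by linarith
    then have y': "y' = y + \<gamma>" using \<gamma>(2) j by (simp add: R_0)
    have "dist y y' < \<delta> / 2 + \<delta> / 2"
      using yy(1,2) dist_triangle_less_add[of y x "\<delta> / 2" y' "\<delta> / 2"] by (auto simp: U_def dist_commute)
    then have "norm \<gamma> < \<delta>" using y' by (simp add: dist_norm)
    then show "y = y'" using \<delta>(2)[OF \<gamma>(1)] y' by simp
  qed
  ultimately show ?thesis by blast
qed

text \<open>Near \<open>x\<close> the transition map is the affine map of this one
  \<open>\<gamma>\<close>, because the target of the second chart is open and \<open>cover\<close>
  is injective on it.\<close>

lemma pullback_transition:
  assumes "c \<in> cover_atlas" "c' \<in> cover_atlas" "x \<in> fst c" "\<gamma> \<in> \<Gamma>" "R (s \<gamma>) x + \<gamma> \<in> fst c'"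
  shows "pullback (transition c c') \<eta> x vs = \<eta> (R (s \<gamma>) x + \<gamma>) (map (R (s \<gamma>)) vs)"
proof -
  from assms(1,2) obtain U U' where U: "c = (U, cover)" "open U" and U': "c' = (U', cover)" "open U'" "inj_on cover U'"
    by (auto simp: cover_atlas_def)
  define V where "V = (\<lambda>y. R (s \<gamma>) y + \<gamma>) -` U'"
  have "continuous_on UNIV (\<lambda>y. R (s \<gamma>) y + \<gamma>)"
    by (intro continuous_intros linear_continuous_on bounded_linear_R)
  then have V: "open V" "x \<in> V" unfolding V_def using U'(2) assms(5) U' by (auto intro: open_vimage)
  have t: "transition c c' y = R (s \<gamma>) y + \<gamma>" if "y \<in> V" for y
    using that U' cover_translate[OF assms(4), of y] inv_into_f_eq[OF U'(3), of "R (s \<gamma>) y + \<gamma>" "cover y"]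
    by (simp add: transition_def U V_def)
  have d: "((\<lambda>y. R (s \<gamma>) y + \<gamma>) has_derivative R (s \<gamma>)) (at x)"
    by (auto intro!: derivative_eq_intros bounded_linear_imp_has_derivative bounded_linear_R)
  have "dird (transition c c') x v = R (s \<gamma>) v" for v
    by (rule trans[OF dird_cong_open(1)[OF V t] dird_eq[OF d]])
  then have "dird (transition c c') x = R (s \<gamma>)" by blast
  then show ?thesis using t[OF V(2)] by (simp add: pullback_def)
qed

lemma overlapE:
  assumes "c \<in> cover_atlas" "c' \<in> cover_atlas" "x \<in> overlap c c'"
  obtains \<gamma> where "x \<in> fst c" "\<gamma> \<in> \<Gamma>" "R (s \<gamma>) x + \<gamma> \<in> fst c'"
proof -
  from assms obtain y where "x \<in> fst c" "y \<in> fst c'" "cover x = cover y"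
    by (auto simp: overlap_def cover_atlas_def)
  then show ?thesis using cover_eqD[of x y] that by auto
qed

lemma overlapI:
  assumes "c \<in> cover_atlas" "c' \<in> cover_atlas" "x \<in> fst c" "\<gamma> \<in> \<Gamma>" "R (s \<gamma>) x + \<gamma> \<in> fst c'"
  shows "x \<in> overlap c c'"
  using assms cover_translate[OF assms(4), of x] by (force simp: overlap_def cover_atlas_def)

lemma desc_mforms:
  assumes "\<omega> \<in> invforms p"
  shows "desc \<omega> \<in> mforms cover_atlas p"
  unfolding mforms_def
proof (intro CollectI conjI allI impI ballI)
  fix c assume c: "c \<in> cover_atlas"
  then have op: "open (fst c)" by (auto simp: cover_atlas_def)
  have "smooth_on (fst c) (\<lambda>x. desc \<omega> c x vs)" for vs
    by (rule smooth_on_subset_cong[OF forms_smooth[OF invforms_forms[OF assms], of vs] op])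
      (simp add: desc_def c restrict_form_def)
  then show "desc \<omega> c \<in> forms_on p (fst c)"
    using forms_alternating[OF invforms_forms[OF assms]]
    by (simp add: forms_on_def) (simp add: desc_def restrict_form_def c)
  fix c' x assume c': "c' \<in> cover_atlas" and x: "x \<in> overlap c c'"
  obtain \<gamma> where \<gamma>: "x \<in> fst c" "\<gamma> \<in> \<Gamma>" "R (s \<gamma>) x + \<gamma> \<in> fst c'" by (rule overlapE[OF c c' x])
  have "act \<gamma> \<omega> x vs = \<omega> x vs" for vs using invforms_act[OF assms \<gamma>(2)] by simp
  then show "desc \<omega> c x = pullback (transition c c') (desc \<omega> c') x"
    by (intro ext) (simp add: pullback_transition[OF c c' \<gamma>] desc_def c c' restrict_form_def \<gamma>
        act_def pullback_affine_def)
qed (simp add: desc_def)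

text \<open>Compatibility of the local representatives for \<gamma> = 0 makes the glued value
  independent of the chart; for general \<open>\<gamma>\<close> it is invariance.\<close>

lemma desc_surj:
  assumes W: "W \<in> mforms cover_atlas p"
  shows "\<exists>\<omega>\<in>invforms p. desc \<omega> = W"
proof -
  have "\<exists>c. c \<in> cover_atlas \<and> x \<in> fst c" for x
    using chart_exists[of x] by (auto simp: cover_atlas_def)
  then obtain C where C: "\<And>x. C x \<in> cover_atlas" "\<And>x. x \<in> fst (C x)" by metis
  have comp: "W c x vs = W c' (R (s \<gamma>) x + \<gamma>) (map (R (s \<gamma>)) vs)"
    if "c \<in> cover_atlas" "c' \<in> cover_atlas" "x \<in> fst c" "\<gamma> \<in> \<Gamma>" "R (s \<gamma>) x + \<gamma> \<in> fst c'" for c c' x \<gamma> vs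
    using W overlapI[OF that] pullback_transition[OF that, of "W c'" vs] that(1,2) by (auto simp: mforms_def)
  have form: "W c \<in> forms_on p (fst c)" if "c \<in> cover_atlas" for c using W that by (auto simp: mforms_def)
  define \<omega> where "\<omega> x = W (C x) x" for x
  have \<omega>: "\<omega> x = W c x" if "c \<in> cover_atlas" "x \<in> fst c" for c x
    using comp[OF C(1) that(1) C(2) zero_in] that(2) by (intro ext) (simp add: \<omega>_def R_0_eq_id)
  have "\<omega> \<in> invforms p"
  proof (rule invformsI)
    have "smooth (\<lambda>x. \<omega> x vs)" for vs
      unfolding smooth_on_def
    proof (intro allI ck_on_local)
      fix k x
      let ?U = "fst (C x)"
      have op: "open ?U" using C(1)[of x] by (auto simp: cover_atlas_def)
      have "ck_on k ?U (\<lambda>y. W (C x) y vs)" using form[OF C(1)] by (auto simp: forms_on_def smooth_on_def)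
      then have "ck_on k ?U (\<lambda>y. \<omega> y vs)"
        using ck_on_cong[OF op, of "\<lambda>y. W (C x) y vs" "\<lambda>y. \<omega> y vs" k] \<omega>[OF C(1)] by simp
      then show "\<exists>V. open V \<and> x \<in> V \<and> ck_on k V (\<lambda>y. \<omega> y vs)" using op C(2) by blast
    qed
    moreover have "alternating p (\<omega> x)" for x
      using form[OF C(1)[of x]] C(2)[of x] by (simp add: forms_on_def \<omega>_def)
    ultimately show "\<omega> \<in> forms p" by (simp add: forms_iff)
    fix \<gamma> assume \<gamma>: "\<gamma> \<in> \<Gamma>"
    show "act \<gamma> \<omega> = \<omega>"
    proof (intro ext)
      fix x vs
      show "act \<gamma> \<omega> x vs = \<omega> x vs"
        using comp[OF C(1,1,2) \<gamma> C(2), of x vs] by (simp add: act_def pullback_affine_def \<omega>_def)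
    qed
  qed
  moreover have "desc \<omega> = W"
  proof (intro ext)
    fix c x vs
    show "desc \<omega> c x vs = W c x vs"
    proof (cases "c \<in> cover_atlas")
      case True
      then show ?thesis using \<omega>[OF True, of x] form[OF True]
        by (auto simp: desc_def restrict_form_def forms_on_def)
    next
      case False
      then have "W c = 0" using W unfolding mforms_def by blast
      then show ?thesis using False by (simp add: desc_def)
    qed
  qed
  ultimately show ?thesis by blast
qed

lemma desc_inj:
  assumes "desc \<omega> = desc \<eta>"
  shows "\<omega> = \<eta>"
proof
  fix x
  obtain U where "open U" "x \<in> U" "inj_on cover U" using chart_exists by blast
  then have "(U, cover) \<in> cover_atlas" "x \<in> U" by (auto simp: cover_atlas_def)
  then show "\<omega> x = \<eta> x" using fun_cong[OF fun_cong[OF assms], of "(U, cover)" x]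
    by (simp add: desc_def restrict_form_def)
qed

lemma desc_add: "desc (\<omega> + \<eta>) = desc \<omega> + desc \<eta>"
  by (simp add: desc_def restrict_form_def fun_eq_iff)

lemma desc_fscale: "desc (fscale z \<omega>) = mscale z (desc \<omega>)"
  by (simp add: desc_def restrict_form_def fun_eq_iff fscale_def mscale_def)

lemma desc_zero: "desc 0 = 0"
  by (simp add: desc_def restrict_form_def fun_eq_iff)

lemma desc_diff: "desc (\<omega> - \<eta>) = desc \<omega> - desc \<eta>"
  by (simp add: desc_def restrict_form_def fun_eq_iff)

lemma mderiv_desc: "mderiv (desc \<omega>) = desc (ed \<omega>)"
proof (intro ext)
  fix c x vs
  show "mderiv (desc \<omega>) c x vs = desc (ed \<omega>) c x vs"
  proof (cases "c \<in> cover_atlas \<and> x \<in> fst c")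
    case True
    then have op: "open (fst c)" by (auto simp: cover_atlas_def)
    have "dird (\<lambda>y. desc \<omega> c y us) x v = dird (\<lambda>y. \<omega> y us) x v" for us v
      by (rule dird_cong_open(1)[OF op]) (use True in \<open>auto simp: desc_def restrict_form_def\<close>)
    then show ?thesis using True
      by (simp add: mderiv_def ext_deriv_def) (simp add: desc_def restrict_form_def)
  next
    case False
    have "desc \<omega> c = 0" if "c \<notin> cover_atlas" using that by (simp add: desc_def)
    then show ?thesis using False
      by (cases "c \<in> cover_atlas") (auto simp: mderiv_def ext_deriv_def restrict_form_def desc_def)
  qed
qed

text \<open>\<open>kill\<close> is asked in all degrees up to \<open>p\<close> because a
  differential is treated through the projection of its primitive, which has degree p - 1.\<close>

theorem de_Rham_iso:
  assumes qs: "1 \<notin> set qs"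
    and kill: "\<And>p' f vs. p' \<le> p \<Longrightarrow> alternating p' f \<Longrightarrow>
      kill_eigen qs (R 1) f (map (R 1) vs) = kill_eigen qs (R 1) f vs"
  shows "\<exists>\<Phi>. linear_iso (de_Rham cover_atlas p) (class_scale cover_atlas p) (desc ` constforms p) mscale \<Phi>"
proof -
  let ?lift = "inv_into (invforms p) desc" and ?h = "harmonic qs"
  let ?Z = "closed_forms cover_atlas p" and ?E = "exact_forms cover_atlas p"
  have mf: "mforms cover_atlas q = desc ` invforms q" for q
    using desc_mforms desc_surj by blast
  have inj: "inj_on desc S" for S using desc_inj by (auto intro: inj_onI)
  have lift: "?lift (desc \<omega>) = \<omega>" if "\<omega> \<in> invforms p" for \<omega> by (rule inv_into_f_f[OF inj that])
  have Z: "?Z = desc ` {\<omega> \<in> invforms p. ed \<omega> = 0}"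
    using desc_inj[of "ed _" 0] by (auto simp: closed_forms_def mf mderiv_desc desc_zero)
  have E: "?E = desc ` {\<omega>. \<exists>q. p = Suc q \<and> \<omega> \<in> ed ` invforms q \<or> p = 0 \<and> \<omega> = 0}"
    by (cases p) (auto simp: exact_forms_def mf mderiv_desc desc_zero image_image image_iff)
  have harm: "?h \<omega> \<in> constforms p" if "\<omega> \<in> invforms p" for \<omega>
    by (rule harmonic_constforms[OF kill that]) simp_all
  have const: "\<omega> \<in> invforms p \<and> ed \<omega> = 0" if "\<omega> \<in> constforms p" for \<omega>
    using that ed_constforms by (auto simp: constforms_def)
  show ?thesis
    unfolding de_Rham_def class_scale_def[abs_def]
  proof (rule exI, rule linear_iso_quotient[where P = "\<lambda>W. desc (?h (?lift W))"])
    show "vector_space (mscale :: complex \<Rightarrow> ('e set, 'e) mform \<Rightarrow> _)" by (rule mform.vector_space_axioms)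
    show "?Z \<subseteq> mforms cover_atlas p" by (auto simp: closed_forms_def)
    show "?E \<subseteq> mforms cover_atlas p"
      unfolding E mf using invforms_ed invforms_zero by auto
    show "desc (?h (?lift (x + y))) = desc (?h (?lift x)) + desc (?h (?lift y))"
      if "x \<in> mforms cover_atlas p" "y \<in> mforms cover_atlas p" for x y
      using that unfolding mf
      by (auto simp: lift invforms_add harmonic_add[of _ p] simp flip: desc_add)
    show "desc (?h (?lift (mscale z x))) = mscale z (desc (?h (?lift x)))"
      if "x \<in> mforms cover_atlas p" for z x
      using that unfolding mf
      by (auto simp: lift invforms_fscale harmonic_fscale simp flip: desc_fscale)
    have add0: "ed (\<omega> + \<eta>) = 0" if "\<omega> \<in> invforms p" "\<eta> \<in> invforms p" "ed \<omega> = 0" "ed \<eta> = 0" for \<omega> \<eta>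
      using ed_add[OF invforms_forms[OF that(1)] invforms_forms[OF that(2)]] that(3,4) by (simp only: add_0)
    show "x + y \<in> ?Z" if "x \<in> ?Z" "y \<in> ?Z" for x y
      using that unfolding Z by (auto simp: invforms_add add0 simp flip: desc_add)
    have "ed (fscale z \<omega>) = 0" if "\<omega> \<in> invforms p" "ed \<omega> = 0" for z \<omega>
      using ed_fscale[OF invforms_forms[OF that(1)], of z] that(2) by (simp add: fscale_def fun_eq_iff)
    then show "mscale z x \<in> ?Z" if "x \<in> ?Z" for z x
      using that unfolding Z by (auto simp: invforms_fscale simp flip: desc_fscale)
    show "0 \<in> ?E"
    proof (cases p)
      case (Suc q)
      then show ?thesis unfolding E using invforms_zero[of q] ed_zero desc_zero by force
    qed (simp add: exact_forms_def)
    show "x + y \<in> ?E" if "x \<in> ?E" "y \<in> ?E" for x y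
    proof (cases p)
      case (Suc q)
      then obtain \<alpha> \<beta> where ab: "\<alpha> \<in> invforms q" "\<beta> \<in> invforms q" "x = desc (ed \<alpha>)" "y = desc (ed \<beta>)"
        using \<open>x \<in> ?E\<close> \<open>y \<in> ?E\<close> unfolding E by auto
      have "x + y = desc (ed (\<alpha> + \<beta>))"
        by (simp only: ab ed_add[OF invforms_forms[OF ab(1)] invforms_forms[OF ab(2)]] desc_add)
      then show ?thesis unfolding E using Suc invforms_add[OF ab(1,2)] by blast
    qed (use that in \<open>simp add: exact_forms_def\<close>)
    show "mscale z x \<in> ?E" if "x \<in> ?E" for z x
    proof (cases p)
      case (Suc q)
      then obtain \<alpha> where a: "\<alpha> \<in> invforms q" "x = desc (ed \<alpha>)" using \<open>x \<in> ?E\<close> unfolding E by auto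
      have "mscale z x = desc (ed (fscale z \<alpha>))"
        by (simp only: a ed_fscale[OF invforms_forms[OF a(1)]] desc_fscale)
      then show ?thesis unfolding E using Suc invforms_fscale[OF a(1)] by blast
    qed (use that in \<open>simp add: exact_forms_def\<close>)
    show "desc ` constforms p \<subseteq> ?Z" unfolding Z using const by blast
    show "desc (?h (?lift x)) = x" if "x \<in> desc ` constforms p" for x
      using that const harmonic_of_constforms[OF _ qs] by (auto simp: lift)
    show "desc (?h (?lift x)) \<in> desc ` constforms p" if "x \<in> ?Z" for x
      using that harm unfolding Z by (auto simp: lift)
    show "desc (?h (?lift x)) = 0" if "x \<in> ?E" for x
    proof (cases p)
      case 0
      have "?h 0 = 0" using harmonic_fscale[of qs 0 0] by (simp add: fscale_def zero_fun_def)
      then show ?thesis using that 0 lift[OF invforms_zero] by (simp add: exact_forms_def desc_zero)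
    next
      case (Suc q)
      then obtain \<alpha> where a: "\<alpha> \<in> invforms q" "x = desc (ed \<alpha>)" using \<open>x \<in> ?E\<close> unfolding E by auto
      have "?h (ed \<alpha>) = 0" by (rule harmonic_ed[OF a(1)], rule kill) (use Suc in simp_all)
      moreover have "ed \<alpha> \<in> invforms p" using invforms_ed[OF a(1)] Suc by simp
      ultimately show ?thesis using a(2) by (simp add: lift desc_zero)
    qed
    show "x - desc (?h (?lift x)) \<in> ?E" if xZ: "x \<in> ?Z" for x
    proof -
      obtain \<omega> where \<omega>: "\<omega> \<in> invforms p" "ed \<omega> = 0" "x = desc \<omega>" using xZ unfolding Z by blast
      have k: "\<And>f vs. alternating p f \<Longrightarrow> kill_eigen qs (R 1) f (map (R 1) vs) = kill_eigen qs (R 1) f vs"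
        using kill[OF order_refl] by blast
      have x: "x - desc (?h (?lift x)) = desc (\<omega> - ?h \<omega>)" by (simp only: \<omega>(3) lift[OF \<omega>(1)] desc_diff)
      show ?thesis
      proof (cases p)
        case 0
        then have "\<omega> = ?h \<omega>" using exact_minus_harmonic(1)[OF k \<omega>(1,2) qs] by blast
        then have "\<omega> - ?h \<omega> = 0" by (simp only: right_minus_eq)
        then show ?thesis unfolding x E using 0 by blast
      next
        case (Suc q)
        then obtain \<eta> where "\<eta> \<in> invforms q" "ed \<eta> = \<omega> - ?h \<omega>"
          using exact_minus_harmonic(2)[OF k \<omega>(1,2) qs] by blast
        then have "\<omega> - ?h \<omega> \<in> ed ` invforms q" by (metis image_eqI)
        then show ?thesis unfolding x E by (intro imageI CollectI exI[of _ q] disjI1 conjI Suc)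
      qed
    qed
  qed
qed

end

section \<open>Constant coefficient forms in a complex coframe\<close>

text \<open>Tensor monomials: unlike wedge products, they let a multilinear map be expanded slot by
  slot.\<close>

fun tens :: "('i \<Rightarrow> 'e \<Rightarrow> complex) \<Rightarrow> 'i list \<Rightarrow> 'e list \<Rightarrow> complex" where
  "tens \<theta> [] [] = 1"
| "tens \<theta> (i # is) (v # vs) = \<theta> i v * tens \<theta> is vs"
| "tens \<theta> _ _ = 0"

lemma tens_eq_prod: "length is = length vs \<Longrightarrow> tens \<theta> is vs = (\<Prod>j<length vs. \<theta> (is ! j) (vs ! j))"
  by (induction "is" vs rule: list_induct2) (simp_all add: prod.lessThan_Suc_shift del: prod.lessThan_Suc)

lemma tens_length: "length is \<noteq> length vs \<Longrightarrow> tens \<theta> is vs = 0"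
  by (induction \<theta> "is" vs rule: tens.induct) auto

lemma tens_eigen:
  assumes "\<And>i v. \<theta> i (D v) = E i * \<theta> i v"
  shows "tens \<theta> is (map D vs) = prod_list (map E is) * tens \<theta> is vs"
proof (induction "is" arbitrary: vs)
  case Nil
  then show ?case by (cases vs) simp_all
next
  case (Cons i "is")
  then show ?case by (cases vs) (simp_all add: assms)
qed

lemma finite_lists_of_length: "finite {is :: 'i::finite list. length is = p}"
  using finite_lists_length_eq[of "UNIV :: 'i set" p] by simp

lemma sum_lists_Suc:
  fixes F :: "'i::finite list \<Rightarrow> complex"
  shows "(\<Sum>js | length js = Suc p. F js) = (\<Sum>i\<in>UNIV. \<Sum>is | length is = p. F (i # is))"
proof -
  have "(\<Sum>js | length js = Suc p. F js) = (\<Sum>(i, is)\<in>UNIV \<times> {is. length is = p}. F (i # is))"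
    by (rule sum.reindex_bij_witness[of _ "\<lambda>(i, is). i # is" "\<lambda>js. (hd js, tl js)"])
      (auto simp: length_Suc_conv)
  then show ?thesis by (simp add: sum.cartesian_product)
qed

text \<open>\<open>dual\<close> says that the complex covectors \<open>\<theta>\<close> generate all
  real coordinates. The head vector is expanded in \<open>Basis\<close>, the remaining slots by
  induction.\<close>

lemma multilinear_expansion:
  fixes \<theta> :: "'i::finite \<Rightarrow> 'e::euclidean_space \<Rightarrow> complex"
  assumes dual: "\<And>b. b \<in> Basis \<Longrightarrow> \<exists>a. \<forall>v. of_real (v \<bullet> b) = (\<Sum>i\<in>UNIV. a i * \<theta> i v)"
    and f: "\<And>us vs. length us + 1 + length vs = p \<Longrightarrow> linear (\<lambda>v. f (us @ v # vs))"
  shows "\<exists>c. \<forall>vs. length vs = p \<longrightarrow> f vs = (\<Sum>is | length is = p. c is * tens \<theta> is vs)"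
  using f
proof (induction p arbitrary: f)
  case 0
  show ?case by (intro exI[of _ "\<lambda>_. f []"]) auto
next
  case (Suc p)
  have "\<exists>c. \<forall>vs. length vs = p \<longrightarrow> f (b # vs) = (\<Sum>is | length is = p. c is * tens \<theta> is vs)" for b
    by (rule Suc.IH) (use Suc.prems[of "b # _"] in simp)
  then obtain c where c: "\<And>b vs. length vs = p \<Longrightarrow> f (b # vs) = (\<Sum>is | length is = p. c b is * tens \<theta> is vs)"
    by metis
  from dual obtain a where a: "\<And>b v. b \<in> Basis \<Longrightarrow> of_real (v \<bullet> b) = (\<Sum>i\<in>UNIV. a b i * \<theta> i v)"
    by metis
  show ?case
  proof (intro exI allI impI)
    fix vs :: "'e list"
    assume "length vs = Suc p"
    then obtain v us where vs: "vs = v # us" "length us = p" by (cases vs) auto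
    have l: "linear (\<lambda>v. f (v # us))" using Suc.prems[of "[]" us] vs(2) by simp
    have "f vs = f ((\<Sum>b\<in>Basis. (v \<bullet> b) *\<^sub>R b) # us)" by (simp only: vs(1) euclidean_representation)
    also have "\<dots> = (\<Sum>b\<in>Basis. of_real (v \<bullet> b) * f (b # us))"
      by (simp add: linear_sum[OF l] linear_scale[OF l] scaleR_conv_of_real)
    also have "\<dots> = (\<Sum>b\<in>Basis. \<Sum>i\<in>UNIV. \<Sum>is | length is = p. a b i * c b is * tens \<theta> (i # is) vs)"
      by (intro sum.cong refl) (simp add: a c vs sum_product mult_ac)
    also have "\<dots> = (\<Sum>i\<in>UNIV. \<Sum>is | length is = p. \<Sum>b\<in>Basis. a b i * c b is * tens \<theta> (i # is) vs)"
      by (subst sum.swap) (intro sum.cong refl, rule sum.swap)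
    also have "\<dots> = (\<Sum>js | length js = Suc p. (\<Sum>b\<in>Basis. a b (hd js) * c b (tl js)) * tens \<theta> js vs)"
      by (simp add: sum_lists_Suc sum_distrib_right)
    finally show "f vs = \<dots>" .
  qed
qed

text \<open>Tensor monomials are eigenvectors of the pullback by \<open>D\<close>, so each factor of
  the filter only rescales coefficients.\<close>

lemma kill_eigen_expansion:
  fixes \<theta> :: "'i::finite \<Rightarrow> 'e \<Rightarrow> complex"
  assumes "\<And>i v. \<theta> i (D v) = E i * \<theta> i v"
    and "\<And>vs. f vs = (\<Sum>is | length is = p. c is * tens \<theta> is vs)"
  shows "kill_eigen qs D f vs =
    (\<Sum>is | length is = p. (\<Prod>q\<leftarrow>qs. (prod_list (map E is) - q) / (1 - q)) * c is * tens \<theta> is vs)"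
  using assms(2)
proof (induction qs arbitrary: f c)
  case (Cons q qs)
  let ?c = "\<lambda>is. (prod_list (map E is) - q) / (1 - q) * c is"
  have "(f (map D vs) - q * f vs) / (1 - q) = (\<Sum>is | length is = p. ?c is * tens \<theta> is vs)" for vs
    by (simp add: Cons.prems tens_eigen[of \<theta> D E, OF assms(1)] sum_distrib_left sum_divide_distrib algebra_simps
        diff_divide_distrib flip: sum_subtractf)
  from Cons.IH[of _ ?c, OF this] show ?case by (simp add: mult_ac)
qed simp

lemma kill_eigen_fixed:
  assumes "\<And>vs. f (map D vs) = f vs" "1 \<notin> set qs"
  shows "kill_eigen qs D f = f"
  using assms(2)
proof (induction qs)
  case (Cons q qs)
  then have "(\<lambda>vs. (f (map D vs) - q * f vs) / (1 - q)) = f"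
    by (intro ext) (simp add: assms(1) field_simps)
  then show ?case using Cons by simp
qed simp

text \<open>The rescaling is a product of ones at the eigenvalue 1 and contains a factor 0 at every
  eigenvalue listed in \<open>qs\<close>.\<close>

lemma kill_eigen_eq_fixed_part:
  fixes \<theta> :: "'i::finite \<Rightarrow> 'e \<Rightarrow> complex"
  assumes "\<And>i v. \<theta> i (D v) = E i * \<theta> i v" "\<And>vs. f vs = (\<Sum>is | length is = p. c is * tens \<theta> is vs)"
    and "1 \<notin> set qs" "\<And>is. length is = p \<Longrightarrow> prod_list (map E is) = 1 \<or> prod_list (map E is) \<in> set qs"
  shows "kill_eigen qs D f vs = (\<Sum>is | length is = p \<and> prod_list (map E is) = 1. c is * tens \<theta> is vs)"
proof -
  have one: "(\<Prod>q\<leftarrow>qs. (1 - q) / (1 - q)) = 1" using assms(3) by (induction qs) auto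
  have zero: "x \<in> set qs \<Longrightarrow> (\<Prod>q\<leftarrow>qs. (x - q) / (1 - q)) = 0" for x by (induction qs) auto
  have "kill_eigen qs D f vs =
    (\<Sum>is | length is = p. (\<Prod>q\<leftarrow>qs. (prod_list (map E is) - q) / (1 - q)) * c is * tens \<theta> is vs)"
    by (rule kill_eigen_expansion[OF assms(1,2)])
  also have "\<dots> = (\<Sum>is | length is = p. if prod_list (map E is) = 1 then c is * tens \<theta> is vs else 0)"
  proof (intro sum.cong refl)
    fix "is" assume "is \<in> {is :: 'i list. length is = p}"
    then show "(\<Prod>q\<leftarrow>qs. (prod_list (map E is) - q) / (1 - q)) * c is * tens \<theta> is vs =
        (if prod_list (map E is) = 1 then c is * tens \<theta> is vs else 0)"
      using assms(4)[of "is"] one zero by (cases "prod_list (map E is) = 1") auto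
  qed
  also have "\<dots> = (\<Sum>is | length is = p \<and> prod_list (map E is) = 1. c is * tens \<theta> is vs)"
    by (rule sum.mono_neutral_cong_right) (auto simp: finite_lists_of_length)
  finally show ?thesis .
qed

section \<open>Permutations of the slots and antisymmetrization\<close>

lemma alternating_update_swap:
  assumes f: "alternating p f" and ab: "a < length vs" "b < length vs" "a \<noteq> b"
  shows "f (vs[a := x, b := y]) = - f (vs[a := y, b := x])"
proof (cases "length vs = p")
  case True
  have lin: "linear (\<lambda>x. f (us[a := x]))" if "a < length us" "length us = p" for us a
    using alternating_linear[OF f, of "take a us" "drop (Suc a) us"] that by (simp add: upd_conv_take_nth_drop)
  have l1: "linear (\<lambda>x. f (vs[a := x, b := y]))" for y
    using lin[of a "vs[b := y]"] ab True by (simp add: list_update_swap)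
  have l2: "linear (\<lambda>y. f (vs[a := x, b := y]))" for x
    using lin[of b "vs[a := x]"] ab True by simp
  have z: "f (vs[a := x, b := x]) = 0" for x
  proof (rule alternating_not_distinct[OF f])
    have "vs[a := x, b := x] ! a = vs[a := x, b := x] ! b" using ab by simp
    then show "\<not> distinct (vs[a := x, b := x])" using ab by (metis distinct_conv_nth length_list_update)
  qed
  have "f (vs[a := x + y, b := x + y]) = f (vs[a := x, b := y]) + f (vs[a := y, b := x])"
    unfolding linear_add[OF l1] linear_add[OF l2] by (simp add: z)
  from trans[OF this[symmetric] z] show ?thesis by (rule eq_neg_iff_add_eq_0[THEN iffD2])
qed (use alternating_length[OF f] in auto)

lemma sign_transpose_compose:
  assumes "\<pi> permutes {..<n::nat}" "a \<noteq> b"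
  shows "sign (Transposition.transpose a b \<circ> \<pi>) = - sign \<pi>"
proof -
  have "permutation \<pi>" using assms(1) permutation_permutes by blast
  then show ?thesis using assms(2) by (simp add: sign_compose permutation_swap_id sign_swap_id)
qed

lemma alternating_permute:
  assumes f: "alternating p f" and "\<pi> permutes {..<p}"
  shows "length vs = p \<Longrightarrow> f (permute_list \<pi> vs) = of_int (sign \<pi>) * f vs"
  using assms(2) finite_lessThan[of p]
proof (induction \<pi> arbitrary: vs rule: permutes_induct)
  case id
  then show ?case by simp
next
  case (swap a b \<pi>)
  let ?us = "permute_list (Transposition.transpose a b) vs"
  have t: "Transposition.transpose a b permutes {..<p}" using swap by (intro permutes_swap_id) auto
  have "permute_list (Transposition.transpose a b \<circ> \<pi>) vs = permute_list \<pi> ?us"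
    using swap by (intro permute_list_compose) auto
  moreover have "f ?us = - f vs"
  proof -
    have "?us = vs[a := vs ! b, b := vs ! a]"
      by (rule nth_equalityI) (use swap in \<open>auto simp: permute_list_def nth_list_update Transposition.transpose_def\<close>)
    then show ?thesis using alternating_update_swap[OF f, of a vs b "vs ! b" "vs ! a"] swap by simp
  qed
  moreover have "f (permute_list \<pi> ?us) = of_int (sign \<pi>) * f ?us"
    using swap by (intro swap.IH) auto
  moreover have "sign (Transposition.transpose a b \<circ> \<pi>) = - sign \<pi>"
    by (rule sign_transpose_compose) (use swap in auto)
  ultimately show ?case by (simp only: of_int_minus mult_minus_left mult_minus_right)
qed

definition wedge_const :: "('i \<Rightarrow> 'e \<Rightarrow> complex) \<Rightarrow> 'i list \<Rightarrow> 'e list \<Rightarrow> complex" where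
  "wedge_const \<theta> is vs = (if length vs = length is
     then \<Sum>\<pi> | \<pi> permutes {..<length is}. of_int (sign \<pi>) * (\<Prod>i<length is. \<theta> (is ! i) (vs ! \<pi> i))
     else 0)"

lemma wedge_const_eq_tens:
  assumes "length vs = length is"
  shows "wedge_const \<theta> is vs =
    (\<Sum>\<pi> | \<pi> permutes {..<length is}. of_int (sign \<pi>) * tens \<theta> is (permute_list \<pi> vs))"
  unfolding wedge_const_def using assms
  by (auto simp: tens_eq_prod permute_list_nth intro!: sum.cong prod.cong)

text \<open>Substituting the composite with the transposition flips the sign and keeps
  \<open>F\<close>, so the sum is its own negative.\<close>

lemma sum_permutes_antisym:
  fixes F :: "(nat \<Rightarrow> nat) \<Rightarrow> complex"
  assumes "a < n" "b < n" "a \<noteq> b" "\<And>\<pi>. \<pi> permutes {..<n} \<Longrightarrow> F (Transposition.transpose a b \<circ> \<pi>) = F \<pi>"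
  shows "(\<Sum>\<pi> | \<pi> permutes {..<n}. of_int (sign \<pi>) * F \<pi>) = 0"
proof -
  have t: "Transposition.transpose a b permutes {..<n}" using assms by (intro permutes_swap_id) auto
  have "(\<Sum>\<pi> | \<pi> permutes {..<n}. of_int (sign \<pi>) * F \<pi>) =
    (\<Sum>\<pi> | \<pi> permutes {..<n}. of_int (sign (Transposition.transpose a b \<circ> \<pi>)) * F (Transposition.transpose a b \<circ> \<pi>))"
    by (rule setum_permutations_compose_left[OF t])
  also have "\<dots> = (\<Sum>\<pi> | \<pi> permutes {..<n}. - (of_int (sign \<pi>) * F \<pi>))"
  proof (intro sum.cong refl)
    fix \<pi> assume "\<pi> \<in> {\<pi>. \<pi> permutes {..<n}}"
    moreover from this have "sign (Transposition.transpose a b \<circ> \<pi>) = - sign \<pi>"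
      by (intro sign_transpose_compose[OF _ assms(3)]) simp
    ultimately show "of_int (sign (Transposition.transpose a b \<circ> \<pi>)) * F (Transposition.transpose a b \<circ> \<pi>) = - (of_int (sign \<pi>) * F \<pi>)"
      using assms(4) by simp
  qed
  finally show ?thesis by (simp add: sum_negf)
qed

lemma alternating_wedge_const:
  assumes lin: "\<And>i. linear (\<theta> i)"
  shows "alternating (length is) (wedge_const \<theta> is)"
  unfolding alternating_def
proof (intro conjI allI impI)
  let ?n = "length is"
  fix us ws :: "'b list"
  assume n: "length us + 1 + length ws = ?n"
  have "linear (\<lambda>v. \<Prod>i<?n. \<theta> (is ! i) ((us @ v # ws) ! \<pi> i))" if \<pi>: "\<pi> permutes {..<?n}" for \<pi>
  proof -
    \<comment> \<open>The only factor of the product into which the vector at position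
      \<open>length us\<close> enters.\<close>
    define i0 where "i0 = inv \<pi> (length us)"
    have i0: "i0 < ?n" "\<pi> i0 = length us"
      using permutes_in_image[OF permutes_inv[OF \<pi>], of "length us"] n permutes_inverses(1)[OF \<pi>]
      by (auto simp: i0_def)
    have other: "(us @ v # ws) ! \<pi> i = (us @ 0 # ws) ! \<pi> i" if "i \<noteq> i0" for i v
    proof -
      have "\<pi> i \<noteq> length us" using that by (simp add: i0(2)[symmetric] inj_eq[OF permutes_inj[OF \<pi>]])
      then show ?thesis by (auto simp: nth_append nth_Cons split: nat.split)
    qed
    have "(\<Prod>i<?n. \<theta> (is ! i) ((us @ v # ws) ! \<pi> i)) =
        \<theta> (is ! i0) v * (\<Prod>i\<in>{..<?n} - {i0}. \<theta> (is ! i) ((us @ 0 # ws) ! \<pi> i))" for v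
    proof -
      have "(\<Prod>i\<in>{..<?n} - {i0}. \<theta> (is ! i) ((us @ v # ws) ! \<pi> i)) =
          (\<Prod>i\<in>{..<?n} - {i0}. \<theta> (is ! i) ((us @ 0 # ws) ! \<pi> i))"
        by (intro prod.cong refl arg_cong[where f = "\<theta> (_ ! _)"] other) auto
      moreover have "(us @ v # ws) ! \<pi> i0 = v" by (simp add: i0)
      ultimately show ?thesis using i0(1) by (subst prod.remove[of _ i0]) auto
    qed
    then show ?thesis by (simp add: linear_iff linear_add[OF lin] linear_scale[OF lin] algebra_simps)
  qed
  then have "linear (\<lambda>v. \<Sum>\<pi> | \<pi> permutes {..<?n}. of_int (sign \<pi>) * (\<Prod>i<?n. \<theta> (is ! i) ((us @ v # ws) ! \<pi> i)))"
    by (intro linear_compose_sum ballI) (simp add: linear_iff algebra_simps)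
  then show "linear (\<lambda>v. wedge_const \<theta> is (us @ v # ws))" using n by (simp add: wedge_const_def)
next
  fix vs :: "'b list"
  assume "\<not> distinct vs"
  then obtain a b where ab: "a < length vs" "b < length vs" "a \<noteq> b" "vs ! a = vs ! b"
    by (auto simp: distinct_conv_nth)
  have *: "vs ! Transposition.transpose a b i = vs ! i" for i using ab(4) by (auto simp: Transposition.transpose_def)
  show "wedge_const \<theta> is vs = 0"
    unfolding wedge_const_def
    using sum_permutes_antisym[OF ab(1-3), of "\<lambda>\<pi>. \<Prod>i<length vs. \<theta> (is ! i) (vs ! \<pi> i)"] by (auto simp: *)
qed (simp add: wedge_const_def)

lemma wedge_const_permute:
  assumes "\<sigma> permutes {..<length is}"
  shows "wedge_const \<theta> (permute_list \<sigma> is) vs = of_int (sign \<sigma>) * wedge_const \<theta> is vs"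
proof (cases "length vs = length is")
  case True
  let ?n = "length is"
  have "(\<Sum>\<pi> | \<pi> permutes {..<?n}. of_int (sign \<pi>) * (\<Prod>i<?n. \<theta> (permute_list \<sigma> is ! i) (vs ! \<pi> i))) =
    (\<Sum>\<pi> | \<pi> permutes {..<?n}. of_int (sign (\<pi> \<circ> \<sigma>)) * (\<Prod>i<?n. \<theta> (permute_list \<sigma> is ! i) (vs ! (\<pi> \<circ> \<sigma>) i)))"
    by (rule sum_permutations_compose_right[OF assms])
  also have "\<dots> = (\<Sum>\<pi> | \<pi> permutes {..<?n}. of_int (sign \<sigma>) * (of_int (sign \<pi>) * (\<Prod>i<?n. \<theta> (is ! i) (vs ! \<pi> i))))"
  proof (intro sum.cong refl)
    fix \<pi> assume \<pi>: "\<pi> \<in> {\<pi>. \<pi> permutes {..<?n}}"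
    have "(\<Prod>i<?n. \<theta> (permute_list \<sigma> is ! i) (vs ! (\<pi> \<circ> \<sigma>) i)) = (\<Prod>i<?n. \<theta> (is ! \<sigma> i) (vs ! \<pi> (\<sigma> i)))"
      using assms by (intro prod.cong refl) (simp add: permute_list_nth)
    also have "\<dots> = (\<Prod>i<?n. \<theta> (is ! i) (vs ! \<pi> i))"
      using prod.permute[OF assms, of "\<lambda>i. \<theta> (is ! i) (vs ! \<pi> i)"] by (simp add: o_def)
    moreover have "sign (\<pi> \<circ> \<sigma>) = sign \<pi> * sign \<sigma>"
      using \<pi> assms by (intro sign_compose) (auto simp: permutation_permutes)
    ultimately show "of_int (sign (\<pi> \<circ> \<sigma>)) * (\<Prod>i<?n. \<theta> (permute_list \<sigma> is ! i) (vs ! (\<pi> \<circ> \<sigma>) i)) =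
        of_int (sign \<sigma>) * (of_int (sign \<pi>) * (\<Prod>i<?n. \<theta> (is ! i) (vs ! \<pi> i)))" by simp
  qed
  finally show ?thesis using True by (simp add: wedge_const_def sum_distrib_left)
qed (simp add: wedge_const_def)

lemma wedge_const_not_distinct:
  assumes "\<not> distinct is"
  shows "wedge_const \<theta> is vs = 0"
proof -
  obtain a b where ab: "a < length is" "b < length is" "a \<noteq> b" "is ! a = is ! b"
    using assms by (auto simp: distinct_conv_nth)
  have t: "Transposition.transpose a b permutes {..<length is}" using ab by (intro permutes_swap_id) auto
  have "permute_list (Transposition.transpose a b) is = is"
    by (rule nth_equalityI) (use ab t in \<open>auto simp: permute_list_nth Transposition.transpose_def\<close>)
  then have "wedge_const \<theta> is vs = - wedge_const \<theta> is vs"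
    using wedge_const_permute[OF t, of \<theta> vs] ab(3) by (simp add: sign_swap_id)
  then show ?thesis by simp
qed

lemma wedge_const_reorder:
  assumes "distinct is" "distinct js" "set is = set js"
  shows "\<exists>c. \<forall>vs. wedge_const \<theta> is vs = c * wedge_const \<theta> js vs"
proof -
  have "mset is = mset js" using assms by (simp add: set_eq_iff_mset_eq_distinct)
  then obtain \<sigma> where "\<sigma> permutes {..<length js}" "permute_list \<sigma> js = is"
    by (rule mset_eq_permutation)
  then show ?thesis using wedge_const_permute by blast
qed

text \<open>The signed sum over all permutations of the slots returns \<open>f\<close> itself
  \<open>fact p\<close> times and turns each tensor monomial into a wedge product.\<close>

lemma alternating_eq_sum_wedge_const:
  fixes \<theta> :: "'i::finite \<Rightarrow> 'e::real_vector \<Rightarrow> complex"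
  assumes f: "alternating p f" and S: "finite S" "S \<subseteq> {is. length is = p}"
    and "\<And>vs. f vs = (\<Sum>is\<in>S. c is * tens \<theta> is vs)"
  shows "f vs = (\<Sum>is\<in>S. c is / fact p * wedge_const \<theta> is vs)"
proof (cases "length vs = p")
  case True
  have "fact p * f vs = (\<Sum>\<pi> | \<pi> permutes {..<p}. f vs)"
    by (simp add: card_permutations[of "{..<p}" p])
  also have "\<dots> = (\<Sum>\<pi> | \<pi> permutes {..<p}. of_int (sign \<pi>) * f (permute_list \<pi> vs))"
    by (intro sum.cong refl) (simp add: alternating_permute[OF f _ True] sign_def)
  also have "\<dots> = (\<Sum>\<pi> | \<pi> permutes {..<p}. \<Sum>is\<in>S. c is * (of_int (sign \<pi>) * tens \<theta> is (permute_list \<pi> vs)))"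
    unfolding assms(4) by (simp add: sum_distrib_left mult.left_commute)
  also have "\<dots> = (\<Sum>is\<in>S. c is * wedge_const \<theta> is vs)"
    using S(2) True by (subst sum.swap) (auto intro!: sum.cong simp: wedge_const_eq_tens sum_distrib_left)
  finally have "f vs = (\<Sum>is\<in>S. c is * wedge_const \<theta> is vs) / fact p" by (simp add: field_simps)
  then show ?thesis by (simp add: sum_divide_distrib)
next
  case False
  then have "wedge_const \<theta> is vs = 0" if "is \<in> S" for "is"
    using S(2) that by (auto simp: wedge_const_def)
  then show ?thesis using alternating_length[OF f False] by simp
qed

section \<open>The solvmanifold as a mapping torus\<close>

definition height :: "('n::finite, 'm::finite) G \<Rightarrow> real" where
  "height g = Re (a_fun (fst g))"

definition stretch :: "real \<Rightarrow> real \<Rightarrow> ('n::finite, 'm::finite) G \<Rightarrow> ('n, 'm) G" where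
  "stretch l c v = (fst v, \<chi> k. of_real (exp (if snd k then - (l * c) else l * c)) * snd v $ k)"

text \<open>A lattice vector of height 1 fixed by every \<open>stretch\<close>;
  \<open>undefined\<close> merely names some index.\<close>

definition base_vec :: "('n::finite, 'm::finite) G" where
  "base_vec = (axis (undefined, False) 1, 0)"

text \<open>The real coordinates in which the lattice consists of the integer vectors.\<close>

definition lattice_map :: "real ^ ('n::finite \<times> bool) ^ ('n \<times> bool) \<Rightarrow> real ^ ('m::finite \<times> bool) ^ ('m \<times> bool) \<Rightarrow>
    ((real ^ ('n \<times> bool)) \<times> (real ^ ('n \<times> bool))) \<times> ((real ^ ('m \<times> bool)) \<times> (real ^ ('m \<times> bool))) \<Rightarrow> ('n, 'm) G" where
  "lattice_map \<mu> P = (\<lambda>((a, b), (c, d)). (cvec a + \<i> *s cvec (\<mu> *v b), cvec (P *v c) + \<i> *s cvec (P *v d)))"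

text \<open>The height is the coordinate sum of the first block, so differences of coordinate
  vectors span its kernel there. One of them is 0; a spanning set is all that is wanted.\<close>

definition lattice_basis :: "real ^ ('n::finite \<times> bool) ^ ('n \<times> bool) \<Rightarrow> real ^ ('m::finite \<times> bool) ^ ('m \<times> bool) \<Rightarrow>
    ('n, 'm) G set" where
  "lattice_basis \<mu> P =
     range (\<lambda>i. lattice_map \<mu> P ((axis i 1 - axis (undefined, False) 1, 0), (0, 0))) \<union>
     range (\<lambda>i. lattice_map \<mu> P ((0, axis i 1), (0, 0))) \<union>
     range (\<lambda>i. lattice_map \<mu> P ((0, 0), (axis i 1, 0))) \<union>
     range (\<lambda>i. lattice_map \<mu> P ((0, 0), (0, axis i 1)))"

lemma diag_mat_mult: "(diag_mat d *v x) $ i = d $ i * x $ i"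
proof -
  have "(diag_mat d *v x) $ i = (\<Sum>j\<in>UNIV. if i = j then d $ i * x $ j else 0)"
    unfolding matrix_vector_mult_def diag_mat_def by (simp add: if_distrib[of "\<lambda>t. t * _"] cong: if_cong)
  then show ?thesis by simp
qed

lemma cvec_add: "cvec (a + b) = cvec a + cvec b"
  and cvec_scale: "cvec (r *\<^sub>R a) = r *\<^sub>R cvec a"
  and cvec_zero [simp]: "cvec 0 = 0"
  by (simp_all add: cvec_def vec_eq_iff scaleR_conv_of_real[where 'a = complex])

lemma cvec_nth [simp]: "cvec v $ i = of_real (v $ i)"
  by (simp add: cvec_def)

lemma linear_lattice_map: "linear (lattice_map \<mu> P)"
  by (rule linearI)
    (auto simp: lattice_map_def cvec_add cvec_scale matrix_vector_right_distrib matrix_vector_mult_scaleR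
      vec_eq_iff scaleR_conv_of_real[where 'a = complex] algebra_simps)

lemma linear_height: "linear (height :: ('n::finite, 'm::finite) G \<Rightarrow> real)"
  by (rule linearI) (auto simp: height_def a_fun_def sum.distrib sum_distrib_left algebra_simps)

lemma linear_stretch: "linear (stretch l c)"
  by (rule linearI) (auto simp: stretch_def vec_eq_iff scaleR_conv_of_real[where 'a = complex] algebra_simps)

lemma stretch_add: "stretch l (a + b) x = stretch l a (stretch l b x)"
  by (auto simp: stretch_def vec_eq_iff exp_add[symmetric] algebra_simps simp flip: of_real_mult)

lemma stretch_0: "stretch l 0 x = x"
  by (simp add: stretch_def prod_eq_iff vec_eq_iff)

lemma height_stretch: "height (stretch l c x) = height x"
  by (simp add: height_def stretch_def)

lemma stretch_base_vec: "stretch l c base_vec = base_vec"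
  by (simp add: stretch_def base_vec_def vec_eq_iff)

lemma height_base_vec: "height (base_vec :: ('n::finite, 'm::finite) G) = 1"
proof -
  have "height (base_vec :: ('n, 'm) G) = (\<Sum>i\<in>(UNIV :: 'n set). if i = undefined then 1 else 0)"
    unfolding height_def base_vec_def a_fun_def Re_sum by (intro sum.cong refl) (simp add: axis_def)
  then show ?thesis by simp
qed

text \<open>The conjugations in a(w) do not affect real parts.\<close>

lemma height_eq_sum: "height g = (\<Sum>i\<in>UNIV. Re (fst g $ i))"
proof -
  have "(\<Sum>i\<in>UNIV. Re (fst g $ i)) = (\<Sum>i\<in>UNIV. \<Sum>b\<in>UNIV. Re (fst g $ (i, b)))"
    unfolding UNIV_Times_UNIV[symmetric] by (simp only: sum.cartesian_product split_def prod.collapse)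
  also have "\<dots> = height g" by (simp add: height_def a_fun_def UNIV_bool add.commute)
  finally show ?thesis ..
qed

lemma height_lattice_map: "height (lattice_map \<mu> P ((a, b), (c, d))) = (\<Sum>i\<in>UNIV. a $ i)"
  by (simp add: height_eq_sum lattice_map_def)

lemma int_vecs_add: "a \<in> int_vecs \<Longrightarrow> b \<in> int_vecs \<Longrightarrow> a + b \<in> int_vecs"
  and int_vecs_uminus: "a \<in> int_vecs \<Longrightarrow> - a \<in> int_vecs"
  and int_vecs_zero [simp]: "0 \<in> int_vecs"
  and int_vecs_axis [simp]: "axis i 1 \<in> int_vecs"
  by (auto simp: int_vecs_def axis_def)

lemma int_vecs_diff: "a \<in> int_vecs \<Longrightarrow> b \<in> int_vecs \<Longrightarrow> a - b \<in> int_vecs"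
  by (auto simp: int_vecs_def)

lemma Gamma_eq: "Gamma \<mu> P = lattice_map \<mu> P ` ((int_vecs \<times> int_vecs) \<times> (int_vecs \<times> int_vecs))"
proof -
  have "Gamma \<mu> P = {(cvec a + \<i> *s cvec (\<mu> *v b), cvec (P *v c) + \<i> *s cvec (P *v d)) | a b c d.
      a \<in> int_vecs \<and> b \<in> int_vecs \<and> c \<in> int_vecs \<and> d \<in> int_vecs}"
    unfolding Gamma_def Gamma1_def Gamma2_def by blast
  then show ?thesis unfolding lattice_map_def by (auto simp: image_iff) blast+
qed

lemma int_vecs_matrix_mult: "a \<in> int_vecs \<Longrightarrow> map_matrix real_of_int M *v a \<in> int_vecs"
  by (auto simp: int_vecs_def matrix_vector_mult_def map_matrix_def intro!: Ints_sum Ints_mult)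

lemma det_map_matrix_of_int: "det (map_matrix real_of_int M) = of_int (det M)"
  by (simp add: det_def map_matrix_def)

text \<open>Cramer's rule: for determinant 1 the coordinates of the solution are determinants of
  integer matrices.\<close>

lemma int_vecs_preimage:
  assumes "det M = 1" "a \<in> int_vecs"
  shows "\<exists>a'\<in>int_vecs. map_matrix real_of_int M *v a' = a"
proof -
  let ?M = "map_matrix real_of_int M"
  have d: "det ?M = 1" using assms(1) by (simp add: det_map_matrix_of_int)
  define a' where "a' = (\<chi> k. det (\<chi> i j. if j = k then a $ i else ?M $ i $ j) / det ?M)"
  have "?M *v a' = a" using cramer[of ?M a' a] d by (simp add: a'_def)
  moreover have "det (\<chi> i j. if j = k then a $ i else ?M $ i $ j) \<in> \<int>" for k
    unfolding det_def using assms(2)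
    by (intro Ints_sum Ints_mult Ints_prod) (auto simp: int_vecs_def map_matrix_def)
  then have "a' \<in> int_vecs" by (simp add: int_vecs_def a'_def d)
  ultimately show ?thesis by blast
qed

locale solvmanifold =
  fixes M :: "int ^ ('m::{finite,linorder} \<times> bool) ^ ('m \<times> bool)"
    and P :: "real ^ ('m \<times> bool) ^ ('m \<times> bool)"
    and l :: real
    and k :: "'n::{finite,linorder} \<times> bool \<Rightarrow> int"
    and \<mu> :: "real ^ ('n \<times> bool) ^ ('n \<times> bool)"
    and \<Gamma> :: "('n, 'm) G set"
  assumes det_M: "det M = 1"
    and invertible_P: "invertible P"
    and l_nonzero: "l \<noteq> 0"
    and conjugate: "P ** map_matrix real_of_int M ** matrix_inv P =
           diag_mat (\<chi> i. if snd i then exp (- l) else exp l)"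
    and k_nonzero: "\<forall>i. k i \<noteq> 0"
    and \<mu>_eq: "\<mu> = diag_mat (\<chi> i. 2 * real_of_int (k i) * pi / l)"
    and \<Gamma>_eq: "\<Gamma> = Gamma \<mu> P"
begin

lemma \<mu>_mult: "(\<mu> *v b) $ i = 2 * real_of_int (k i) * pi / l * b $ i"
  by (simp add: \<mu>_eq diag_mat_mult)

lemma inv_P: "P ** matrix_inv P = mat 1" "matrix_inv P ** P = mat 1"
proof -
  have "\<exists>A'. P ** A' = mat 1 \<and> A' ** P = mat 1" using invertible_P by (simp add: invertible_def)
  from someI_ex[OF this] show "P ** matrix_inv P = mat 1" "matrix_inv P ** P = mat 1"
    by (simp_all add: matrix_inv_def)
qed

lemma P_inj: "P *v a = 0 \<Longrightarrow> a = 0"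
proof -
  assume "P *v a = 0"
  then have "matrix_inv P *v (P *v a) = 0" by simp
  then show "a = 0" by (simp add: matrix_vector_mul_assoc inv_P)
qed

lemma lattice_map_inj: "inj (lattice_map \<mu> P)"
proof (rule linear_injective_0[OF linear_lattice_map, THEN iffD2], intro allI impI)
  fix x assume 0: "lattice_map \<mu> P x = 0"
  obtain a b c d where x: "x = ((a, b), (c, d))" by (metis prod.exhaust)
  have w: "of_real (a $ i) + \<i> * of_real ((\<mu> *v b) $ i) = 0"
    and z: "of_real ((P *v c) $ j) + \<i> * of_real ((P *v d) $ j) = 0" for i j
    using arg_cong[OF 0, of "\<lambda>v. fst v $ i"] arg_cong[OF 0, of "\<lambda>v. snd v $ j"]
    by (simp_all add: x lattice_map_def)
  have "a = 0" "\<mu> *v b = 0" "P *v c = 0" "P *v d = 0"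
    using w z by (auto simp: vec_eq_iff complex_eq_iff)
  moreover from this(2) have "b = 0"
    using k_nonzero l_nonzero by (simp add: vec_eq_iff \<mu>_mult)
  ultimately show "x = 0" using P_inj by (simp add: x zero_prod_def)
qed

text \<open>The choice of \<open>\<mu>\<close> enters here: on the lattice \<open>l\<close> times
  the imaginary part of a(w) is an integer multiple of 2 pi, so only the real part is felt by the
  exponential.\<close>

lemma exp_a_fun:
  assumes "\<gamma> \<in> \<Gamma>"
  shows "exp (of_real l * a_fun (fst \<gamma>)) = of_real (exp (l * height \<gamma>))"
    and "exp (of_real l * cnj (a_fun (fst \<gamma>))) = of_real (exp (l * height \<gamma>))"
    and "height \<gamma> \<in> \<int>"
proof -
  obtain a b c d where \<gamma>: "\<gamma> = lattice_map \<mu> P ((a, b), (c, d))" "a \<in> int_vecs" "b \<in> int_vecs"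
    using assms by (auto simp: \<Gamma>_eq Gamma_eq)
  show "height \<gamma> \<in> \<int>" using \<gamma>(2) by (auto simp: \<gamma>(1) height_lattice_map int_vecs_def intro!: Ints_sum)
  let ?N = "\<Sum>i\<in>UNIV. real_of_int (k (i, False)) * b $ (i, False) - real_of_int (k (i, True)) * b $ (i, True)"
  have "l * Im (a_fun (fst \<gamma>)) = (\<Sum>i\<in>UNIV. l * ((\<mu> *v b) $ (i, False) - (\<mu> *v b) $ (i, True)))"
    by (simp add: \<gamma>(1) lattice_map_def a_fun_def sum_distrib_left)
  also have "\<dots> = 2 * pi * ?N"
    unfolding sum_distrib_left using l_nonzero by (intro sum.cong refl) (simp add: \<mu>_mult field_simps)
  finally have im: "l * Im (a_fun (fst \<gamma>)) = 2 * pi * ?N" .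
  have "?N \<in> \<int>" using \<gamma>(3) by (auto simp: int_vecs_def intro!: Ints_sum Ints_diff Ints_mult)
  then have 1: "cis (l * Im (a_fun (fst \<gamma>))) = 1" using im by (simp add: cis_multiple_2pi)
  show *: "exp (of_real l * a_fun (fst \<gamma>)) = of_real (exp (l * height \<gamma>))"
    using 1 by (simp add: exp_eq_polar height_def)
  have "exp (of_real l * cnj (a_fun (fst \<gamma>))) = cnj (exp (of_real l * a_fun (fst \<gamma>)))"
    by (simp add: exp_cnj)
  then show "exp (of_real l * cnj (a_fun (fst \<gamma>))) = of_real (exp (l * height \<gamma>))" using * by simp
qed

lemma gmult_eq:
  assumes "\<gamma> \<in> \<Gamma>"
  shows "gmult l \<gamma> x = stretch l (height \<gamma>) x + \<gamma>"
proof -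
  have m: "exp (- (of_real l * cnj (a_fun (fst \<gamma>)))) = of_real (exp (- (l * height \<gamma>)))"
    using exp_a_fun(2)[OF assms] by (simp add: exp_minus)
  have "(rho l (fst \<gamma>) *v snd x) $ j = snd (stretch l (height \<gamma>) x) $ j" for j
    unfolding rho_def diag_mat_mult by (simp add: stretch_def exp_a_fun(1)[OF assms] m)
  then show ?thesis by (simp add: gmult_def prod_eq_iff vec_eq_iff) (simp add: stretch_def add.commute)
qed

text \<open>Conjugation by \<open>P\<close> turns the diagonal matrix of the stretch into
  \<open>M\<close>, so in lattice coordinates the monodromy is an integer matrix.\<close>

lemma stretch_1_lattice_map:
  "stretch l 1 (lattice_map \<mu> P ((a, b), (c, d))) =
    lattice_map \<mu> P ((a, b), (map_matrix real_of_int M *v c, map_matrix real_of_int M *v d))"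
proof -
  let ?D = "diag_mat (\<chi> i. if snd i then exp (- l) else exp l)"
  have "?D ** P = P ** map_matrix real_of_int M"
    unfolding conjugate[symmetric] by (simp add: matrix_mul_assoc[symmetric] inv_P)
  then have "P *v (map_matrix real_of_int M *v c) = ?D *v (P *v c)" for c
    by (simp add: matrix_vector_mul_assoc)
  then show ?thesis
    by (auto simp: lattice_map_def stretch_def vec_eq_iff diag_mat_mult algebra_simps)
qed

lemma stretch_in:
  assumes "\<gamma> \<in> \<Gamma>" "c \<in> \<int>"
  shows "stretch l c \<gamma> \<in> \<Gamma>"
proof -
  have 1: "stretch l 1 \<gamma> \<in> \<Gamma>" if "\<gamma> \<in> \<Gamma>" for \<gamma>
    using that by (auto simp: \<Gamma>_eq Gamma_eq stretch_1_lattice_map intro!: imageI int_vecs_matrix_mult)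
  \<comment> \<open>The inverse monodromy is integral as well, since \<open>M\<close> has
    determinant 1; the two steps then reach every integer \<open>c\<close>.\<close>
  have m1: "stretch l (-1) \<gamma> \<in> \<Gamma>" if \<gamma>_in: "\<gamma> \<in> \<Gamma>" for \<gamma>
  proof -
    obtain a b c d where \<gamma>: "\<gamma> = lattice_map \<mu> P ((a, b), (c, d))"
      "a \<in> int_vecs" "b \<in> int_vecs" "c \<in> int_vecs" "d \<in> int_vecs"
      using \<gamma>_in by (auto simp: \<Gamma>_eq Gamma_eq)
    obtain c' d' where cd: "c' \<in> int_vecs" "d' \<in> int_vecs"
      "map_matrix real_of_int M *v c' = c" "map_matrix real_of_int M *v d' = d"
      using int_vecs_preimage[OF det_M] \<gamma>(4,5) by metis
    have "\<gamma> = stretch l 1 (lattice_map \<mu> P ((a, b), (c', d')))"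
      by (simp add: stretch_1_lattice_map cd \<gamma>(1))
    then have "stretch l (-1) \<gamma> = lattice_map \<mu> P ((a, b), (c', d'))"
      by (simp add: stretch_add[symmetric] stretch_0)
    then show ?thesis using \<gamma> cd by (auto simp: \<Gamma>_eq Gamma_eq)
  qed
  obtain j where c: "c = of_int j" using assms(2) Ints_cases by blast
  show ?thesis unfolding c
  proof (induction j rule: int_induct[of _ 0])
    case base
    then show ?case using assms(1) by (simp add: stretch_0)
  next
    case (step1 i)
    then show ?case using 1[OF step1(2)] by (simp add: stretch_add[symmetric] add.commute)
  next
    case (step2 i)
    then show ?case using m1[OF step2(2)] by (simp add: stretch_add[symmetric] add.commute)
  qed
qed

lemma finite_lattice_basis: "finite (lattice_basis \<mu> P)"
  by (simp add: lattice_basis_def)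

lemma span_lattice_basis:
  assumes "height x = 0"
  shows "x \<in> span (lattice_basis \<mu> P)"
proof -
  let ?T = "lattice_map \<mu> P"
  note lin = linear_add[OF linear_lattice_map] linear_sum[OF linear_lattice_map]
    linear_scale[OF linear_lattice_map]
  \<comment> \<open>The lattice coordinates of \<open>x\<close>, obtained by inverting
    \<open>\<mu>\<close> and \<open>P\<close>.\<close>
  define a b c d where "a = (\<chi> i. Re (fst x $ i))" and "b = (\<chi> i. l / (2 * real_of_int (k i) * pi) * Im (fst x $ i))"
    and "c = matrix_inv P *v (\<chi> j. Re (snd x $ j))" and "d = matrix_inv P *v (\<chi> j. Im (snd x $ j))"
  have "\<mu> *v b = (\<chi> i. Im (fst x $ i))"
    using k_nonzero l_nonzero by (simp add: vec_eq_iff \<mu>_mult b_def)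
  moreover have "P *v c = (\<chi> j. Re (snd x $ j))" "P *v d = (\<chi> j. Im (snd x $ j))"
    by (simp_all add: c_def d_def matrix_vector_mul_assoc inv_P)
  ultimately have "?T ((a, b), (c, d)) = x"
    by (simp add: lattice_map_def prod_eq_iff vec_eq_iff a_def complex_eq_iff)
  moreover have "((a, b), (c, d)) =
      (\<Sum>i\<in>UNIV. a $ i *\<^sub>R ((axis i 1 - axis (undefined, False) 1, 0), (0, 0))) +
      (\<Sum>i\<in>UNIV. b $ i *\<^sub>R ((0, axis i 1), (0, 0))) +
      (\<Sum>i\<in>UNIV. c $ i *\<^sub>R ((0, 0), (axis i 1, 0))) +
      (\<Sum>i\<in>UNIV. d $ i *\<^sub>R ((0, 0), (0, axis i 1)))"
  proof -
    have ax: "(\<Sum>i\<in>UNIV. v $ i *\<^sub>R axis i 1) = v" for v :: "real ^ ('z::finite \<times> bool)"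
      using basis_expansion[of v] by (simp add: scalar_mult_eq_scaleR)
    \<comment> \<open>Height 0 makes the subtracted multiples of the distinguished axis vector
      cancel.\<close>
    have "(\<Sum>i\<in>UNIV. a $ i) = 0" using assms by (simp add: height_eq_sum a_def)
    then have "(\<Sum>i\<in>UNIV. a $ i *\<^sub>R (axis i 1 - axis (undefined, False) 1)) = a"
      by (simp add: scaleR_diff_right sum_subtractf ax flip: scaleR_sum_left)
    then show ?thesis by (simp add: prod_eq_iff fst_sum snd_sum ax)
  qed
  ultimately have "x = (\<Sum>i\<in>UNIV. a $ i *\<^sub>R ?T ((axis i 1 - axis (undefined, False) 1, 0), (0, 0))) +
      (\<Sum>i\<in>UNIV. b $ i *\<^sub>R ?T ((0, axis i 1), (0, 0))) +
      (\<Sum>i\<in>UNIV. c $ i *\<^sub>R ?T ((0, 0), (axis i 1, 0))) +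
      (\<Sum>i\<in>UNIV. d $ i *\<^sub>R ?T ((0, 0), (0, axis i 1)))"
    by (simp only: lin)
  also have "\<dots> \<in> span (lattice_basis \<mu> P)"
    by (intro span_add span_sum span_scale span_base) (auto simp: lattice_basis_def)
  finally show ?thesis .
qed

definition basis_list :: "('n, 'm) G list" where
  "basis_list = (SOME bs. set bs = lattice_basis \<mu> P)"

lemma set_basis_list: "set basis_list = lattice_basis \<mu> P"
  unfolding basis_list_def using finite_list[OF finite_lattice_basis] by (rule someI_ex)

text \<open>An injective linear map in finite dimension is bounded below, and an integer vector of
  norm less than 1 is 0.\<close>

lemma lattice_discrete: "\<exists>\<delta>>0. \<forall>\<gamma>\<in>\<Gamma>. norm \<gamma> < \<delta> \<longrightarrow> \<gamma> = 0"
proof -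
  obtain \<delta> where \<delta>: "\<delta> > 0" "\<And>x. \<delta> * norm x \<le> norm (lattice_map \<mu> P x)"
    using linear_inj_bounded_below_pos[OF linear_lattice_map lattice_map_inj] by blast
  have "\<gamma> = 0" if \<gamma>: "\<gamma> \<in> \<Gamma>" "norm \<gamma> < \<delta>" for \<gamma>
  proof -
    obtain a b c d where x: "\<gamma> = lattice_map \<mu> P ((a, b), (c, d))"
      "a \<in> int_vecs" "b \<in> int_vecs" "c \<in> int_vecs" "d \<in> int_vecs"
      using \<gamma>(1) by (auto simp: \<Gamma>_eq Gamma_eq)
    have "\<delta> * norm ((a, b), (c, d)) < \<delta> * 1" using \<delta>(2)[of "((a, b), (c, d))"] \<gamma>(2) x(1) by simp
    then have n: "norm ((a, b), (c, d)) < 1" using \<delta>(1) by (simp only: mult_less_cancel_left_pos)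
    have z: "v = 0" if "v \<in> int_vecs" "norm v < 1" for v :: "real ^ ('z::finite \<times> bool)"
    proof -
      have "v $ i = 0" for i
      proof (rule Ints_nonzero_abs_less1)
        show "v $ i \<in> \<int>" using that(1) unfolding int_vecs_def by blast
        show "\<bar>v $ i\<bar> < 1" using that(2) component_le_norm_cart[of v i] by linarith
      qed
      then show ?thesis by (simp add: vec_eq_iff)
    qed
    have "norm (a, b) < 1" "norm (c, d) < 1"
      using n norm_fst_le[of "(a, b)" "(c, d)"] norm_snd_le[of "(c, d)" "(a, b)"] by linarith+
    then have "norm a < 1" "norm b < 1" "norm c < 1" "norm d < 1"
      using norm_fst_le[of a b] norm_snd_le[of b a] norm_fst_le[of c d] norm_snd_le[of d c] by linarith+
    then have "((a, b), (c, d)) = 0" using z[OF x(2)] z[OF x(3)] z[OF x(4)] z[OF x(5)] by (simp add: zero_prod_def)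
    then show ?thesis using linear_0[OF linear_lattice_map] x(1) by metis
  qed
  then show ?thesis using \<delta>(1) by blast
qed

sublocale mapping_torus height "stretch l" base_vec \<Gamma> basis_list
proof unfold_locales
  note lin = linear_add[OF linear_lattice_map, symmetric] linear_neg[OF linear_lattice_map, symmetric]
  show "(base_vec :: ('n, 'm) G) \<in> \<Gamma>"
  proof -
    have "base_vec = lattice_map \<mu> P ((axis (undefined, False) 1, 0), (0, 0))"
      by (simp add: base_vec_def lattice_map_def vec_eq_iff axis_def)
    then show ?thesis unfolding \<Gamma>_eq Gamma_eq by (rule image_eqI) simp
  qed
  show "\<gamma> + \<delta> \<in> \<Gamma>" if "\<gamma> \<in> \<Gamma>" "\<delta> \<in> \<Gamma>" for \<gamma> \<delta>
    using that unfolding \<Gamma>_eq Gamma_eq by (auto simp: lin int_vecs_add)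
  show "- \<gamma> \<in> \<Gamma>" if "\<gamma> \<in> \<Gamma>" for \<gamma>
    using that unfolding \<Gamma>_eq Gamma_eq by (auto simp: lin int_vecs_uminus)
  show "set basis_list \<subseteq> \<Gamma>"
    unfolding set_basis_list lattice_basis_def \<Gamma>_eq Gamma_eq by (auto intro!: imageI int_vecs_diff)
  show "height b = 0" if "b \<in> set basis_list" for b
    using that unfolding set_basis_list lattice_basis_def
    by (auto simp: height_lattice_map sum_subtractf axis_def)
qed (simp_all add: linear_add[OF linear_height] linear_scale[OF linear_height]
    linear_add[OF linear_stretch] linear_scale[OF linear_stretch] stretch_0 stretch_add height_stretch stretch_base_vec
    height_base_vec exp_a_fun(3) stretch_in set_basis_list span_lattice_basis lattice_discrete)

lemma proj_eq_cover: "proj l \<Gamma> = cover"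
  by (simp add: fun_eq_iff proj_def cover_def gmult_eq cong: image_cong)

lemma quotient_atlas_eq: "quotient_atlas l \<Gamma> = cover_atlas"
  by (simp add: quotient_atlas_def cover_atlas_def proj_eq_cover)

lemma descend_eq: "descend l \<Gamma> \<omega> = desc \<omega>"
  by (simp add: descend_def desc_def quotient_atlas_eq)

end


section \<open>The invariant coframe\<close>

text \<open>The four summands index dw, the conjugate of dw, dz and the conjugate of dz, in this order. Since each
  character trivializes its form, the generators of \<open>A_space\<close> are the constant coefficient forms of
  weight 0.\<close>

type_synonym ('n, 'm) idx = "(('n \<times> bool) + ('n \<times> bool)) + (('m \<times> bool) + ('m \<times> bool))"

primrec frame :: "('n::finite, 'm::finite) idx \<Rightarrow> ('n, 'm) G \<Rightarrow> complex" where
  "frame (Inl i) v = (case i of Inl a \<Rightarrow> fst v $ a | Inr a \<Rightarrow> cnj (fst v $ a))"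
| "frame (Inr i) v = (case i of Inl a \<Rightarrow> snd v $ a | Inr a \<Rightarrow> cnj (snd v $ a))"

text \<open>The exponent j for which \<open>stretch l 1\<close> scales the frame covector by exp (l
  j). It is the same for conjugate covectors because the scaling is real.\<close>

primrec weight :: "('n::finite, 'm::finite) idx \<Rightarrow> int" where
  "weight (Inl i) = 0"
| "weight (Inr i) = (if snd (case_sum id id i) then -1 else 1)"

primrec coframe :: "real \<Rightarrow> ('n::finite, 'm::finite) idx \<Rightarrow> ('n, 'm) G \<Rightarrow> ('n, 'm) G \<Rightarrow> complex" where
  "coframe l (Inl i) = case_sum phi phi_bar i"
| "coframe l (Inr i) = case_sum (psi l) (psi_bar l) i"

primrec coframe_char :: "real \<Rightarrow> ('n::finite, 'm::finite) idx \<Rightarrow> ('n, 'm) G \<Rightarrow> complex" where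
  "coframe_char l (Inl i) = case_sum char_phi char_phi_bar i"
| "coframe_char l (Inr i) = case_sum (char_psi l) (char_psi_bar l) i"

definition idx_list :: "('n::{finite,linorder} \<times> bool) set \<Rightarrow> ('n \<times> bool) set \<Rightarrow>
    ('m::{finite,linorder} \<times> bool) set \<Rightarrow> ('m \<times> bool) set \<Rightarrow> ('n, 'm) idx list" where
  "idx_list I J K H = map (Inl \<circ> Inl) (index_list I) @ map (Inl \<circ> Inr) (index_list J) @
     map (Inr \<circ> Inl) (index_list K) @ map (Inr \<circ> Inr) (index_list H)"

lemma set_index_list [simp]: "set (index_list I) = I"
  and distinct_index_list [simp]: "distinct (index_list I)"
  by (auto simp: index_list_def distinct_product UNIV_bool)

lemma length_index_list [simp]: "length (index_list I) = card I"
  using distinct_card[OF distinct_index_list[of I]] by simp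

lemma distinct_idx_list: "distinct (idx_list I J K H)"
  by (auto simp: idx_list_def distinct_map intro!: inj_onI)

lemma set_idx_list: "set (idx_list I J K H) = Inl ` (Inl ` I \<union> Inr ` J) \<union> Inr ` (Inl ` K \<union> Inr ` H)"
  by (auto simp: idx_list_def)

lemma length_idx_list: "length (idx_list I J K H) = card I + card J + card K + card H"
  by (simp add: idx_list_def)

lemma idx_list_exists: "\<exists>I J K H. set (idx_list I J K H) = S"
proof -
  have "set (idx_list {a. Inl (Inl a) \<in> S} {a. Inl (Inr a) \<in> S} {a. Inr (Inl a) \<in> S} {a. Inr (Inr a) \<in> S}) = S"
  proof (rule set_eqI)
    fix x
    show "x \<in> set (idx_list {a. Inl (Inl a) \<in> S} {a. Inl (Inr a) \<in> S} {a. Inr (Inl a) \<in> S} {a. Inr (Inr a) \<in> S})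
      \<longleftrightarrow> x \<in> S"
    proof -
      consider a where "x = Inl (Inl a)" | a where "x = Inl (Inr a)" | a where "x = Inr (Inl a)" | a where "x = Inr (Inr a)"
        by (metis sum.exhaust)
      then show ?thesis unfolding set_idx_list by cases auto
    qed
  qed
  then show ?thesis by blast
qed

lemma linear_frame: "linear (frame i)"
proof (rule linearI)
  show "frame i (x + y) = frame i x + frame i y" for x y
    by (cases i) (simp_all split: sum.split)
  show "frame i (r *\<^sub>R x) = r *\<^sub>R frame i x" for r x
    by (cases i) (simp_all add: scaleR_conv_of_real[where 'a = complex] split: sum.split)
qed

lemma frame_stretch: "frame i (stretch l c v) = exp (of_real (l * c * of_int (weight i))) * frame i v"
  by (cases i) (auto simp: stretch_def exp_of_real split: sum.split simp del: of_real_mult of_real_minus)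

lemma coframe_char_mult: "coframe_char l i g * coframe l i g v = frame i v"
  by (cases i) (auto split: sum.split simp: char_phi_def char_phi_bar_def phi_def phi_bar_def char_psi_def psi_def
      char_psi_bar_def psi_bar_def exp_cnj exp_minus mult.assoc[symmetric])

lemma alpha_eq_prod_list: "alpha l I J K H g = (\<Prod>i\<leftarrow>idx_list I J K H. coframe_char l i g)"
  by (simp add: alpha_def idx_list_def o_def prod.distinct_set_conv_list[symmetric] mult.assoc)

lemma coframe_wedge_eq: "coframe_wedge l I J K H = wedge (map (coframe l) (idx_list I J K H))"
  by (simp add: coframe_wedge_def idx_list_def o_def)

text \<open>Distributing the characters over the factors of the wedge product, one to each, removes
  the dependence on \<open>g\<close>.\<close>

lemma alpha_coframe_wedge:
  "alpha l I J K H g * coframe_wedge l I J K H g vs = wedge_const frame (idx_list I J K H) vs"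
proof (cases "length vs = length (idx_list I J K H)")
  case True
  let ?js = "idx_list I J K H"
  have "alpha l I J K H g = (\<Prod>i<length ?js. coframe_char l (?js ! i) g)"
    by (simp add: alpha_eq_prod_list prod.list_conv_set_nth atLeast0LessThan)
  moreover have "(\<Prod>i<length ?js. coframe_char l (?js ! i) g) * (\<Prod>i<length ?js. coframe l (?js ! i) g (vs ! \<pi> i)) =
      (\<Prod>i<length ?js. frame (?js ! i) (vs ! \<pi> i))" for \<pi>
    by (simp add: prod.distrib[symmetric] coframe_char_mult)
  ultimately show ?thesis using True
    by (simp add: coframe_wedge_eq wedge_def wedge_const_def sum_distrib_left mult.left_commute)
qed (simp add: coframe_wedge_eq wedge_def wedge_const_def)

lemma frame_combination:
  "\<exists>a. \<forall>v. c * frame i v + d * frame j v = (\<Sum>m\<in>UNIV. a m * frame m v)"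
proof (intro exI allI)
  fix v
  show "c * frame i v + d * frame j v =
    (\<Sum>m\<in>UNIV. ((if m = i then c else 0) + (if m = j then d else 0)) * frame m v)"
    by (simp add: distrib_right sum.distrib if_distrib[of "\<lambda>t. t * _"] cong: if_cong)
qed

text \<open>A coordinate and its conjugate recover the real and the imaginary part.\<close>

lemma frame_dual:
  assumes "b \<in> Basis"
  shows "\<exists>a. \<forall>v. of_real (v \<bullet> b) = (\<Sum>i\<in>UNIV. a i * frame i v)"
proof -
  have re: "of_real (Re z) = 1 / 2 * z + 1 / 2 * cnj z"
    and im: "of_real (Im z) = (- \<i> / 2) * z + (\<i> / 2) * cnj z" for z
    by (auto simp: complex_eq_iff)
  consider i where "b = (axis i 1, 0)" | i where "b = (axis i \<i>, 0)"
    | i where "b = (0, axis i 1)" | i where "b = (0, axis i \<i>)"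
    using assms by (auto simp: Basis_prod_def Basis_vec_def Basis_complex_def)
  then show ?thesis
  proof cases
    case (1 i)
    then have eq: "of_real (v \<bullet> b) = 1 / 2 * frame (Inl (Inl i)) v + 1 / 2 * frame (Inl (Inr i)) v" for v
      using re[of "fst v $ i"] by (cases v) (simp add: inner_axis inner_complex_def)
    show ?thesis unfolding eq by (rule frame_combination)
  next
    case (2 i)
    then have eq: "of_real (v \<bullet> b) = (- \<i> / 2) * frame (Inl (Inl i)) v + (\<i> / 2) * frame (Inl (Inr i)) v" for v
      using im[of "fst v $ i"] by (cases v) (simp add: inner_axis inner_complex_def)
    show ?thesis unfolding eq by (rule frame_combination)
  next
    case (3 i)
    then have eq: "of_real (v \<bullet> b) = 1 / 2 * frame (Inr (Inl i)) v + 1 / 2 * frame (Inr (Inr i)) v" for v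
      using re[of "snd v $ i"] by (cases v) (simp add: inner_axis inner_complex_def)
    show ?thesis unfolding eq by (rule frame_combination)
  next
    case (4 i)
    then have eq: "of_real (v \<bullet> b) = (- \<i> / 2) * frame (Inr (Inl i)) v + (\<i> / 2) * frame (Inr (Inr i)) v" for v
      using im[of "snd v $ i"] by (cases v) (simp add: inner_axis inner_complex_def)
    show ?thesis unfolding eq by (rule frame_combination)
  qed
qed

text \<open>Weights lie between -1 and 1, so in degrees up to \<open>p\<close> these cover the
  eigenvalues of \<open>stretch l 1\<close> other than 1.\<close>

definition eigenvalues :: "real \<Rightarrow> nat \<Rightarrow> complex list" where
  "eigenvalues l p = map (\<lambda>j. exp (of_real (l * of_int j))) (filter (\<lambda>j. j \<noteq> 0) [- int p..int p])"

lemma exp_of_real_eq_1: "exp (of_real x) = (1 :: complex) \<longleftrightarrow> x = 0"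
  by (simp add: exp_of_real)

lemma one_notin_eigenvalues:
  assumes "l \<noteq> 0"
  shows "1 \<notin> set (eigenvalues l p)"
proof
  assume "1 \<in> set (eigenvalues l p)"
  then obtain j where "j \<noteq> 0" "exp (of_real (l * of_int j)) = (1 :: complex)"
    unfolding eigenvalues_def by fastforce
  then show False unfolding exp_of_real_eq_1 using assms by simp
qed

lemma prod_list_exp_weight:
  "(\<Prod>i\<leftarrow>is. exp (of_real (r * of_int (weight i)))) = (exp (of_real (r * of_int (\<Sum>i\<leftarrow>is. weight i))) :: complex)"
  by (induction "is") (simp_all add: exp_add distrib_left)

lemma abs_sum_list_weight: "\<bar>\<Sum>i\<leftarrow>is. weight i\<bar> \<le> int (length is)"
proof (induction "is")
  case (Cons i "is")
  have "\<bar>weight i\<bar> \<le> 1" by (cases i) auto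
  then show ?case using Cons by simp
qed simp

lemma alternating_frame_expansion:
  fixes f :: "('n::finite, 'm::finite) G list \<Rightarrow> complex"
  assumes "alternating p f"
  shows "\<exists>c. \<forall>vs. f vs = (\<Sum>is | length is = p. c is * tens frame is vs)"
proof -
  have "\<exists>c. \<forall>vs. length vs = p \<longrightarrow> f vs = (\<Sum>is | length is = p. c is * tens frame is vs)"
    by (rule multilinear_expansion) (erule frame_dual, erule alternating_linear[OF assms])
  then obtain c where c: "\<And>vs. length vs = p \<Longrightarrow> f vs = (\<Sum>is | length is = p. c is * tens frame is vs)"
    by blast
  have "f vs = (\<Sum>is | length is = p. c is * tens frame is vs)" for vs
  proof (cases "length vs = p")
    case False
    then show ?thesis using alternating_length[OF assms] by (simp add: tens_length sum.neutral)
  qed (rule c)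
  then show ?thesis by blast
qed

lemma kill_eigen_frame:
  fixes f :: "('n::finite, 'm::finite) G list \<Rightarrow> complex"
  assumes "l \<noteq> 0" "p' \<le> p" "\<And>vs. f vs = (\<Sum>is | length is = p'. c is * tens frame is vs)"
  shows "kill_eigen (eigenvalues l p) (stretch l 1) f vs =
    (\<Sum>is | length is = p' \<and> (\<Sum>i\<leftarrow>is. weight i) = 0. c is * tens frame is vs)"
proof -
  let ?E = "\<lambda>i::('n, 'm) idx. exp (of_real (l * of_int (weight i))) :: complex"
  have one: "prod_list (map ?E is) = 1 \<longleftrightarrow> (\<Sum>i\<leftarrow>is. weight i) = 0" for "is"
    unfolding prod_list_exp_weight exp_of_real_eq_1 using assms(1) by simp
  have "kill_eigen (eigenvalues l p) (stretch l 1) f vs =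
    (\<Sum>is | length is = p' \<and> prod_list (map ?E is) = 1. c is * tens frame is vs)"
  proof (rule kill_eigen_eq_fixed_part)
    show "frame i (stretch l 1 v) = ?E i * frame i v" for i and v :: "('n, 'm) G"
      using frame_stretch[of i l 1 v] by simp
    show "f vs = (\<Sum>is | length is = p'. c is * tens frame is vs)" for vs by (rule assms(3))
    show "1 \<notin> set (eigenvalues l p)" by (rule one_notin_eigenvalues[OF assms(1)])
    show "prod_list (map ?E is) = 1 \<or> prod_list (map ?E is) \<in> set (eigenvalues l p)"
      if "length is = p'" for "is"
    proof (cases "(\<Sum>i\<leftarrow>is. weight i) = 0")
      case False
      moreover have "\<bar>\<Sum>i\<leftarrow>is. weight i\<bar> \<le> int p" using abs_sum_list_weight[of "is"] that assms(2) by linarith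
      ultimately show ?thesis unfolding prod_list_exp_weight eigenvalues_def by (auto simp: abs_le_iff)
    qed (simp only: one simp_thms)
  qed
  then show ?thesis by (simp only: one)
qed

lemma tens_frame_stretch:
  "tens frame is (map (stretch l r) vs) = exp (of_real (l * r * of_int (\<Sum>i\<leftarrow>is. weight i))) * tens frame is vs"
  unfolding prod_list_exp_weight[symmetric] by (rule tens_eigen) (rule frame_stretch)

lemma wedge_const_frame_stretch:
  "wedge_const frame is (map (stretch l r) vs) =
    exp (of_real (l * r * of_int (\<Sum>i\<leftarrow>is. weight i))) * wedge_const frame is vs"
proof (cases "length vs = length is")
  case True
  then show ?thesis
    by (auto simp: wedge_const_eq_tens permute_list_map tens_frame_stretch sum_distrib_left mult.left_commute
        intro!: sum.cong)
qed (simp add: wedge_const_def)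

section \<open>Constant coefficient invariant forms and the generators of
  \<open>A_space\<close>\<close>

context solvmanifold
begin

lemma kill_eigen_invariant:
  fixes f :: "('n, 'm) G list \<Rightarrow> complex"
  assumes "p' \<le> p" "alternating p' f"
  shows "kill_eigen (eigenvalues l p) (stretch l 1) f (map (stretch l 1) vs) =
    kill_eigen (eigenvalues l p) (stretch l 1) f vs"
proof -
  obtain c where c: "\<And>vs. f vs = (\<Sum>is | length is = p'. c is * tens frame is vs)"
    using alternating_frame_expansion[OF assms(2)] by blast
  show ?thesis unfolding kill_eigen_frame[OF l_nonzero assms(1) c]
    by (intro sum.cong refl) (simp add: tens_frame_stretch)
qed

lemma coframe_char_lattice:
  "\<gamma> \<in> \<Gamma> \<Longrightarrow> coframe_char l i \<gamma> = exp (of_real (l * height \<gamma> * of_int (weight i)))"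
  by (cases i) (auto split: sum.split simp: char_phi_def char_phi_bar_def char_psi_def char_psi_bar_def
      exp_minus exp_a_fun exp_of_real of_real_inverse simp del: of_real_mult)

text \<open>At a lattice element of height h the character is exp (l h W) with the total weight W;
  \<open>base_vec\<close>, with h = 1, detects whether W is 0.\<close>

lemma alpha_eq_1_iff:
  "(\<forall>g\<in>\<Gamma>. alpha l I J K H g = 1) \<longleftrightarrow> (\<Sum>i\<leftarrow>idx_list I J K H. weight i) = 0"
proof -
  let ?W = "\<Sum>i\<leftarrow>idx_list I J K H. weight i"
  have *: "alpha l I J K H g = exp (of_real (l * height g * of_int ?W))" if "g \<in> \<Gamma>" for g
    unfolding alpha_eq_prod_list by (simp only: coframe_char_lattice[OF that] prod_list_exp_weight)
  show ?thesis
  proof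
    assume "\<forall>g\<in>\<Gamma>. alpha l I J K H g = 1"
    then have "exp (of_real (l * of_int ?W)) = (1::complex)"
      using *[OF e_in] e_in by (simp add: height_base_vec)
    then show "?W = 0" unfolding exp_of_real_eq_1 using l_nonzero by simp
  qed (simp add: *)
qed

lemma invariant_frame_expansion:
  fixes f :: "('n, 'm) G list \<Rightarrow> complex"
  assumes "alternating p f" "\<And>vs. f (map (stretch l 1) vs) = f vs"
  shows "\<exists>c. \<forall>vs. f vs = (\<Sum>is | length is = p \<and> (\<Sum>i\<leftarrow>is. weight i) = 0. c is * tens frame is vs)"
proof -
  obtain c where c: "\<And>vs. f vs = (\<Sum>is | length is = p. c is * tens frame is vs)"
    using alternating_frame_expansion[OF assms(1)] by blast
  have "kill_eigen (eigenvalues l p) (stretch l 1) f = f"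
    by (rule kill_eigen_fixed[OF _ one_notin_eigenvalues[OF l_nonzero]]) (rule assms(2))
  then show ?thesis using kill_eigen_frame[OF l_nonzero order_refl c] by auto
qed

lemma constforms_iff:
  "\<omega> \<in> constforms p \<longleftrightarrow> (\<exists>f. \<omega> = (\<lambda>x. f) \<and> alternating p f \<and> (\<forall>vs. f (map (stretch l 1) vs) = f vs))"
proof
  assume \<omega>: "\<omega> \<in> constforms p"
  then have inv: "\<omega> \<in> invforms p" and c: "\<And>x. \<omega> x = \<omega> 0" unfolding constforms_def by blast+
  have "\<omega> 0 (map (stretch l 1) vs) = \<omega> 0 vs" for vs
  proof -
    have "\<omega> 0 vs = act base_vec \<omega> 0 vs" using invforms_act[OF inv e_in] by simp
    also have "\<dots> = \<omega> (stretch l 1 0 + base_vec) (map (stretch l 1) vs)"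
      by (simp add: act_def pullback_affine_def height_base_vec)
    also have "\<dots> = \<omega> 0 (map (stretch l 1) vs)" by (rule fun_cong[OF c])
    finally show ?thesis ..
  qed
  then show "\<exists>f. \<omega> = (\<lambda>x. f) \<and> alternating p f \<and> (\<forall>vs. f (map (stretch l 1) vs) = f vs)"
    using forms_alternating[OF invforms_forms[OF inv], of 0] c by (intro exI[of _ "\<omega> 0"]) blast
next
  assume "\<exists>f. \<omega> = (\<lambda>x. f) \<and> alternating p f \<and> (\<forall>vs. f (map (stretch l 1) vs) = f vs)"
  then obtain f where f: "\<omega> = (\<lambda>x. f)" "alternating p f" "\<And>vs. f (map (stretch l 1) vs) = f vs" by blast
  obtain c where f_eq: "\<And>vs. f vs =
      (\<Sum>is | length is = p \<and> (\<Sum>i\<leftarrow>is. weight i) = 0. c is * tens frame is vs)"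
    using invariant_frame_expansion[OF f(2,3)] by blast
  \<comment> \<open>Invariance under \<open>stretch l 1\<close> alone leaves only monomials of
    weight 0, and on these every \<open>stretch l r\<close> acts trivially.\<close>
  have "f (map (stretch l r) vs) = f vs" for r vs
    unfolding f_eq by (intro sum.cong refl) (simp add: tens_frame_stretch)
  then have "\<omega> \<in> invforms p"
    using f(2) by (intro invformsI) (auto simp: forms_iff f(1) act_def pullback_affine_def)
  then show "\<omega> \<in> constforms p" by (simp add: constforms_def f(1))
qed

lemma generator_constforms:
  assumes "length is = p" "(\<Sum>i\<leftarrow>is. weight i) = 0"
  shows "(\<lambda>x. wedge_const frame is) \<in> constforms p"
  unfolding constforms_iff
  using alternating_wedge_const[of frame "is", OF linear_frame] assms
  by (intro exI[of _ "wedge_const frame is"]) (simp add: wedge_const_frame_stretch)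

lemma A_space_eq: "A_space l \<Gamma> p = desc ` constforms p"
proof -
  define S where "S = {desc (\<lambda>x. wedge_const frame (idx_list I J K H)) | I J K H.
    (\<Sum>i\<leftarrow>idx_list I J K H. weight i) = 0 \<and> length (idx_list I J K H) = p}"
  have A: "A_space l \<Gamma> p = mform.span S"
    unfolding A_space_def S_def descend_eq alpha_eq_1_iff alpha_coframe_wedge length_idx_list ..
  have "mform.span S \<subseteq> desc ` constforms p"
  proof (rule mform.span_minimal)
    show "S \<subseteq> desc ` constforms p" unfolding S_def using generator_constforms by blast
    show "mform.subspace (desc ` constforms p)"
    proof (rule mform.subspaceI)
      have "0 \<in> constforms p" using invforms_zero by (simp add: constforms_def)
      then show "0 \<in> desc ` constforms p" using desc_zero by (metis image_eqI)
      fix x y z assume "x \<in> desc ` constforms p"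
      then obtain \<omega> where \<omega>: "\<omega> \<in> constforms p" "x = desc \<omega>" by blast
      have "fscale z \<omega> \<in> constforms p"
        using \<omega>(1) invforms_fscale by (auto simp: constforms_def fscale_def)
      then show "mscale z x \<in> desc ` constforms p" using \<omega>(2) desc_fscale by (metis image_eqI)
      assume "y \<in> desc ` constforms p"
      then obtain \<eta> where \<eta>: "\<eta> \<in> constforms p" "y = desc \<eta>" by blast
      have "(\<omega> + \<eta>) u = (\<omega> + \<eta>) 0" for u
      proof -
        have "\<omega> u = \<omega> 0" "\<eta> u = \<eta> 0" using \<omega>(1) \<eta>(1) unfolding constforms_def by blast+
        then show ?thesis by simp
      qed
      then have "\<omega> + \<eta> \<in> constforms p"
        using \<omega>(1) \<eta>(1) invforms_add[of \<omega> p \<eta>] unfolding constforms_def by blast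
      then show "x + y \<in> desc ` constforms p" using \<omega>(2) \<eta>(2) desc_add by (metis image_eqI)
    qed
  qed
  moreover have "desc \<omega> \<in> mform.span S" if "\<omega> \<in> constforms p" for \<omega>
  proof -
    obtain f where f: "\<omega> = (\<lambda>x. f)" "alternating p f" "\<And>vs. f (map (stretch l 1) vs) = f vs"
      using constforms_iff[THEN iffD1, OF \<open>\<omega> \<in> constforms p\<close>] by blast
    let ?T = "{is. length is = p \<and> (\<Sum>i\<leftarrow>is. weight i) = 0} :: ('n, 'm) idx list set"
    obtain c where c: "\<And>vs. f vs = (\<Sum>is\<in>?T. c is * tens frame is vs)"
      using invariant_frame_expansion[OF f(2,3)] by blast
    have fin: "finite ?T" by (rule finite_subset[OF _ finite_lists_of_length[of p]]) auto
    have f_eq: "f vs = (\<Sum>is\<in>?T. c is / fact p * wedge_const frame is vs)" for vs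
      by (rule alternating_eq_sum_wedge_const[OF f(2) fin _ c]) auto
    \<comment> \<open>A list with a repetition gives 0; any other is a reordering of the standard
      list of its four multiindices, which costs only a scalar.\<close>
    have gen: "desc (\<lambda>x. wedge_const frame is) \<in> mform.span S" if "is \<in> ?T" for "is"
    proof (cases "distinct is")
      case False
      then have "(\<lambda>x. wedge_const frame is) = (0 :: ('n, 'm) G form)"
        by (intro ext) (simp add: wedge_const_not_distinct)
      then show ?thesis by (simp only: desc_zero mform.span_zero)
    next
      case True
      obtain I J K H where S: "set (idx_list I J K H) = set is"
        using idx_list_exists[of "set is"] by blast
      let ?js = "idx_list I J K H"
      have mset: "mset ?js = mset is"
        using S True distinct_idx_list set_eq_iff_mset_eq_distinct by blast
      then have "length ?js = p" "(\<Sum>i\<leftarrow>?js. weight i) = 0"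
        using \<open>is \<in> ?T\<close> mset_eq_length[OF mset] by (auto simp flip: sum_mset_sum_list)
      then have "desc (\<lambda>x. wedge_const frame ?js) \<in> S" unfolding S_def by blast
      then have js: "desc (\<lambda>x. wedge_const frame ?js) \<in> mform.span S" by (rule mform.span_base)
      obtain z where "\<And>vs :: ('n, 'm) G list. wedge_const frame is vs = z * wedge_const frame ?js vs"
        using wedge_const_reorder[OF True distinct_idx_list S[symmetric]] by blast
      then have "(\<lambda>x. wedge_const frame is) = (fscale z (\<lambda>x. wedge_const frame ?js) :: ('n, 'm) G form)"
        by (simp add: fscale_def fun_eq_iff)
      then show ?thesis using mform.span_scale[OF js] by (simp only: desc_fscale)
    qed
    have "desc \<omega> = (\<Sum>is\<in>?T. mscale (c is / fact p) (desc (\<lambda>x. wedge_const frame is)))"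
    proof -
      have "desc (\<lambda>x vs. \<Sum>is\<in>U. g is * h is vs) = (\<Sum>is\<in>U. mscale (g is) (desc (\<lambda>x. h is)))"
        if "finite U" for U :: "('n, 'm) idx list set" and g h
        using that
      proof (induction U rule: finite_induct)
        case empty
        have "(\<lambda>x vs. 0) = (0 :: ('n, 'm) G form)" by (simp add: fun_eq_iff)
        then show ?case by (simp add: desc_zero)
      next
        case (insert i U)
        have "(\<lambda>x vs. \<Sum>is\<in>insert i U. g is * h is vs) =
            fscale (g i) (\<lambda>x. h i) + (\<lambda>x vs. \<Sum>is\<in>U. g is * h is vs)"
          using insert by (simp add: fun_eq_iff fscale_def)
        then show ?case by (simp only: desc_add desc_fscale insert.IH sum.insert[OF insert.hyps])
      qed
      from this[OF fin, of "\<lambda>is. c is / fact p" "wedge_const frame"]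
      show ?thesis unfolding f(1) f_eq[abs_def] .
    qed
    also have "\<dots> \<in> mform.span S" by (intro mform.span_sum mform.span_scale gen)
    finally show ?thesis .
  qed
  ultimately show ?thesis unfolding A by blast
qed

end

theorem proposition3p1:
  fixes M :: "int ^ ('m::{finite,linorder} \<times> bool) ^ ('m \<times> bool)"
    and P :: "real ^ ('m \<times> bool) ^ ('m \<times> bool)"
    and l :: real
    and k :: "'n::{finite,linorder} \<times> bool \<Rightarrow> int"
    and \<mu> :: "real ^ ('n \<times> bool) ^ ('n \<times> bool)"
    and \<Gamma> :: "('n, 'm) G set"
  assumes "det M = 1"
    and "invertible P"
    and "l \<noteq> 0"
    and "P ** map_matrix real_of_int M ** matrix_inv P =
           diag_mat (\<chi> i. if snd i then exp (- l) else exp l)"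
    and "\<forall>i. k i \<noteq> 0"
    and "\<mu> = diag_mat (\<chi> i. 2 * real_of_int (k i) * pi / l)"
    and "\<Gamma> = Gamma \<mu> P"
  shows "\<exists>\<Phi>. \<forall>p. linear_iso
           (de_Rham (quotient_atlas l \<Gamma>) p) (class_scale (quotient_atlas l \<Gamma>) p)
           (A_space l \<Gamma> p) mscale (\<Phi> p)"
proof -
  interpret solvmanifold M P l k \<mu> \<Gamma> by unfold_locales (rule assms)+
  \<comment> \<open>The eigenvalue list depends on \<open>p\<close>, and so does the projection; the
    isomorphism is chosen degree by degree.\<close>
  have "\<exists>\<Phi>. linear_iso (de_Rham cover_atlas p) (class_scale cover_atlas p) (desc ` constforms p) mscale \<Phi>" for p
    by (rule de_Rham_iso[OF one_notin_eigenvalues[OF l_nonzero, of p]]) (rule kill_eigen_invariant)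
  then show ?thesis unfolding quotient_atlas_eq A_space_eq by (rule choice[OF allI])
qed

end
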